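(* Let $p$ be an odd prime and let $H_1,H_2\le\mathrm{GL}_2(\mathbb{Z}/p^2\mathbb{Z})$ with $\varphi(H_i)\le C_s(p)$ for $i=1,2$. Then $H_1$ and $H_2$ are nontrivially locally conjugate in $\mathrm{GL}_2(\mathbb{Z}/p^2\mathbb{Z})$ if and only if there exist subgroups $D,D'\le C_s(p^2)$ which are diagonal swaps with $D\neq D'$ such that $H_1$ and $H_2$ are, in some order, conjugate in $\mathrm{GL}_2(\mathbb{Z}/p^2\mathbb{Z})$ to $$\left\langle D,\ I+\begin{pmatrix}0&1\\0&0\end{pmatrix}p\right\rangle\quad\text{and}\quad\left\langle D',\ I+\begin{pmatrix}0&1\\0&0\end{pmatrix}p\right\rangle.$$
   Context: Subgroups $H_1,H_2$ of a group $G$ are locally conjugate in $G$ if there is a bijection $f:H_1\to H_2$ such that $h$ and $f(h)$ are conjugate in $G$ for all $h\in H_1$; they are nontrivially locally conjugate in $G$ if moreover they are not conjugate in $G$. $\varphi:\mathrm{GL}_2(\mathbb{Z}/p^2\mathbb{Z})\to\mathrm{GL}_2(\mathbb{Z}/p\mathbb{Z})$ is reduction modulo $p$. $C_s(p^k)$ is the group of diagonal matrices in $\mathrm{GL}_2(\mathbb{Z}/p^k\mathbb{Z})$. For $A\in\mathrm{Mat}_2(\mathbb{Z}/p\mathbb{Z})$, $I+Ap$ means $I+p\tilde A\in\mathrm{GL}_2(\mathbb{Z}/p^2\mathbb{Z})$ for any lift $\tilde A$ of $A$. Two groups $D,D'$ of diagonal matrices are diagonal swaps if $\begin{pmatrix}w&0\\0&z\end{pmatrix}\in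 D$ exactly when $\begin{pmatrix}z&0\\0&w\end{pmatrix}\in D'$. *)

theory Defs
  imports "HOL-Analysis.Determinants" "HOL-Number_Theory.Residues"
begin

definition conjugate_elems :: "('a, 'b) monoid_scheme \<Rightarrow> 'a \<Rightarrow> 'a \<Rightarrow> bool" where
  "conjugate_elems G x y \<longleftrightarrow> (\<exists>g\<in>carrier G. y = g \<otimes>\<^bsub>G\<^esub> x \<otimes>\<^bsub>G\<^esub> inv\<^bsub>G\<^esub> g)"

definition conjugate_subgroups :: "('a, 'b) monoid_scheme \<Rightarrow> 'a set \<Rightarrow> 'a set \<Rightarrow> bool" where
  "conjugate_subgroups G H K \<longleftrightarrow>
     (\<exists>g\<in>carrier G. K = (\<lambda>h. g \<otimes>\<^bsub>G\<^esub> h \<otimes>\<^bsub>G\<^esub> inv\<^bsub>G\<^esub> g) ` H)"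

definition locally_conjugate :: "('a, 'b) monoid_scheme \<Rightarrow> 'a set \<Rightarrow> 'a set \<Rightarrow> bool" where
  "locally_conjugate G H K \<longleftrightarrow>
     (\<exists>f. bij_betw f H K \<and> (\<forall>h\<in>H. conjugate_elems G h (f h)))"

definition nontrivially_locally_conjugate ::
  "('a, 'b) monoid_scheme \<Rightarrow> 'a set \<Rightarrow> 'a set \<Rightarrow> bool" where
  "nontrivially_locally_conjugate G H K \<longleftrightarrow>
     locally_conjugate G H K \<and> \<not> conjugate_subgroups G H K"

definition mat2_monoid :: "('a, 'b) ring_scheme \<Rightarrow> ('a^2^2) monoid" where
  "mat2_monoid R =
     \<lparr>carrier = {A. \<forall>i j. A $ i $ j \<in> carrier R},
      mult = (\<lambda>A B. \<chi> i j. \<Oplus>\<^bsub>R\<^esub>k\<in>UNIV. A $ i $ k \<otimes>\<^bsub>R\<^esub> B $ k $ j),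
      one = (\<chi> i j. if i = j then \<one>\<^bsub>R\<^esub> else \<zero>\<^bsub>R\<^esub>)\<rparr>"

text \<open>Elements of \<open>\<int>/n\<int>\<close> are represented by their residues in \<open>{0..n - 1}\<close>,
  as in \<^const>\<open>residue_ring\<close>.\<close>

definition GL2 :: "nat \<Rightarrow> (int^2^2) monoid" where
  "GL2 n = units_of (mat2_monoid (residue_ring (int n)))"

definition mat2_mod :: "nat \<Rightarrow> int^2^2 \<Rightarrow> int^2^2" where
  "mat2_mod n A = (\<chi> i j. A $ i $ j mod int n)"

definition diag2 :: "int \<Rightarrow> int \<Rightarrow> int^2^2" where
  "diag2 w z = vector [vector [w, 0], vector [0, z]]"

definition split_Cartan :: "nat \<Rightarrow> (int^2^2) set" where
  "split_Cartan n = {A \<in> carrier (GL2 n). \<exists>w z. A = diag2 w z}"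

definition diagonal_swaps :: "(int^2^2) set \<Rightarrow> (int^2^2) set \<Rightarrow> bool" where
  "diagonal_swaps D D' \<longleftrightarrow> (\<forall>w z. diag2 w z \<in> D \<longleftrightarrow> diag2 z w \<in> D')"

text \<open>The element \<open>I + Ap\<close> of \<open>GL\<^sub>2(\<int>/p\<^sup>2\<int>)\<close>, where the integer matrix \<open>A\<close>
  stands for its class modulo \<open>p\<close>; the choice of the lift does not matter, see
  \<open>I_plus_cong\<close> below.\<close>

definition I_plus :: "nat \<Rightarrow> int^2^2 \<Rightarrow> int^2^2" where
  "I_plus p A = mat2_mod (p\<^sup>2) (\<chi> i j. (mat 1 :: int^2^2) $ i $ j + int p * A $ i $ j)"

definition E12 :: "int^2^2" where
  "E12 = vector [vector [0, 1], vector [0, 0]]"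

lemma I_plus_cong:
  assumes "mat2_mod p A = mat2_mod p B"
  shows "I_plus p A = I_plus p B"
proof -
  have "(int p * A $ i $ j) mod int (p\<^sup>2) = (int p * B $ i $ j) mod int (p\<^sup>2)" for i j
    using assms by (simp add: mat2_mod_def vec_eq_iff power2_eq_square flip: mult_mod_right)
  then show ?thesis
    unfolding I_plus_def mat2_mod_def vec_eq_iff
    by (simp only: vec_lambda_beta) (blast intro: mod_add_cong)
qed

lemma (in cring) mat2_monoid_is_monoid: "Group.monoid (mat2_monoid R)"
proof (rule Group.monoid.intro)
  let ?M = "mat2_monoid R"
  have fs: "(\<Oplus>k\<in>(UNIV::2 set). f k) = f 1 \<oplus> f 2" if "\<And>k. f k \<in> carrier R" for f
    using that by (simp add: UNIV_2)
  have sel: "carrier ?M = {A. \<forall>i j. A $ i $ j \<in> carrier R}"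
    "\<one>\<^bsub>?M\<^esub> = (\<chi> i j. if i = j then \<one> else \<zero>)"
    by (simp_all add: mat2_monoid_def)
  have mult: "(A \<otimes>\<^bsub>?M\<^esub> B) $ i $ j = A $ i $ 1 \<otimes> B $ 1 $ j \<oplus> A $ i $ 2 \<otimes> B $ 2 $ j"
    if "A \<in> carrier ?M" "B \<in> carrier ?M" for A B i j
    using that by (simp add: mat2_monoid_def fs)
  show closed: "A \<otimes>\<^bsub>?M\<^esub> B \<in> carrier ?M"
    if "A \<in> carrier ?M" "B \<in> carrier ?M" for A B
  proof -
    have "(A \<otimes>\<^bsub>?M\<^esub> B) $ i $ j \<in> carrier R" for i j
      using that by (simp only: mult) (simp add: sel)
    then show ?thesis by (simp add: sel)
  qed
  show one: "\<one>\<^bsub>?M\<^esub> \<in> carrier ?M"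
    by (simp add: sel)
  show "(A \<otimes>\<^bsub>?M\<^esub> B) \<otimes>\<^bsub>?M\<^esub> C = A \<otimes>\<^bsub>?M\<^esub> (B \<otimes>\<^bsub>?M\<^esub> C)"
    if "A \<in> carrier ?M" "B \<in> carrier ?M" "C \<in> carrier ?M" for A B C
    unfolding vec_eq_iff mult[OF closed[OF that(1,2)] that(3)]
      mult[OF that(1) closed[OF that(2,3)]] mult[OF that(1,2)] mult[OF that(2,3)]
    using that by (simp add: sel l_distr r_distr m_assoc a_ac)
  show "\<one>\<^bsub>?M\<^esub> \<otimes>\<^bsub>?M\<^esub> A = A" if "A \<in> carrier ?M" for A
    unfolding vec_eq_iff mult[OF one that]
    using that by (auto simp: sel forall_2)
  show "A \<otimes>\<^bsub>?M\<^esub> \<one>\<^bsub>?M\<^esub> = A" if "A \<in> carrier ?M" for A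
    unfolding vec_eq_iff mult[OF that one]
    using that by (auto simp: sel forall_2)
qed

lemma group_GL2: "n > 1 \<Longrightarrow> group (GL2 n)"
  unfolding GL2_def
  by (intro Group.monoid.units_group cring.mat2_monoid_is_monoid residues.cring)
     (simp add: residues_def)

end

theory Submission
  imports Defs "HOL-Number_Theory.Euler_Criterion"
begin

text \<open>
  Write \<open>G\<close> for \<open>GL\<^sub>2(\<int>/p\<^sup>2\<int>)\<close>. The kernel of reduction modulo \<open>p\<close> is identified by
  \<open>A \<mapsto> I + pA\<close> with the additive group of matrices over the field \<open>\<int>/p\<int>\<close>, on which \<open>G\<close> acts by
  conjugation. For a subgroup \<open>H\<close> of \<open>G\<close> let \<open>V(H)\<close> be the space of all \<open>A\<close> with \<open>I + pA \<in> H\<close>.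

  The group \<open>\<langle>D, I + pE\<^sub>1\<^sub>2\<rangle>\<close> consists of the upper triangular matrices with diagonal in \<open>D\<close> and
  upper right entry divisible by \<open>p\<close>. Interchanging the diagonal entries of such a matrix leaves it
  in its conjugacy class (\<open>upper_conjugate_swap\<close>), so diagonal swaps give locally conjugate groups.
  A matrix conjugating one of these groups to the other preserves the line of \<open>E\<^sub>1\<^sub>2\<close>, is therefore
  upper triangular modulo \<open>p\<close>, and preserves the diagonal entries in their order. Thus it
  exists only if \<open>D = D'\<close> (\<open>upper_group_conjugate_imp_eq\<close>).

  For the converse let \<open>H\<close> and \<open>K\<close> be locally conjugate. If \<open>H\<close> reduces to scalar matrices, so does
  \<open>K\<close>. Then both are products of a common central group of scalars with \<open>V(H)\<close> and \<open>V(K)\<close>, and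
  one has to compare locally conjugate spaces of matrices (\<open>scalar_resolved\<close>). Dimensions 0, 1 and
  4 are clear. A counting argument going back to Gassmann shows that locally conjugate hyperplanes
  of an invariant space are conjugate (\<open>locally_conjugate_hyperplanes\<close>); it settles dimension 3 and
  the planes of trace zero. A plane containing \<open>I\<close> is determined by one further element. Any other
  plane is spanned by \<open>Z\<close> and \<open>I + Y\<close> with \<open>Z\<close> and \<open>Y\<close> of trace zero, and local conjugacy compares
  the determinants on \<open>Y + \<langle>Z\<rangle>\<close>. They determine the plane up to conjugacy except for
  \<open>\<langle>E\<^sub>1\<^sub>2, diag(1 + y, 1 - y)\<rangle>\<close>, of which they only see \<open>y\<^sup>2\<close>. The sign of \<open>y\<close> is the first source of
  swapped pairs.

  Otherwise each group contains a matrix with two different eigenvalues modulo \<open>p\<close>, which can be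
  assumed diagonal. Then the group is the product of its diagonal part \<open>D\<close> and of the space \<open>W\<close> of
  antidiagonal matrices in \<open>V\<close> (\<open>regular_split_decompose\<close>). Local conjugacy determines
  \<open>D\<close> up to the swap (\<open>diagonals_eq\<close>), so after a conjugation by the permutation matrix both
  groups have the same \<open>D\<close>. If the spaces \<open>W\<close> are lines \<open>\<langle>yE\<^sub>1\<^sub>2 + zE\<^sub>2\<^sub>1\<rangle>\<close>, the class of \<open>yz\<close> modulo squares
  is an invariant (\<open>antidiagonal_lines_similar\<close>), and lines with the same class are conjugate by
  diagonal matrices unless \<open>yz = 0\<close>. This leaves the lines of \<open>E\<^sub>1\<^sub>2\<close> and \<open>E\<^sub>2\<^sub>1\<close>, which the permutation
  matrix exchanges at the price of swapping \<open>D\<close>.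
\<close>

section \<open>Conjugation and local conjugacy\<close>

definition conjugation :: "('a, 'b) monoid_scheme \<Rightarrow> 'a \<Rightarrow> 'a \<Rightarrow> 'a" where
  "conjugation G g x = g \<otimes>\<^bsub>G\<^esub> x \<otimes>\<^bsub>G\<^esub> inv\<^bsub>G\<^esub> g"

context group
begin

lemma conjugation_closed [simp]:
  "g \<in> carrier G \<Longrightarrow> x \<in> carrier G \<Longrightarrow> conjugation G g x \<in> carrier G"
  by (simp add: conjugation_def)

lemma conjugation_eq_iff:
  assumes "g \<in> carrier G" "x \<in> carrier G" "y \<in> carrier G"
  shows "conjugation G g x = y \<longleftrightarrow> g \<otimes> x = y \<otimes> g"
  using assms inv_solve_right[of y "g \<otimes> x" g] by (auto simp: conjugation_def)

lemma conjugation_one [simp]: "x \<in> carrier G \<Longrightarrow> conjugation G \<one> x = x"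
  by (simp add: conjugation_def)

lemma conjugation_of_one [simp]: "g \<in> carrier G \<Longrightarrow> conjugation G g \<one> = \<one>"
  by (simp add: conjugation_def)

lemma conjugation_conjugation:
  "\<lbrakk>g \<in> carrier G; h \<in> carrier G; x \<in> carrier G\<rbrakk> \<Longrightarrow>
    conjugation G g (conjugation G h x) = conjugation G (g \<otimes> h) x"
  by (simp add: conjugation_def m_assoc inv_mult_group)

lemma conjugation_mult:
  "\<lbrakk>g \<in> carrier G; x \<in> carrier G; y \<in> carrier G\<rbrakk> \<Longrightarrow>
    conjugation G g (x \<otimes> y) = conjugation G g x \<otimes> conjugation G g y"
  by (smt (verit) conjugation_closed conjugation_eq_iff m_assoc m_closed)

lemma conjugation_inv:
  "\<lbrakk>g \<in> carrier G; x \<in> carrier G\<rbrakk> \<Longrightarrow> conjugation G g (inv x) = inv (conjugation G g x)"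
  by (metis conjugation_closed conjugation_mult conjugation_of_one inv_closed l_inv inv_equality)

lemma conjugation_inv_cancel [simp]:
  "\<lbrakk>g \<in> carrier G; x \<in> carrier G\<rbrakk> \<Longrightarrow> conjugation G (inv g) (conjugation G g x) = x"
  "\<lbrakk>g \<in> carrier G; x \<in> carrier G\<rbrakk> \<Longrightarrow> conjugation G g (conjugation G (inv g) x) = x"
  by (simp_all add: conjugation_conjugation)

lemma inj_on_conjugation: "g \<in> carrier G \<Longrightarrow> inj_on (conjugation G g) (carrier G)"
  by (metis conjugation_inv_cancel(1) inj_onI)

lemma finite_subgroupI:
  assumes fin: "finite (carrier G)" and S: "S \<subseteq> carrier G" "S \<noteq> {}"
    and closed: "\<And>a b. a \<in> S \<Longrightarrow> b \<in> S \<Longrightarrow> a \<otimes> b \<in> S"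
  shows "subgroup S G"
proof -
  have sol: "\<exists>x\<in>S. a \<otimes> x = b" if ab: "a \<in> S" "b \<in> S" for a b
  proof -
    have "inj_on ((\<otimes>) a) S"
      using S(1) ab(1) by (intro inj_onI) (metis Units_eq Units_l_cancel subsetD)
    then have "(\<otimes>) a ` S = S"
      using closed ab(1) S(1) fin by (intro endo_inj_surj) (auto intro: finite_subset)
    then show ?thesis
      using ab(2) by (metis imageE)
  qed
  obtain a where a: "a \<in> S"
    using S(2) by blast
  obtain e where "e \<in> S" "a \<otimes> e = a"
    using sol[OF a a] by blast
  then have one: "\<one> \<in> S"
    using a S(1) l_cancel_one by blast
  show ?thesis
  proof (rule subgroupI[OF S _ closed])
    fix b assume b: "b \<in> S"
    then obtain x where x: "x \<in> S" "b \<otimes> x = \<one>"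
      using sol one by blast
    then have "inv x = b"
      using b S(1) by (intro inv_equality) auto
    then show "inv b \<in> S"
      using x(1) S(1) by force
  qed
qed

lemma conjugation_image_subgroup:
  assumes "subgroup H G" "g \<in> carrier G"
  shows "subgroup (conjugation G g ` H) G"
proof (rule subgroupI)
  show "conjugation G g ` H \<subseteq> carrier G"
    using assms subgroup.mem_carrier[OF assms(1)] by auto
  show "conjugation G g ` H \<noteq> {}"
    using subgroup.one_closed[OF assms(1)] by auto
  show "inv a \<in> conjugation G g ` H" if "a \<in> conjugation G g ` H" for a
    using that assms subgroup.mem_carrier[OF assms(1)] subgroup.m_inv_closed[OF assms(1)]
    by (auto simp flip: conjugation_inv)
  show "a \<otimes> b \<in> conjugation G g ` H"
    if "a \<in> conjugation G g ` H" "b \<in> conjugation G g ` H" for a b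
    using that assms subgroup.mem_carrier[OF assms(1)] subgroup.m_closed[OF assms(1)]
    by (auto simp flip: conjugation_mult)
qed

lemma conjugate_elems_iff:
  "conjugate_elems G x y \<longleftrightarrow> (\<exists>g\<in>carrier G. y = conjugation G g x)"
  by (simp add: conjugate_elems_def conjugation_def)

lemma conjugate_subgroups_iff:
  "conjugate_subgroups G H K \<longleftrightarrow> (\<exists>g\<in>carrier G. K = conjugation G g ` H)"
  by (simp add: conjugate_subgroups_def conjugation_def[abs_def])

lemma conjugate_subgroupsI:
  "g \<in> carrier G \<Longrightarrow> conjugate_subgroups G H (conjugation G g ` H)"
  by (auto simp: conjugate_subgroups_iff)

lemma conjugate_elems_sym:
  "\<lbrakk>x \<in> carrier G; conjugate_elems G x y\<rbrakk> \<Longrightarrow> conjugate_elems G y x"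
  unfolding conjugate_elems_iff by (metis conjugation_inv_cancel(1) inv_closed)

lemma conjugate_elems_trans:
  "\<lbrakk>x \<in> carrier G; conjugate_elems G x y; conjugate_elems G y z\<rbrakk> \<Longrightarrow> conjugate_elems G x z"
  unfolding conjugate_elems_iff by (metis conjugation_conjugation m_closed)

lemma conjugate_subgroups_refl: "H \<subseteq> carrier G \<Longrightarrow> conjugate_subgroups G H H"
  unfolding conjugate_subgroups_iff
  by (rule bexI[of _ \<one>]) (auto simp: image_def subset_eq)

lemma conjugate_subgroups_sym:
  assumes "H \<subseteq> carrier G" "conjugate_subgroups G H K"
  shows "conjugate_subgroups G K H"
proof -
  obtain g where g: "g \<in> carrier G" "K = conjugation G g ` H"
    using assms(2) conjugate_subgroups_iff by auto
  then have "H = conjugation G (inv g) ` K"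
    using assms(1) by (force simp: image_image subset_eq)
  then show ?thesis
    using g(1) conjugate_subgroups_iff by auto
qed

lemma conjugate_subgroups_trans:
  assumes "H \<subseteq> carrier G" "conjugate_subgroups G H K" "conjugate_subgroups G K L"
  shows "conjugate_subgroups G H L"
proof -
  obtain g h where g: "g \<in> carrier G" "K = conjugation G g ` H"
    and h: "h \<in> carrier G" "L = conjugation G h ` K"
    using assms(2,3) conjugate_subgroups_iff by auto
  then have "L = conjugation G (h \<otimes> g) ` H"
    using assms(1) by (auto simp: image_image subset_eq conjugation_conjugation intro!: image_cong)
  then show ?thesis
    using g(1) h(1) conjugate_subgroups_iff by auto
qed

text \<open>For finite groups an inclusion between a conjugate of one subgroup and another subgroup of
  the same order is an equality; most conjugacies below are obtained in this form.\<close>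

lemma conjugate_subgroups_if_subset:
  assumes "g \<in> carrier G" "H \<subseteq> carrier G" "finite K" "card H = card K"
    and "\<And>x. x \<in> H \<Longrightarrow> conjugation G g x \<in> K"
  shows "conjugate_subgroups G H K"
proof -
  have "card (conjugation G g ` H) = card H"
    using inj_on_subset[OF inj_on_conjugation[OF assms(1)] assms(2)] by (rule card_image)
  then have "conjugation G g ` H = K"
    using assms by (intro card_subset_eq) auto
  then show ?thesis
    using assms(1) conjugate_subgroups_iff by auto
qed

lemma locally_conjugate_sym:
  assumes "H \<subseteq> carrier G" "locally_conjugate G H K"
  shows "locally_conjugate G K H"
proof -
  obtain f where f: "bij_betw f H K" "\<forall>h\<in>H. conjugate_elems G h (f h)"
    using assms(2) locally_conjugate_def by metis
  have "conjugate_elems G k (the_inv_into H f k)" if "k \<in> K" for k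
    using that f assms(1) conjugate_elems_sym
    by (metis bij_betw_def f_the_inv_into_f subsetD the_inv_into_into[OF _ _ subset_refl])
  then show ?thesis
    unfolding locally_conjugate_def using bij_betw_the_inv_into[OF f(1)] by auto
qed

lemma locally_conjugate_trans:
  assumes "H \<subseteq> carrier G" "locally_conjugate G H K" "locally_conjugate G K L"
  shows "locally_conjugate G H L"
proof -
  obtain f f' where "bij_betw f H K" "\<forall>h\<in>H. conjugate_elems G h (f h)"
    and "bij_betw f' K L" "\<forall>h\<in>K. conjugate_elems G h (f' h)"
    using assms(2,3) unfolding locally_conjugate_def by metis
  then show ?thesis
    unfolding locally_conjugate_def using assms(1)
    by (intro exI[of _ "f' \<circ> f"])
      (auto intro: bij_betw_trans conjugate_elems_trans simp: bij_betw_apply subset_eq)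
qed

lemma conjugate_imp_locally_conjugate:
  assumes "H \<subseteq> carrier G" "conjugate_subgroups G H K"
  shows "locally_conjugate G H K"
proof -
  obtain g where g: "g \<in> carrier G" "K = conjugation G g ` H"
    using assms(2) conjugate_subgroups_iff by auto
  then have "bij_betw (conjugation G g) H K"
    using inj_on_subset[OF inj_on_conjugation assms(1)] by (simp add: bij_betw_def)
  then show ?thesis
    using g unfolding locally_conjugate_def conjugate_elems_iff by auto
qed

lemma locally_conjugate_card: "locally_conjugate G H K \<Longrightarrow> card H = card K"
  unfolding locally_conjugate_def using bij_betw_same_card by blast

lemma locally_conjugateE:
  assumes "locally_conjugate G H K" "x \<in> H"
  obtains g where "g \<in> carrier G" "conjugation G g x \<in> K"
  using assms unfolding locally_conjugate_def conjugate_elems_iff by (metis bij_betw_apply)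

lemma locally_conjugate_Int:
  assumes "locally_conjugate G H K" and "H \<subseteq> carrier G"
    and "\<And>g x. g \<in> carrier G \<Longrightarrow> x \<in> carrier G \<Longrightarrow> conjugation G g x \<in> S \<longleftrightarrow> x \<in> S"
  shows "locally_conjugate G (H \<inter> S) (K \<inter> S)"
proof -
  obtain f where f: "bij_betw f H K" "\<forall>h\<in>H. conjugate_elems G h (f h)"
    using assms(1) locally_conjugate_def by metis
  have "f h \<in> S \<longleftrightarrow> h \<in> S" if "h \<in> H" for h
    using f(2) that assms(2,3) conjugate_elems_iff by (metis subsetD)
  then have "bij_betw f (H \<inter> S) (K \<inter> S)"
    using f(1) unfolding bij_betw_def by (auto intro: inj_on_subset)
  then show ?thesis
    unfolding locally_conjugate_def using f(2) by auto
qed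

text \<open>The counting form of local conjugacy, going back to Gassmann: the elements conjugating \<open>x\<close> to \<open>y\<close>
  and those conjugating \<open>x\<close> to a conjugate of \<open>y\<close> are translates of each other.\<close>

lemma locally_conjugate_card_conjugators:
  assumes "locally_conjugate G A B" and fin: "finite (carrier G)"
    and A: "A \<subseteq> carrier G" and B: "B \<subseteq> carrier G" and x: "x \<in> carrier G"
  shows "card {g \<in> carrier G. conjugation G g x \<in> B} = card {g \<in> carrier G. conjugation G g x \<in> A}"
proof -
  obtain f where f: "bij_betw f A B" "\<forall>h\<in>A. conjugate_elems G h (f h)"
    using assms(1) locally_conjugate_def by metis
  let ?C = "\<lambda>y. {g \<in> carrier G. conjugation G g x = y}"
  have finA: "finite A" and finB: "finite B"
    using A B fin finite_subset by auto
  have *: "card (?C (f y)) = card (?C y)" if y: "y \<in> A" for y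
  proof -
    obtain k where k: "k \<in> carrier G" "f y = conjugation G k y"
      using f(2) y conjugate_elems_iff by auto
    have "bij_betw (\<lambda>g. k \<otimes> g) (?C y) (?C (f y))"
    proof (rule bij_betw_byWitness[where f' = "\<lambda>g. inv k \<otimes> g"])
      show "\<forall>g\<in>?C y. inv k \<otimes> (k \<otimes> g) = g" "\<forall>g\<in>?C (f y). k \<otimes> (inv k \<otimes> g) = g"
        using k by (auto simp flip: m_assoc)
      show "(\<lambda>g. k \<otimes> g) ` ?C y \<subseteq> ?C (f y)"
        using k x by (auto simp flip: conjugation_conjugation)
      show "(\<lambda>g. inv k \<otimes> g) ` ?C (f y) \<subseteq> ?C y"
        using k x y A by (auto simp flip: conjugation_conjugation)
    qed
    then show ?thesis
      using bij_betw_same_card by fastforce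
  qed
  have sum: "card {g \<in> carrier G. conjugation G g x \<in> S} = (\<Sum>y\<in>S. card (?C y))"
    if "finite S" for S
  proof -
    have "{g \<in> carrier G. conjugation G g x \<in> S} = (\<Union>y\<in>S. ?C y)"
      by auto
    then show ?thesis
      using that fin by (simp add: card_UN_disjoint disjoint_iff)
  qed
  have "(\<Sum>y\<in>B. card (?C y)) = (\<Sum>y\<in>A. card (?C (f y)))"
    by (rule sum.reindex_bij_betw[OF f(1), symmetric])
  also have "\<dots> = (\<Sum>y\<in>A. card (?C y))"
    using * by simp
  finally show ?thesis
    using sum[OF finA] sum[OF finB] by simp
qed

text \<open>Exchange the order of summation: each element of \<open>C\<close> is moved into \<open>A\<close> as often as into \<open>B\<close>.\<close>

lemma locally_conjugate_sum_card_Int: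
  assumes "locally_conjugate G A B" and fin: "finite (carrier G)"
    and A: "A \<subseteq> carrier G" and B: "B \<subseteq> carrier G" and C: "C \<subseteq> carrier G"
  shows "(\<Sum>g\<in>carrier G. card (conjugation G g ` C \<inter> B)) =
    (\<Sum>g\<in>carrier G. card (conjugation G g ` C \<inter> A))"
proof -
  have finC: "finite C"
    using C fin finite_subset by auto
  have *: "(\<Sum>g\<in>carrier G. card (conjugation G g ` C \<inter> S)) =
      (\<Sum>x\<in>C. card {g \<in> carrier G. conjugation G g x \<in> S})" for S
  proof -
    have "card (conjugation G g ` C \<inter> S) = (\<Sum>x\<in>C. of_bool (conjugation G g x \<in> S))"
      if g: "g \<in> carrier G" for g
    proof -
      have "conjugation G g ` C \<inter> S = conjugation G g ` {x \<in> C. conjugation G g x \<in> S}"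
        by auto
      moreover have "inj_on (conjugation G g) {x \<in> C. conjugation G g x \<in> S}"
        by (rule inj_on_subset[OF inj_on_conjugation[OF g]]) (use C in auto)
      ultimately show ?thesis
        using finC by (simp add: card_image sum_of_bool_eq Int_def)
    qed
    then have "(\<Sum>g\<in>carrier G. card (conjugation G g ` C \<inter> S)) =
        (\<Sum>g\<in>carrier G. \<Sum>x\<in>C. of_bool (conjugation G g x \<in> S))"
      by simp
    also have "\<dots> = (\<Sum>x\<in>C. \<Sum>g\<in>carrier G. of_bool (conjugation G g x \<in> S))"
      by (rule sum.swap)
    finally show ?thesis
      using fin by (simp add: sum_of_bool_eq Int_def)
  qed
  show ?thesis
    unfolding * using locally_conjugate_card_conjugators[OF assms(1) fin A B] C
    by (intro sum.cong) auto
qed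

text \<open>The product set \<open>AB\<close> has \<open>|A||B| / |A \<inter> B|\<close> elements.\<close>

lemma card_subgroups_Int_ge:
  assumes N: "subgroup N G" "finite N" and A: "subgroup A G" "A \<subseteq> N" and B: "subgroup B G" "B \<subseteq> N"
  shows "card A * card B \<le> card N * card (A \<inter> B)"
proof -
  have fin: "finite A" "finite B"
    using assms finite_subset by auto
  note Ac = subgroup.mem_carrier[OF A(1)] and Bc = subgroup.mem_carrier[OF B(1)]
  let ?F = "\<lambda>z. {(a, b). a \<in> A \<and> b \<in> B \<and> a \<otimes> b = z}"
  have finF: "finite (?F z)" for z
    by (rule finite_subset[of _ "A \<times> B"]) (use fin in auto)
  have "card (?F z) \<le> card (A \<inter> B)" for z
  proof (cases "?F z = {}")
    case False
    then obtain a0 b0 where ab0: "a0 \<in> A" "b0 \<in> B" "a0 \<otimes> b0 = z"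
      by auto
    have eq: "inv a0 \<otimes> a = b0 \<otimes> inv b" if "a \<in> A" "b \<in> B" "a \<otimes> b = z" for a b
    proof -
      have "a0 \<otimes> b0 \<otimes> inv b = a"
        using that ab0 Ac Bc by (metis inv_closed inv_solve_right m_closed)
      then show ?thesis
        using that ab0 Ac Bc by (metis inv_closed inv_solve_left m_assoc m_closed)
    qed
    have "inv a0 \<otimes> a \<in> A \<inter> B" if "a \<in> A" "b \<in> B" "a \<otimes> b = z" for a b
      using eq[OF that] that ab0
        subgroup.m_closed[OF A(1) subgroup.m_inv_closed[OF A(1) ab0(1)] that(1)]
        subgroup.m_closed[OF B(1) ab0(2) subgroup.m_inv_closed[OF B(1) that(2)]] by simp
    then have "(\<lambda>(a, b). inv a0 \<otimes> a) ` ?F z \<subseteq> A \<inter> B"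
      by auto
    moreover have "inj_on (\<lambda>(a, b). inv a0 \<otimes> a) (?F z)"
      using ab0 Ac Bc by (auto simp: inj_on_def) (metis Units_eq Units_l_cancel m_closed)
    ultimately show ?thesis
      using fin by (intro card_inj_on_le) auto
  next
    case True
    then show ?thesis
      by (simp only: card.empty)
  qed
  moreover have "A \<times> B = (\<Union>z\<in>N. ?F z)"
    using A(2) B(2) subgroup.m_closed[OF N(1)] by (auto simp: subset_eq)
  then have "card (A \<times> B) \<le> (\<Sum>z\<in>N. card (?F z))"
    using card_UN_le[OF N(2)] by simp
  moreover have "(\<Sum>z\<in>N. card (?F z)) \<le> card N * card (A \<inter> B)"
    using sum_bounded_above[of N "\<lambda>z. card (?F z)"] calculation by simp
  ultimately show ?thesis
    by (simp add: card_cartesian_product)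
qed

text \<open>Subgroups of index \<open>p\<close> in a normal \<open>p\<close>-subgroup: two different ones of them meet in index \<open>p\<close>
  again, so if no conjugate of \<open>A\<close> were \<open>B\<close>, then all intersections of \<open>B\<close> with the conjugates
  of \<open>A\<close> would be as small as possible. The intersections of \<open>A\<close> with its own conjugates
  have the same total size, and one of them is \<open>A\<close> itself.\<close>

lemma locally_conjugate_hyperplanes:
  assumes lc: "locally_conjugate G A B" and fin: "finite (carrier G)" and p: "prime (p :: nat)"
    and N: "subgroup N G" "\<And>g x. g \<in> carrier G \<Longrightarrow> x \<in> N \<Longrightarrow> conjugation G g x \<in> N"
    and A: "subgroup A G" "A \<subseteq> N" and B: "subgroup B G" "B \<subseteq> N"
    and card: "card A = p ^ k" "card N = p ^ Suc k"
  shows "conjugate_subgroups G A B"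
proof (rule ccontr)
  assume nc: "\<not> conjugate_subgroups G A B"
  have Ac: "A \<subseteq> carrier G" and Bc: "B \<subseteq> carrier G" and Nc: "N \<subseteq> carrier G"
    using A(1) B(1) N(1) subgroup.subset by auto
  have finN: "finite N" and finA: "finite A" and finB: "finite B"
    using Ac Bc Nc fin by (auto intro: finite_subset)
  have cB: "card B = p ^ k"
    using locally_conjugate_card[OF lc] card(1) by simp
  have p0: "p > 0"
    using p prime_gt_0_nat by auto
  define J where "J g S = card (conjugation G g ` A \<inter> S)" for g S
  have gA: "subgroup (conjugation G g ` A) G" "conjugation G g ` A \<subseteq> N"
      "card (conjugation G g ` A) = p ^ k" if "g \<in> carrier G" for g
    using conjugation_image_subgroup[OF A(1) that] A(2) N(2)[OF that]
      card_image[OF inj_on_subset[OF inj_on_conjugation[OF that] Ac]] card(1) by auto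
  have lower: "p ^ k \<le> p * J g S"
    if "g \<in> carrier G" "subgroup S G" "S \<subseteq> N" "card S = p ^ k" for g S
  proof -
    have "p ^ k * p ^ k \<le> p ^ k * (p * J g S)"
      using card_subgroups_Int_ge[OF N(1) finN gA(1,2)[OF that(1)] that(2,3)]
      unfolding gA(3)[OF that(1)] that(4) card(2) J_def by (simp add: ac_simps)
    then show ?thesis
      using p0 by simp
  qed
  have upper: "p * J g B \<le> p ^ k" if g: "g \<in> carrier G" for g
  proof -
    have "conjugation G g ` A \<noteq> B"
      using nc g conjugate_subgroups_iff by auto
    then have "J g B \<noteq> p ^ k"
      using card_subset_eq[OF finB, of "conjugation G g ` A \<inter> B"]
        card_subset_eq[of "conjugation G g ` A" "conjugation G g ` A \<inter> B"] gA(3)[OF g] cB finA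
      unfolding J_def by (metis finite_imageI inf_le1 inf_le2)
    moreover have "J g B dvd p ^ k"
    proof -
      have "subgroup (conjugation G g ` A \<inter> B) (G\<lparr>carrier := B\<rparr>)"
        using subgroup_incl[OF subgroups_Inter_pair[OF gA(1)[OF g] B(1)] B(1)] by auto
      then have "J g B dvd order (G\<lparr>carrier := B\<rparr>)"
        unfolding J_def
        using group.lagrange[OF subgroup_imp_group[OF B(1)]] by (metis dvd_triv_right)
      then show ?thesis
        by (simp add: order_def cB)
    qed
    then obtain i where i: "i \<le> k" "J g B = p ^ i"
      using divides_primepow_nat[OF p] by auto
    ultimately have "Suc i \<le> k"
      by (metis le_antisym not_less_eq_eq)
    then show ?thesis
      using i p0 by (metis power_Suc power_increasing Suc_leI One_nat_def)
  qed
  have "conjugation G \<one> ` A = id ` A"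
    using Ac by (intro image_cong) auto
  then have one: "J \<one> A = p ^ k"
    by (simp add: J_def card(1))
  have "(\<Sum>g\<in>carrier G. p * J g B) < (\<Sum>g\<in>carrier G. p * J g A)"
  proof (rule sum_strict_mono_ex1[OF fin])
    show "\<forall>g\<in>carrier G. p * J g B \<le> p * J g A"
      using upper lower[OF _ A card(1)] by (meson order_trans)
    have "p * J \<one> B < p * J \<one> A"
    proof -
      have "p ^ k < p * p ^ k"
        using prime_gt_1_nat[OF p] p0 by simp
      then show ?thesis
        unfolding one using upper[OF one_closed] by (rule le_less_trans[rotated])
    qed
    then show "\<exists>g\<in>carrier G. p * J g B < p * J g A"
      by auto
  qed
  moreover have "(\<Sum>g\<in>carrier G. J g B) = (\<Sum>g\<in>carrier G. J g A)"
    unfolding J_def by (rule locally_conjugate_sum_card_Int[OF lc fin Ac Bc Ac])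
  ultimately show False
    by (simp flip: sum_distrib_left)
qed

end

section \<open>Matrices modulo \<open>n\<close> and the group \<open>GL\<^sub>2(\<int>/n\<int>)\<close>\<close>

definition mat22 :: "int \<Rightarrow> int \<Rightarrow> int \<Rightarrow> int \<Rightarrow> int^2^2" where
  "mat22 a b c d = vector [vector [a, b], vector [c, d]]"

definition smul :: "int \<Rightarrow> int^2^2 \<Rightarrow> int^2^2" where
  "smul r A = (\<chi> i j. r * A $ i $ j)"

lemma smul_nth [simp]: "smul r A $ i $ j = r * A $ i $ j"
  by (simp add: smul_def)

lemma mat22_nth [simp]:
  "mat22 a b c d $ 1 $ 1 = a" "mat22 a b c d $ 1 $ 2 = b"
  "mat22 a b c d $ 2 $ 1 = c" "mat22 a b c d $ 2 $ 2 = d"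
  by (simp_all add: mat22_def)

lemma mat22_cases: obtains a b c d where "A = mat22 a b c d"
proof -
  have "A = mat22 (A $ 1 $ 1) (A $ 1 $ 2) (A $ 2 $ 1) (A $ 2 $ 2)"
    by (simp add: vec_eq_iff forall_2)
  then show ?thesis
    using that by blast
qed

lemma mat22_eq_iff [simp]:
  "mat22 a b c d = mat22 a' b' c' d' \<longleftrightarrow> a = a' \<and> b = b' \<and> c = c' \<and> d = d'"
  by (auto simp: vec_eq_iff forall_2)

lemma mat22_mult [simp]:
  "mat22 a b c d ** mat22 a' b' c' d' =
    mat22 (a * a' + b * c') (a * b' + b * d') (c * a' + d * c') (c * b' + d * d')"
  by (simp add: matrix_matrix_mult_def vec_eq_iff forall_2 sum_2)

lemma mat22_add [simp]:
  "mat22 a b c d + mat22 a' b' c' d' = mat22 (a + a') (b + b') (c + c') (d + d')"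
  by (simp add: vec_eq_iff forall_2)

lemma smul_mat22 [simp]: "smul r (mat22 a b c d) = mat22 (r * a) (r * b) (r * c) (r * d)"
  by (simp add: smul_def vec_eq_iff forall_2)

lemma det_mat22 [simp]: "det (mat22 a b c d) = a * d - b * c"
  by (simp add: det_2)

lemma mat_1_eq_mat22: "mat 1 = mat22 1 0 0 1"
  by (simp add: mat_def vec_eq_iff forall_2)

lemma diag2_eq_mat22: "diag2 w z = mat22 w 0 0 z"
  by (simp add: diag2_def mat22_def)

lemma E12_eq_mat22: "E12 = mat22 0 1 0 0"
  by (simp add: E12_def mat22_def)

lemma mat2_mod_nth [simp]: "mat2_mod n A $ i $ j = A $ i $ j mod int n"
  by (simp add: mat2_mod_def)

lemma mat2_mod_mat2_mod [simp]: "mat2_mod n (mat2_mod n A) = mat2_mod n A"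
  by (simp add: vec_eq_iff)

lemma mat2_mod_eq_iff:
  "mat2_mod n A = mat2_mod n B \<longleftrightarrow> (\<forall>i j. int n dvd A $ i $ j - B $ i $ j)"
  by (simp add: vec_eq_iff mod_eq_dvd_iff)

lemma mat2_mod_mat22_eq_iff:
  "mat2_mod n (mat22 a b c d) = mat2_mod n (mat22 a' b' c' d') \<longleftrightarrow>
    int n dvd a - a' \<and> int n dvd b - b' \<and> int n dvd c - c' \<and> int n dvd d - d'"
  by (auto simp: mat2_mod_eq_iff forall_2)

lemma mat2_mod_mult_cong:
  assumes "mat2_mod n A = mat2_mod n A'" "mat2_mod n B = mat2_mod n B'"
  shows "mat2_mod n (A ** B) = mat2_mod n (A' ** B')"
proof -
  have "[(\<Sum>k\<in>UNIV. A $ i $ k * B $ k $ j) = (\<Sum>k\<in>UNIV. A' $ i $ k * B' $ k $ j)] (mod int n)" for i j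
    using assms by (intro cong_sum cong_mult) (simp_all add: cong_def vec_eq_iff)
  then show ?thesis
    by (simp add: vec_eq_iff matrix_matrix_mult_def cong_def)
qed

lemma mat2_mod_mult_mod [simp]:
  "mat2_mod n (mat2_mod n A ** B) = mat2_mod n (A ** B)"
  "mat2_mod n (A ** mat2_mod n B) = mat2_mod n (A ** B)"
  by (rule mat2_mod_mult_cong; simp)+

lemma cong_det_mat2_mod: "[det (mat2_mod n A) = det A] (mod int n)"
  unfolding det_2 by (intro cong_diff cong_mult) (simp_all add: cong_def)

lemma coprime_det_mat2_mod [simp]:
  "coprime (det (mat2_mod n A)) (int n) \<longleftrightarrow> coprime (det A) (int n)"
  using cong_imp_coprime[OF cong_det_mat2_mod] cong_imp_coprime[OF cong_sym[OF cong_det_mat2_mod]]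
  by blast

lemma mat2_mod_carrier_iff:
  "n > 0 \<Longrightarrow> A \<in> carrier (mat2_monoid (residue_ring (int n))) \<longleftrightarrow> mat2_mod n A = A"
  by (auto simp: mat2_monoid_def residue_ring_def vec_eq_iff pos_mod_sign pos_mod_bound)
    (metis pos_mod_bound pos_mod_sign of_nat_0_less_iff zle_diff1_eq)+

lemma mat2_monoid_residue_mult:
  assumes "n > 1"
  shows "A \<otimes>\<^bsub>mat2_monoid (residue_ring (int n))\<^esub> B = mat2_mod n (A ** B)"
proof -
  interpret residues "int n" "residue_ring (int n)"
    using assms by unfold_locales auto
  have "f \<in> UNIV \<rightarrow> carrier (residue_ring (int n)) \<Longrightarrow>
      finsum (residue_ring (int n)) f (UNIV :: 2 set) = (f 1 + f 2) mod int n" for f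
    by (simp add: UNIV_2 res_add_eq res_zero_eq Pi_iff mod_add_right_eq)
  moreover have "x \<otimes>\<^bsub>residue_ring (int n)\<^esub> y = x * y mod int n" for x y
    by (simp add: res_mult_eq)
  moreover have "x * y mod int n \<in> carrier (residue_ring (int n))" for x y
    using assms by (simp add: res_carrier_eq)
  ultimately show ?thesis
    by (simp add: mat2_monoid_def matrix_matrix_mult_def vec_eq_iff sum_2 mod_add_eq)
qed

lemma mat2_monoid_residue_one:
  "n > 1 \<Longrightarrow> \<one>\<^bsub>mat2_monoid (residue_ring (int n))\<^esub> = mat2_mod n (mat 1)"
  by (simp add: mat2_monoid_def residue_ring_def vec_eq_iff mat_def)

lemma GL2_mult: "n > 1 \<Longrightarrow> A \<otimes>\<^bsub>GL2 n\<^esub> B = mat2_mod n (A ** B)"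
  by (simp add: GL2_def units_of_mult mat2_monoid_residue_mult)

lemma GL2_one: "n > 1 \<Longrightarrow> \<one>\<^bsub>GL2 n\<^esub> = mat2_mod n (mat 1)"
  by (simp add: GL2_def units_of_one mat2_monoid_residue_one)

text \<open>The inverse is the adjugate matrix times an inverse of the determinant.\<close>

lemma GL2_carrier:
  assumes "n > 1"
  shows "A \<in> carrier (GL2 n) \<longleftrightarrow> mat2_mod n A = A \<and> coprime (det A) (int n)"
proof -
  have n: "n > 0"
    using assms by simp
  have "carrier (GL2 n) = {A. mat2_mod n A = A \<and>
      (\<exists>B. mat2_mod n B = B \<and> mat2_mod n (B ** A) = mat2_mod n (mat 1) \<and>
        mat2_mod n (A ** B) = mat2_mod n (mat 1))}"
    by (auto simp: GL2_def units_of_carrier Units_def mat2_mod_carrier_iff[OF n]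
        mat2_monoid_residue_mult[OF assms] mat2_monoid_residue_one[OF assms])
  moreover have "coprime (det A) (int n)"
    if "mat2_mod n (A ** B) = mat2_mod n (mat 1)" for B
  proof -
    have "[det A * det B = det (mat2_mod n (A ** B))] (mod int n)"
      using cong_det_mat2_mod cong_sym det_mul by metis
    then have "[det A * det B = 1] (mod int n)"
      using that cong_trans[OF _ cong_det_mat2_mod[of n "mat 1"]] by simp
    then show ?thesis
      using coprime_iff_invertible_int by auto
  qed
  moreover have "\<exists>B. mat2_mod n B = B \<and> mat2_mod n (B ** A) = mat2_mod n (mat 1) \<and>
      mat2_mod n (A ** B) = mat2_mod n (mat 1)" if cop: "coprime (det A) (int n)"
  proof -
    obtain a b c d where A: "A = mat22 a b c d"
      using mat22_cases by blast
    obtain u where u: "[(a * d - b * c) * u = 1] (mod int n)"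
      using cop coprime_iff_invertible_int unfolding A det_mat22 by auto
    let ?B = "mat22 (d * u) (- b * u) (- c * u) (a * u)"
    have "mat2_mod n (?B ** A) = mat2_mod n (mat 1)" "mat2_mod n (A ** ?B) = mat2_mod n (mat 1)"
      unfolding A mat22_mult mat_1_eq_mat22 mat2_mod_mat22_eq_iff
      using u unfolding cong_iff_dvd_diff by (simp_all add: algebra_simps)
    then show ?thesis
      by (intro exI[of _ "mat2_mod n ?B"]) simp
  qed
  ultimately show ?thesis
    by blast
qed

section \<open>The kernel of reduction modulo \<open>p\<close>\<close>

locale odd_prime =
  fixes p :: nat
  assumes prime_p: "prime p" and odd_p: "odd p"
begin

abbreviation "G \<equiv> GL2 (p\<^sup>2)"
abbreviation "red \<equiv> mat2_mod (p\<^sup>2)"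
abbreviation "P \<equiv> int p"

lemma p_ge_3: "p \<ge> 3"
  using prime_p odd_p prime_ge_2_nat[OF prime_p] by (cases "p = 2") auto

lemma p_sq_gt_1: "p\<^sup>2 > 1"
  using p_ge_3 by (intro one_less_power) auto

lemma prime_P: "prime P"
  using prime_p by simp

sublocale group G
  by (rule group_GL2[OF p_sq_gt_1])

lemma not_dvd_2: "\<not> P dvd 2"
  using p_ge_3 zdvd_imp_le[of P 2] by auto

lemma not_dvd_1: "\<not> P dvd 1"
  using p_ge_3 zdvd_imp_le[of P 1] by auto

lemma dvd_mult_iff [simp]: "P dvd a * b \<longleftrightarrow> P dvd a \<or> P dvd b"
  using prime_P by (rule prime_dvd_mult_iff)

lemma sq_dvd_iff [simp]: "P\<^sup>2 dvd P * a \<longleftrightarrow> P dvd a"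
  using p_ge_3 by (simp add: power2_eq_square)

lemma dvd_2_mult_iff: "P dvd 2 * a \<longleftrightarrow> P dvd a"
  using not_dvd_2 by simp

lemma sq_dvd_imp_dvd: "P\<^sup>2 dvd a \<Longrightarrow> P dvd a"
  by (meson dvd_power dvd_trans zero_less_numeral)

lemma coprime_sq_iff: "coprime a (int (p\<^sup>2)) \<longleftrightarrow> \<not> P dvd a"
  using prime_P by (metis coprime_absorb_left coprime_commute coprime_power_right_iff not_prime_unit
      of_nat_power prime_imp_coprime zero_neq_numeral)

lemma solve_mod: "\<not> P dvd k \<Longrightarrow> \<exists>x. P dvd k * x - e"
  by (metis prime_imp_coprime cong_iff_dvd_diff cong_solve_coprime_int coprime_commute cong_scalar_right mult.assoc mult_1 prime_P)

lemma cancel_mod_sq: "\<not> P dvd k \<Longrightarrow> P\<^sup>2 dvd k * x \<Longrightarrow> P\<^sup>2 dvd x"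
  using prime_P by (metis coprime_commute coprime_dvd_mult_right_iff coprime_power_left_iff prime_imp_coprime)

lemma carrier_iff: "A \<in> carrier G \<longleftrightarrow> red A = A \<and> \<not> P dvd det A"
  using GL2_carrier[OF p_sq_gt_1] coprime_sq_iff by simp

lemma red_carrier_iff [simp]: "red A \<in> carrier G \<longleftrightarrow> \<not> P dvd det A"
  using GL2_carrier[OF p_sq_gt_1] coprime_sq_iff coprime_det_mat2_mod[of "p\<^sup>2" A] by simp

lemma red_carrier [simp]: "A \<in> carrier G \<Longrightarrow> red A = A"
  by (simp add: carrier_iff)

lemma red_mult [simp]: "red A \<otimes>\<^bsub>G\<^esub> red B = red (A ** B)"
  using GL2_mult[OF p_sq_gt_1] by simp

lemma one_eq_red: "\<one>\<^bsub>G\<^esub> = red (mat22 1 0 0 1)"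
  using GL2_one[OF p_sq_gt_1] mat_1_eq_mat22 by simp

lemma red_eq_iff:
  "red (mat22 a b c d) = red (mat22 a' b' c' d') \<longleftrightarrow>
    P\<^sup>2 dvd a - a' \<and> P\<^sup>2 dvd b - b' \<and> P\<^sup>2 dvd c - c' \<and> P\<^sup>2 dvd d - d'"
  by (simp add: mat2_mod_mat22_eq_iff)

lemma conjugation_red_eq_iff:
  assumes "\<not> P dvd det g" "\<not> P dvd det A" "\<not> P dvd det B"
  shows "conjugation G (red g) (red A) = red B \<longleftrightarrow> red (g ** A) = red (B ** g)"
  using assms by (simp add: conjugation_eq_iff)

lemma red_cong_mod_p: "red A = red B \<Longrightarrow> mat2_mod p A = mat2_mod p B"
  using sq_dvd_imp_dvd by (simp add: mat2_mod_eq_iff)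

lemma finite_carrier: "finite (carrier G)"
proof -
  have "A \<in> (\<lambda>(a, b, c, d). mat22 a b c d) ` ({0..<int (p\<^sup>2)} \<times> {0..<int (p\<^sup>2)} \<times> {0..<int (p\<^sup>2)} \<times> {0..<int (p\<^sup>2)})"
    if "A \<in> carrier G" for A
  proof -
    obtain a b c d where A: "A = mat22 a b c d"
      using mat22_cases by blast
    have "red A = A"
      using that by simp
    then have "a mod int (p\<^sup>2) = a" "b mod int (p\<^sup>2) = b" "c mod int (p\<^sup>2) = c" "d mod int (p\<^sup>2) = d"
      unfolding A by (metis mat22_nth mat2_mod_nth)+
    moreover have "int (p\<^sup>2) > 0"
      using p_ge_3 by simp
    ultimately show ?thesis
      unfolding A using pos_mod_sign[of "int (p\<^sup>2)"] pos_mod_bound[of "int (p\<^sup>2)"]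
      by (intro image_eqI[of _ _ "(a, b, c, d)"])
        (simp, unfold mem_Times_iff fst_conv snd_conv atLeastLessThan_iff, metis)
  qed
  then show ?thesis
    by (meson finite_SigmaI finite_atLeastLessThan_int finite_imageI finite_subset subsetI)
qed

lemma I_plus_eq_red: "I_plus p (mat22 a b c d) = red (mat22 (1 + P * a) (P * b) (P * c) (1 + P * d))"
proof -
  have "(\<chi> i j. (mat 1 :: int^2^2) $ i $ j + P * mat22 a b c d $ i $ j) =
      mat22 (1 + P * a) (P * b) (P * c) (1 + P * d)"
    by (simp add: vec_eq_iff forall_2 mat_def)
  then show ?thesis
    by (simp add: I_plus_def)
qed

lemma I_plus_carrier [simp]: "I_plus p A \<in> carrier G"
proof (cases A rule: mat22_cases)
  case (1 a b c d)
  have "(1 + P * a) * (1 + P * d) - P * b * (P * c) = 1 + P * (a + d + P * a * d - P * b * c)"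
    by (simp add: algebra_simps)
  then show ?thesis
    unfolding 1 I_plus_eq_red red_carrier_iff det_mat22 using not_dvd_1
    by (metis dvd_add_left_iff dvd_triv_left)
qed

lemma I_plus_eq_iff: "I_plus p A = I_plus p B \<longleftrightarrow> mat2_mod p A = mat2_mod p B"
  by (cases A rule: mat22_cases; cases B rule: mat22_cases)
    (simp add: I_plus_eq_red red_eq_iff mat2_mod_mat22_eq_iff flip: right_diff_distrib)

lemma I_plus_mult: "I_plus p A \<otimes>\<^bsub>G\<^esub> I_plus p B = I_plus p (A + B)"
proof (cases A rule: mat22_cases; cases B rule: mat22_cases)
  fix a b c d a' b' c' d'
  assume AB: "A = mat22 a b c d" "B = mat22 a' b' c' d'"
  show ?thesis
    unfolding AB I_plus_eq_red red_mult mat22_mult mat22_add red_eq_iff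
    by (simp add: algebra_simps power2_eq_square)
qed

lemma I_plus_0 [simp]: "I_plus p (mat22 0 0 0 0) = \<one>\<^bsub>G\<^esub>"
  by (simp add: I_plus_eq_red one_eq_red)

lemma conjugation_I_plus:
  assumes "\<not> P dvd det g" "mat2_mod p (g ** A) = mat2_mod p (B ** g)"
  shows "conjugation G (red g) (I_plus p A) = I_plus p B"
proof -
  have "red g \<otimes>\<^bsub>G\<^esub> I_plus p A = I_plus p B \<otimes>\<^bsub>G\<^esub> red g"
  proof (cases A rule: mat22_cases; cases B rule: mat22_cases; cases g rule: mat22_cases)
    fix a b c d a' b' c' d' \<alpha> \<beta> \<gamma> \<delta>
    assume ABg: "A = mat22 a b c d" "B = mat22 a' b' c' d'" "g = mat22 \<alpha> \<beta> \<gamma> \<delta>"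
    have *: "P\<^sup>2 dvd x" if "x = P * y" "P dvd y" for x y
      using that by simp
    have d: "P dvd \<alpha> * a + \<beta> * c - (a' * \<alpha> + b' * \<gamma>)" "P dvd \<alpha> * b + \<beta> * d - (a' * \<beta> + b' * \<delta>)"
      "P dvd \<gamma> * a + \<delta> * c - (c' * \<alpha> + d' * \<gamma>)" "P dvd \<gamma> * b + \<delta> * d - (c' * \<beta> + d' * \<delta>)"
      using assms(2) unfolding ABg mat22_mult mat2_mod_mat22_eq_iff by auto
    show ?thesis
      unfolding ABg I_plus_eq_red red_mult mat22_mult red_eq_iff
      by (intro conjI; (rule *[OF _ d(1)] *[OF _ d(2)] *[OF _ d(3)] *[OF _ d(4)], simp add: algebra_simps))
  qed
  then show ?thesis
    using assms(1) by (simp add: conjugation_eq_iff)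
qed


lemma I_plus_add_mem:
  "\<lbrakk>subgroup H G; I_plus p A \<in> H; I_plus p B \<in> H\<rbrakk> \<Longrightarrow> I_plus p (A + B) \<in> H"
  by (metis I_plus_mult subgroup.m_closed)

lemma I_plus_zero_mem: "subgroup H G \<Longrightarrow> I_plus p (mat22 0 0 0 0) \<in> H"
  using subgroup.one_closed by simp

lemma I_plus_smul_mem:
  assumes H: "subgroup H G" and A: "I_plus p A \<in> H"
  shows "I_plus p (smul r A) \<in> H"
proof (cases A rule: mat22_cases)
  case (1 a b c d)
  have "I_plus p (smul (int n) A) \<in> H" for n
  proof (induction n)
    case 0
    then show ?case
      using I_plus_zero_mem[OF H] by (simp add: 1)
  next
    case (Suc n)
    have "smul (int (Suc n)) A = smul (int n) A + A"
      by (simp add: 1 algebra_simps)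
    then show ?case
      using I_plus_add_mem[OF H Suc A] by simp
  qed
  from this[of "nat (r mod P)"] have "I_plus p (smul (r mod P) A) \<in> H"
    using p_ge_3 by simp
  moreover have "P dvd r mod P * x - r * x" for x
    by (metis dvd_minus_mod dvd_diff_commute dvd_mult2 left_diff_distrib)
  then have "mat2_mod p (smul (r mod P) A) = mat2_mod p (smul r A)"
    by (simp only: 1 smul_mat22 mat2_mod_mat22_eq_iff simp_thms)
  ultimately show ?thesis
    using I_plus_eq_iff by metis
qed

lemma I_plus_combination_mem:
  "\<lbrakk>subgroup H G; I_plus p A \<in> H; I_plus p B \<in> H\<rbrakk> \<Longrightarrow> I_plus p (smul r A + smul s B) \<in> H"
  by (intro I_plus_add_mem I_plus_smul_mem)

lemma I_plus_mem_cong: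
  "\<lbrakk>I_plus p A \<in> H; mat2_mod p A = mat2_mod p B\<rbrakk> \<Longrightarrow> I_plus p B \<in> H"
  using I_plus_eq_iff by metis

lemma split_Cartan_iff:
  "X \<in> split_Cartan (p\<^sup>2) \<longleftrightarrow> (\<exists>x w. X = red (mat22 x 0 0 w) \<and> \<not> P dvd x \<and> \<not> P dvd w)"
proof
  assume "X \<in> split_Cartan (p\<^sup>2)"
  then show "\<exists>x w. X = red (mat22 x 0 0 w) \<and> \<not> P dvd x \<and> \<not> P dvd w"
    unfolding split_Cartan_def diag2_eq_mat22 by (auto simp: carrier_iff) metis
next
  assume "\<exists>x w. X = red (mat22 x 0 0 w) \<and> \<not> P dvd x \<and> \<not> P dvd w"
  then obtain x w where X: "X = red (mat22 x 0 0 w)" "\<not> P dvd x" "\<not> P dvd w"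
    by auto
  moreover have "red (mat22 x 0 0 w) = mat22 (x mod int (p\<^sup>2)) 0 0 (w mod int (p\<^sup>2))"
    by (simp add: vec_eq_iff forall_2)
  ultimately show "X \<in> split_Cartan (p\<^sup>2)"
    unfolding split_Cartan_def diag2_eq_mat22 using red_carrier_iff[of "mat22 x 0 0 w"] by auto
qed

lemma diagonal_swaps_iff:
  assumes "D \<subseteq> split_Cartan (p\<^sup>2)" "D' \<subseteq> split_Cartan (p\<^sup>2)"
  shows "diagonal_swaps D D' \<longleftrightarrow> (\<forall>x w. red (mat22 x 0 0 w) \<in> D \<longleftrightarrow> red (mat22 w 0 0 x) \<in> D')"
proof -
  have r: "red (mat22 x 0 0 w) = mat22 (x mod int (p\<^sup>2)) 0 0 (w mod int (p\<^sup>2))" for x w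
    by (simp add: vec_eq_iff forall_2)
  have *: "red (mat22 x 0 0 w) = mat22 x 0 0 w" "red (mat22 w 0 0 x) = mat22 w 0 0 x"
    if "mat22 x 0 0 w \<in> D \<union> D' \<or> mat22 w 0 0 x \<in> D \<union> D'" for x w
  proof -
    have "red (mat22 x 0 0 w) = mat22 x 0 0 w \<or> red (mat22 w 0 0 x) = mat22 w 0 0 x"
    proof -
      have "X \<in> D \<union> D' \<Longrightarrow> red X = X" for X
        using assms by (intro red_carrier) (auto simp: split_Cartan_def)
      then show ?thesis
        using that by blast
    qed
    then show "red (mat22 x 0 0 w) = mat22 x 0 0 w" "red (mat22 w 0 0 x) = mat22 w 0 0 x"
      unfolding r by auto
  qed
  show ?thesis
    unfolding diagonal_swaps_def diag2_eq_mat22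
  proof (rule iffI; intro allI)
    fix x w assume "\<forall>w z. mat22 w 0 0 z \<in> D \<longleftrightarrow> mat22 z 0 0 w \<in> D'"
    then show "red (mat22 x 0 0 w) \<in> D \<longleftrightarrow> red (mat22 w 0 0 x) \<in> D'"
      unfolding r by blast
  next
    fix x w assume A: "\<forall>x w. red (mat22 x 0 0 w) \<in> D \<longleftrightarrow> red (mat22 w 0 0 x) \<in> D'"
    show "mat22 x 0 0 w \<in> D \<longleftrightarrow> mat22 w 0 0 x \<in> D'"
    proof (cases "mat22 x 0 0 w \<in> D \<union> D' \<or> mat22 w 0 0 x \<in> D \<union> D'")
      case True
      show ?thesis
        using A[rule_format, of x w] unfolding *[OF True] .
    qed simp
  qed
qed

section \<open>The groups generated by \<open>D\<close> and \<open>I + pE\<^sub>1\<^sub>2\<close>\<close>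

text \<open>For a group \<open>D\<close> of diagonal matrices this is \<open>\<langle>D, I + pE\<^sub>1\<^sub>2\<rangle>\<close>, see
  \<open>generate_eq_upper_group\<close> below.\<close>

definition upper_group :: "(int^2^2) set \<Rightarrow> (int^2^2) set" where
  "upper_group D = {red (mat22 x (P * y) 0 w) | x y w. red (mat22 x 0 0 w) \<in> D}"

lemma upper_group_iff:
  "red (mat22 x (P * y) 0 w) \<in> upper_group D \<longleftrightarrow> red (mat22 x 0 0 w) \<in> D"
proof
  assume "red (mat22 x (P * y) 0 w) \<in> upper_group D"
  then obtain x' y' w' where 1: "red (mat22 x (P * y) 0 w) = red (mat22 x' (P * y') 0 w')"
    "red (mat22 x' 0 0 w') \<in> D"
    unfolding upper_group_def by auto
  then have "red (mat22 x 0 0 w) = red (mat22 x' 0 0 w')"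
    by (simp add: red_eq_iff)
  then show "red (mat22 x 0 0 w) \<in> D"
    using 1 by simp
qed (auto simp: upper_group_def)

lemma subgroup_upper_group:
  assumes D: "subgroup D G" "D \<subseteq> split_Cartan (p\<^sup>2)"
  shows "subgroup (upper_group D) G"
proof (rule finite_subgroupI[OF finite_carrier])
  have unit: "\<not> P dvd x \<and> \<not> P dvd w" if "red (mat22 x 0 0 w) \<in> D" for x w
    using subgroup.mem_carrier[OF D(1) that] by simp
  show "upper_group D \<subseteq> carrier G"
    using unit by (auto simp: upper_group_def)
  have "red (mat22 1 0 0 1) \<in> D"
    using subgroup.one_closed[OF D(1)] by (simp add: one_eq_red)
  then show "upper_group D \<noteq> {}"
    by (auto simp: upper_group_def)
  fix a b assume a: "a \<in> upper_group D" and b: "b \<in> upper_group D"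
  obtain x y w where A: "a = red (mat22 x (P * y) 0 w)" "red (mat22 x 0 0 w) \<in> D"
    using a upper_group_def by auto
  obtain x' y' w' where B: "b = red (mat22 x' (P * y') 0 w')" "red (mat22 x' 0 0 w') \<in> D"
    using b upper_group_def by auto
  have "red (mat22 (x * x') 0 0 (w * w')) \<in> D"
    using subgroup.m_closed[OF D(1) A(2) B(2)] by simp
  moreover have "a \<otimes>\<^bsub>G\<^esub> b = red (mat22 (x * x') (P * (x * y' + y * w')) 0 (w * w'))"
    unfolding A B by (simp add: algebra_simps)
  ultimately show "a \<otimes>\<^bsub>G\<^esub> b \<in> upper_group D"
    using upper_group_iff by simp
qed

lemma generate_eq_upper_group:
  assumes D: "subgroup D G" "D \<subseteq> split_Cartan (p\<^sup>2)"
  shows "generate G (D \<union> {I_plus p E12}) = upper_group D"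
proof (rule generateI[symmetric])
  show "subgroup (upper_group D) G"
    by (rule subgroup_upper_group[OF D])
  have "red (mat22 1 0 0 1) \<in> D"
    using subgroup.one_closed[OF D(1)] by (simp add: one_eq_red)
  then have "I_plus p E12 \<in> upper_group D"
    using upper_group_iff[of 1 1 1 D] by (simp add: E12_eq_mat22 I_plus_eq_red)
  moreover have "d \<in> upper_group D" if "d \<in> D" for d
  proof -
    obtain x w where "d = red (mat22 x 0 0 w)"
      using D(2) split_Cartan_iff[of d] \<open>d \<in> D\<close> by blast
    then show ?thesis
      using that upper_group_iff[of x 0 w D] by simp
  qed
  ultimately show "D \<union> {I_plus p E12} \<subseteq> upper_group D"
    by auto
  fix K assume K: "subgroup K G" "D \<union> {I_plus p E12} \<subseteq> K"
  show "upper_group D \<subseteq> K"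
  proof
    fix a assume "a \<in> upper_group D"
    then obtain x y w where A: "a = red (mat22 x (P * y) 0 w)" "red (mat22 x 0 0 w) \<in> D"
      using upper_group_def by auto
    have "\<not> P dvd x"
      using subgroup.mem_carrier[OF D(1) A(2)] by simp
    then obtain z where z: "P dvd x * z - y"
      using solve_mod by blast
    have "I_plus p (smul z E12) \<in> K"
      using K by (intro I_plus_smul_mem) auto
    then have "red (mat22 x 0 0 w) \<otimes>\<^bsub>G\<^esub> I_plus p (mat22 0 z 0 0) \<in> K"
      using K A(2) by (intro subgroup.m_closed) (auto simp: E12_eq_mat22)
    moreover have "x * (P * z) - P * y = P * (x * z - y)"
      by (simp add: algebra_simps)
    then have "red (mat22 x 0 0 w) \<otimes>\<^bsub>G\<^esub> I_plus p (mat22 0 z 0 0) = a"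
      unfolding A I_plus_eq_red red_mult mat22_mult red_eq_iff using z by simp
    ultimately show "a \<in> K"
      by simp
  qed
qed

text \<open>Both matrices have the eigenvalues \<open>x\<close> and \<open>w\<close>. Away from \<open>x = w\<close> both are conjugate to
  \<open>diag(x, w)\<close>, even if the eigenvalues agree modulo \<open>p\<close>: then subtract the scalar \<open>w\<close>
  and divide by \<open>p\<close>.\<close>

lemma upper_conjugate_swap:
  "\<exists>g\<in>carrier G. conjugation G g (red (mat22 x (P * y) 0 w)) = red (mat22 w (P * y) 0 x)"
  if xw: "\<not> P dvd x" "\<not> P dvd w"
proof -
  \<comment> \<open>A matrix with equal diagonal entries intertwines the two as soon as a single congruence holds.\<close>
  have *: ?thesis if "P\<^sup>2 dvd \<alpha> * (x - w) - P * y * \<gamma>" "\<not> P dvd \<alpha> * \<alpha> - \<beta> * \<gamma>" for \<alpha> \<beta> \<gamma>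
  proof (rule bexI[of _ "red (mat22 \<alpha> \<beta> \<gamma> \<alpha>)"])
    have e: "\<alpha> * x + \<beta> * 0 - (w * \<alpha> + P * y * \<gamma>) = \<alpha> * (x - w) - P * y * \<gamma>"
      "\<alpha> * (P * y) + \<beta> * w - (w * \<beta> + P * y * \<alpha>) = 0"
      "\<gamma> * x + \<alpha> * 0 - (0 * \<alpha> + x * \<gamma>) = 0"
      "\<gamma> * (P * y) + \<alpha> * w - (0 * \<beta> + x * \<alpha>) = - (\<alpha> * (x - w) - P * y * \<gamma>)"
      by (simp_all add: algebra_simps)
    have "red (mat22 \<alpha> \<beta> \<gamma> \<alpha> ** mat22 x (P * y) 0 w) = red (mat22 w (P * y) 0 x ** mat22 \<alpha> \<beta> \<gamma> \<alpha>)"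
      unfolding mat22_mult red_eq_iff e using that(1) by (simp only: dvd_minus_iff dvd_0_right simp_thms)
    then show "conjugation G (red (mat22 \<alpha> \<beta> \<gamma> \<alpha>)) (red (mat22 x (P * y) 0 w)) = red (mat22 w (P * y) 0 x)"
      using xw that(2) by (subst conjugation_red_eq_iff) auto
  qed (use that in simp)
  show ?thesis
  proof (cases "P dvd x - w")
    case False
    then obtain t where "P dvd (x - w) * t - y"
      using solve_mod by blast
    moreover have "P * t * (x - w) - P * y * 1 = P * ((x - w) * t - y)"
      by (simp add: algebra_simps)
    moreover have "\<not> P dvd P * t * (P * t) - 1 * 1"
      using not_dvd_1 by (metis dvd_diff_right_iff dvd_triv_left dvd_mult_iff mult_1 dvd_refl)
    ultimately show ?thesis
      by (intro *[of "P * t" 1 1]) (metis sq_dvd_iff, auto)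
  next
    case True
    then obtain k where k: "x - w = P * k"
      by auto
    show ?thesis
    proof (cases "P dvd k")
      case True
      then have "P\<^sup>2 dvd x - w"
        by (simp add: k)
      then show ?thesis
        using not_dvd_1 by (intro *[of 1 0 0]) auto
    next
      case False
      then obtain \<beta> where "P dvd k * \<beta> - (y * y + 1)"
        using solve_mod by blast
      moreover have "1 = - (y * y - \<beta> * k) - (k * \<beta> - (y * y + 1))"
        by (simp add: algebra_simps)
      ultimately have "\<not> P dvd y * y - \<beta> * k"
        using not_dvd_1 by (metis dvd_diff dvd_minus_iff)
      then show ?thesis
        by (intro *[of y k \<beta>]) (simp_all add: k)
    qed
  qed
qed

lemma upper_group_locally_conjugate:
  assumes D: "subgroup D G" "D \<subseteq> split_Cartan (p\<^sup>2)"
    and swaps: "\<And>x w. red (mat22 x 0 0 w) \<in> D \<longleftrightarrow> red (mat22 w 0 0 x) \<in> D'"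
  shows "locally_conjugate G (upper_group D) (upper_group D')"
proof -
  define f where "f X = mat22 (X $ 2 $ 2) (X $ 1 $ 2) 0 (X $ 1 $ 1)" for X :: "int^2^2"
  have f: "f (red (mat22 x (P * y) 0 w)) = red (mat22 w (P * y) 0 x)" for x y w
    by (simp add: f_def vec_eq_iff forall_2)
  have "bij_betw f (upper_group D) (upper_group D')"
    by (rule bij_betw_byWitness[where f' = f])
      (use swaps in \<open>auto simp: upper_group_def f; blast\<close>)+
  moreover have "conjugate_elems G h (f h)" if "h \<in> upper_group D" for h
  proof -
    obtain x y w where h: "h = red (mat22 x (P * y) 0 w)" "red (mat22 x 0 0 w) \<in> D"
      using \<open>h \<in> upper_group D\<close> unfolding upper_group_def by auto
    then have "\<not> P dvd x" "\<not> P dvd w"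
      using subgroup.mem_carrier[OF D(1)] by force+
    then show ?thesis
      unfolding h conjugate_elems_iff f using upper_conjugate_swap by metis
  qed
  ultimately show ?thesis
    unfolding locally_conjugate_def by auto
qed

text \<open>The elements of \<open>\<langle>D, I + pE\<^sub>1\<^sub>2\<rangle>\<close> of the form \<open>I + pA\<close> with \<open>A\<close> nilpotent are the powers of
  \<open>I + pE\<^sub>1\<^sub>2\<close>. A conjugating matrix therefore preserves their span and is upper triangular modulo
  \<open>p\<close>, and such a matrix preserves the two diagonal entries and not just the set of them.\<close>

lemma upper_group_conjugate_imp_subset:
  assumes D: "subgroup D G" and D': "subgroup D' G"
    and conj: "conjugate_subgroups G (upper_group D) (upper_group D')"
    and mem: "red (mat22 x 0 0 w) \<in> D"
  shows "red (mat22 x 0 0 w) \<in> D'"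
proof -
  obtain g where g: "g \<in> carrier G" "upper_group D' = conjugation G g ` upper_group D"
    using conj conjugate_subgroups_iff by auto
  obtain \<alpha> \<beta> \<gamma> \<delta> where g22: "g = mat22 \<alpha> \<beta> \<gamma> \<delta>"
    using mat22_cases by blast
  then have red_g: "red (mat22 \<alpha> \<beta> \<gamma> \<delta>) = g" and unit_g: "\<not> P dvd \<alpha> * \<delta> - \<beta> * \<gamma>"
    using g(1) carrier_iff[of g] by auto
  have img: "\<exists>x' y' w'. red (mat22 x' 0 0 w') \<in> D' \<and>
      red (mat22 \<alpha> \<beta> \<gamma> \<delta> ** mat22 x (P * y) 0 w) = red (mat22 x' (P * y') 0 w' ** mat22 \<alpha> \<beta> \<gamma> \<delta>)"
    if "red (mat22 x 0 0 w) \<in> D" for x y w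
  proof -
    have "conjugation G g (red (mat22 x (P * y) 0 w)) \<in> upper_group D'"
      using g(2) that upper_group_iff[of x y w D] by auto
    then obtain x' y' w' where
      *: "conjugation G g (red (mat22 x (P * y) 0 w)) = red (mat22 x' (P * y') 0 w')"
        "red (mat22 x' 0 0 w') \<in> D'"
      unfolding upper_group_def by auto
    have "red (mat22 x (P * y) 0 w) \<in> carrier G" "red (mat22 x' (P * y') 0 w') \<in> carrier G"
      using subgroup.mem_carrier[OF D that] subgroup.mem_carrier[OF D' *(2)] by auto
    then have "red (mat22 \<alpha> \<beta> \<gamma> \<delta> ** mat22 x (P * y) 0 w) = red (mat22 x' (P * y') 0 w' ** mat22 \<alpha> \<beta> \<gamma> \<delta>)"
      using *(1) red_g g(1) conjugation_eq_iff by (metis red_mult)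
    then show ?thesis
      using *(2) by blast
  qed
  have "red (mat22 1 0 0 1) \<in> D"
    using subgroup.one_closed[OF D] by (simp add: one_eq_red)
  from img[OF this, of 1] obtain x1 y1 w1 where 1:
    "P\<^sup>2 dvd \<gamma> - w1 * \<gamma>" "P\<^sup>2 dvd \<gamma> * P + \<delta> - w1 * \<delta>"
    by (auto simp: red_eq_iff)
  have "P dvd \<gamma>"
  proof (rule ccontr)
    assume \<gamma>: "\<not> P dvd \<gamma>"
    have "\<gamma> - w1 * \<gamma> = \<gamma> * (1 - w1)"
      by (simp add: algebra_simps)
    then have "P\<^sup>2 dvd 1 - w1"
      using 1(1) cancel_mod_sq[OF \<gamma>] by metis
    moreover have "P * \<gamma> = (\<gamma> * P + \<delta> - w1 * \<delta>) - (1 - w1) * \<delta>"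
      by (simp add: algebra_simps)
    ultimately have "P\<^sup>2 dvd P * \<gamma>"
      using 1(2) by (metis dvd_diff dvd_mult2)
    then show False
      using \<gamma> by simp
  qed
  then obtain u where u: "\<gamma> = P * u"
    by auto
  have units: "\<not> P dvd \<alpha>" "\<not> P dvd \<delta>"
    using unit_g by (auto simp: u)
  from img[OF mem, of 0] obtain x' y' w' where 2: "red (mat22 x' 0 0 w') \<in> D'"
    "P\<^sup>2 dvd \<alpha> * x - (x' * \<alpha> + P * y' * \<gamma>)" "P\<^sup>2 dvd \<delta> * w - w' * \<delta>"
    by (auto simp: red_eq_iff)
  have "\<alpha> * (x - x') = (\<alpha> * x - (x' * \<alpha> + P * y' * \<gamma>)) + P\<^sup>2 * (y' * u)"
    "\<delta> * (w - w') = \<delta> * w - w' * \<delta>"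
    by (simp_all add: u algebra_simps power2_eq_square)
  then have "P\<^sup>2 dvd \<alpha> * (x - x')" "P\<^sup>2 dvd \<delta> * (w - w')"
    using 2(2,3) by (metis dvd_add dvd_triv_left, metis)
  then have "P\<^sup>2 dvd x - x'" "P\<^sup>2 dvd w - w'"
    using units cancel_mod_sq by blast+
  then have "red (mat22 x 0 0 w) = red (mat22 x' 0 0 w')"
    by (simp add: red_eq_iff)
  then show ?thesis
    using 2(1) by simp
qed

lemma upper_group_conjugate_imp_eq:
  assumes D: "subgroup D G" "D \<subseteq> split_Cartan (p\<^sup>2)" and D': "subgroup D' G" "D' \<subseteq> split_Cartan (p\<^sup>2)"
    and conj: "conjugate_subgroups G (upper_group D) (upper_group D')"
  shows "D = D'"
proof
  show "D \<subseteq> D'"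
    using upper_group_conjugate_imp_subset[OF D(1) D'(1) conj] D(2) split_Cartan_iff by (metis subset_eq)
  have "conjugate_subgroups G (upper_group D') (upper_group D)"
    using conjugate_subgroups_sym subgroup.subset subgroup_upper_group[OF D] conj by blast
  from upper_group_conjugate_imp_subset[OF D'(1) D(1) this]
  show "D' \<subseteq> D"
    using D'(2) split_Cartan_iff by (metis subset_eq)
qed

end

section \<open>Invariants of conjugacy and the goal of the classification\<close>

text \<open>For the trace, take the trace of \<open>(gA - Bg) adj(g)\<close>, which is \<open>det g (tr A - tr B)\<close>.\<close>

lemma conj_invariants:
  assumes cop: "coprime (det g) (int n)" and eq: "mat2_mod n (g ** A) = mat2_mod n (B ** g)"
  shows "int n dvd (A $ 1 $ 1 + A $ 2 $ 2) - (B $ 1 $ 1 + B $ 2 $ 2)" "int n dvd det A - det B"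
proof -
  obtain a b c d a' b' c' d' \<alpha> \<beta> \<gamma> \<delta> where
    AB: "A = mat22 a b c d" "B = mat22 a' b' c' d'" "g = mat22 \<alpha> \<beta> \<gamma> \<delta>"
    by (metis mat22_cases)
  have cancel: "int n dvd x" if "int n dvd (\<alpha> * \<delta> - \<beta> * \<gamma>) * x" for x
    using that cop unfolding AB det_mat22 by (metis coprime_commute coprime_dvd_mult_right_iff)
  have d: "int n dvd \<alpha> * a + \<beta> * c - (a' * \<alpha> + b' * \<gamma>)" "int n dvd \<alpha> * b + \<beta> * d - (a' * \<beta> + b' * \<delta>)"
      "int n dvd \<gamma> * a + \<delta> * c - (c' * \<alpha> + d' * \<gamma>)" "int n dvd \<gamma> * b + \<delta> * d - (c' * \<beta> + d' * \<delta>)"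
    using eq unfolding AB mat22_mult mat2_mod_mat22_eq_iff by auto
  have "(\<alpha> * \<delta> - \<beta> * \<gamma>) * ((a + d) - (a' + d')) =
      (\<alpha> * a + \<beta> * c - (a' * \<alpha> + b' * \<gamma>)) * \<delta> - (\<alpha> * b + \<beta> * d - (a' * \<beta> + b' * \<delta>)) * \<gamma>
      - (\<gamma> * a + \<delta> * c - (c' * \<alpha> + d' * \<gamma>)) * \<beta> + (\<gamma> * b + \<delta> * d - (c' * \<beta> + d' * \<delta>)) * \<alpha>"
    by (simp add: algebra_simps)
  moreover have "int n dvd \<dots>"
    by (intro dvd_add dvd_diff; rule dvd_mult2; fact d)
  ultimately show "int n dvd (A $ 1 $ 1 + A $ 2 $ 2) - (B $ 1 $ 1 + B $ 2 $ 2)"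
    unfolding AB mat22_nth by (metis cancel)
  have "[det (g ** A) = det (B ** g)] (mod int n)"
    using cong_det_mat2_mod eq cong_sym cong_trans by metis
  then have "int n dvd det g * det A - det B * det g"
    unfolding det_mul cong_iff_dvd_diff .
  then have "int n dvd det g * (det A - det B)"
    by (simp add: algebra_simps)
  then show "int n dvd det A - det B"
    using cop by (metis coprime_commute coprime_dvd_mult_right_iff)
qed

context odd_prime
begin

lemma coprime_P_iff: "coprime a (int p) \<longleftrightarrow> \<not> P dvd a"
  by (metis coprime_commute coprime_def dvd_refl not_prime_unit prime_P prime_imp_coprime)

lemma conj_invariants_mod_p:
  assumes "\<not> P dvd det g" "mat2_mod p (g ** mat22 a b c d) = mat2_mod p (mat22 a' b' c' d' ** g)"
  shows "P dvd (a + d) - (a' + d')" "P dvd (a * d - b * c) - (a' * d' - b' * c')"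
  using conj_invariants[OF _ assms(2)] assms(1) by (simp_all add: coprime_P_iff)

lemma conjugation_conj_invariants:
  assumes g: "g \<in> carrier G" and A: "red (mat22 a b c d) \<in> carrier G" "red (mat22 a' b' c' d') \<in> carrier G"
    and eq: "conjugation G g (red (mat22 a b c d)) = red (mat22 a' b' c' d')"
  shows "P\<^sup>2 dvd (a + d) - (a' + d')" "P\<^sup>2 dvd (a * d - b * c) - (a' * d' - b' * c')"
proof -
  have u: "\<not> P dvd det g" "red g = g"
    using g carrier_iff by auto
  then have "red (g ** mat22 a b c d) = red (mat22 a' b' c' d' ** g)"
    using eq conjugation_red_eq_iff[of g "mat22 a b c d" "mat22 a' b' c' d'"] A by simp
  from conj_invariants[OF _ this] u
  show "P\<^sup>2 dvd (a + d) - (a' + d')" "P\<^sup>2 dvd (a * d - b * c) - (a' * d' - b' * c')"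
    by (simp_all add: coprime_sq_iff[simplified])
qed

lemma conj_mod_p_ex:
  assumes "\<not> P dvd det g"
  shows "\<exists>B. mat2_mod p (g ** A) = mat2_mod p (B ** g)"
proof -
  obtain a b c d \<alpha> \<beta> \<gamma> \<delta> where AB: "A = mat22 a b c d" "g = mat22 \<alpha> \<beta> \<gamma> \<delta>"
    by (metis mat22_cases)
  obtain u where u: "P dvd det g * u - 1"
    using solve_mod[OF assms] by blast
  let ?B = "smul u (g ** A ** mat22 \<delta> (- \<beta>) (- \<gamma>) \<alpha>)"
  have "?B ** g = smul (det g * u) (g ** A)"
    unfolding AB by (simp add: algebra_simps)
  moreover have "mat2_mod p (smul (det g * u) X) = mat2_mod p X" for X
  proof -
    have "P dvd (det g * u) * x - x" for x
    proof -
      have "(det g * u) * x - x = (det g * u - 1) * x"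
        by (simp add: algebra_simps)
      then show ?thesis
        using u by simp
    qed
    then show ?thesis
      by (simp add: mat2_mod_eq_iff smul_def)
  qed
  ultimately show ?thesis
    by metis
qed

lemma I_plus_conj_ex:
  assumes "locally_conjugate G H K" "I_plus p A \<in> H"
  obtains g B where "\<not> P dvd det g" "I_plus p B \<in> K" "mat2_mod p (g ** A) = mat2_mod p (B ** g)"
proof -
  obtain g where g: "g \<in> carrier G" "conjugation G g (I_plus p A) \<in> K"
    using locally_conjugateE[OF assms] by blast
  then have u: "\<not> P dvd det g" "red g = g"
    using carrier_iff by auto
  then obtain B where B: "mat2_mod p (g ** A) = mat2_mod p (B ** g)"
    using conj_mod_p_ex by blast
  then show ?thesis
    using that[of g B] conjugation_I_plus[OF u(1) B] u g(2) by simp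
qed

text \<open>For groups that are not conjugate the inequality \<open>D \<noteq> D'\<close> follows, since equal \<open>D\<close> and \<open>D'\<close>
  give conjugate groups.\<close>

definition swapped_pair :: "(int^2^2) set \<Rightarrow> (int^2^2) set \<Rightarrow> bool" where
  "swapped_pair H K \<longleftrightarrow> (\<exists>D D'. subgroup D G \<and> subgroup D' G \<and> D \<subseteq> split_Cartan (p\<^sup>2) \<and>
    D' \<subseteq> split_Cartan (p\<^sup>2) \<and> diagonal_swaps D D' \<and>
    conjugate_subgroups G H (upper_group D) \<and> conjugate_subgroups G K (upper_group D'))"

definition resolved :: "(int^2^2) set \<Rightarrow> (int^2^2) set \<Rightarrow> bool" where
  "resolved H K \<longleftrightarrow> conjugate_subgroups G H K \<or> swapped_pair H K"

lemma swapped_pair_sym: "swapped_pair H K \<Longrightarrow> swapped_pair K H"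
  unfolding swapped_pair_def diagonal_swaps_def by blast

lemma resolved_conjugate:
  assumes H: "subgroup H G" "subgroup K G" "conjugate_subgroups G H H'" "conjugate_subgroups G K K'"
    and "resolved H' K'"
  shows "resolved H K"
proof -
  note c = subgroup.subset[OF H(1)] subgroup.subset[OF H(2)]
  from assms(5) consider "conjugate_subgroups G H' K'" | "swapped_pair H' K'"
    using resolved_def by blast
  then show ?thesis
  proof cases
    case 1
    have "K' \<subseteq> carrier G"
      using c(2) H(4) conjugate_subgroups_iff by auto
    then show ?thesis
      using 1 c H conjugate_subgroups_trans conjugate_subgroups_sym unfolding resolved_def by meson
  next
    case 2
    then show ?thesis
      using c H conjugate_subgroups_trans unfolding resolved_def swapped_pair_def by meson
  qed
qed

lemma subgroup_split_Cartan: "subgroup (split_Cartan (p\<^sup>2)) G"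
proof (rule finite_subgroupI[OF finite_carrier])
  show "split_Cartan (p\<^sup>2) \<subseteq> carrier G"
    by (auto simp: split_Cartan_def)
  have "red (mat22 1 0 0 1) \<in> split_Cartan (p\<^sup>2)"
    using split_Cartan_iff not_dvd_1 by metis
  then show "split_Cartan (p\<^sup>2) \<noteq> {}"
    by auto
  fix a b assume "a \<in> split_Cartan (p\<^sup>2)" "b \<in> split_Cartan (p\<^sup>2)"
  then obtain x w x' w' where ab: "a = red (mat22 x 0 0 w)" "\<not> P dvd x" "\<not> P dvd w"
    "b = red (mat22 x' 0 0 w')" "\<not> P dvd x'" "\<not> P dvd w'"
    using split_Cartan_iff[of a] split_Cartan_iff[of b] by blast
  show "a \<otimes>\<^bsub>G\<^esub> b \<in> split_Cartan (p\<^sup>2)"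
    unfolding split_Cartan_iff ab(1,4) red_mult mat22_mult using ab
    by (intro exI[of _ "x * x'"] exI[of _ "w * w'"]) simp
qed

lemma red_upper_factor:
  "red (mat22 x 0 0 w) \<otimes>\<^bsub>G\<^esub> I_plus p (mat22 0 y 0 0) = red (mat22 x (P * (x * y)) 0 w)"
  by (simp add: I_plus_eq_red red_eq_iff algebra_simps)

lemma mult_mem_cancel:
  assumes "subgroup H G" "a \<in> carrier G" "b \<in> H"
  shows "a \<otimes>\<^bsub>G\<^esub> b \<in> H \<longleftrightarrow> a \<in> H"
proof
  assume "a \<otimes>\<^bsub>G\<^esub> b \<in> H"
  then have "a \<otimes>\<^bsub>G\<^esub> b \<otimes>\<^bsub>G\<^esub> inv\<^bsub>G\<^esub> b \<in> H"
    using subgroup.m_closed[OF assms(1) _ subgroup.m_inv_closed[OF assms(1,3)]] by blast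
  then show "a \<in> H"
    using assms subgroup.mem_carrier[OF assms(1,3)] by (simp add: m_assoc)
qed (use assms in \<open>auto intro: subgroup.m_closed\<close>)

lemma upper_mem_iff:
  assumes H: "subgroup H G" "I_plus p (mat22 0 1 0 0) \<in> H" and u: "\<not> P dvd x" "\<not> P dvd w"
  shows "red (mat22 x (P * y) 0 w) \<in> H \<longleftrightarrow> red (mat22 x 0 0 w) \<in> H"
proof -
  obtain z where z: "P dvd x * z - y"
    using solve_mod u(1) by blast
  have "P * (x * z) - P * y = P * (x * z - y)"
    by (simp add: algebra_simps)
  then have "red (mat22 x (P * y) 0 w) = red (mat22 x 0 0 w) \<otimes>\<^bsub>G\<^esub> I_plus p (mat22 0 z 0 0)"
    using z unfolding red_upper_factor red_eq_iff by (metis dvd_diff_commute dvd_0_right diff_self sq_dvd_iff)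
  moreover have "I_plus p (mat22 0 z 0 0) \<in> H"
    using I_plus_smul_mem[OF H, of z] by simp
  ultimately show ?thesis
    using mult_mem_cancel[OF H(1)] u by simp
qed

text \<open>Groups of this shape are recovered from their intersections with the diagonal group.\<close>

lemma swapped_pairI:
  assumes H: "subgroup H G" "I_plus p (mat22 0 1 0 0) \<in> H"
      "\<And>X. X \<in> H \<Longrightarrow> \<exists>x y w. X = red (mat22 x (P * y) 0 w)"
    and K: "subgroup K G" "I_plus p (mat22 0 1 0 0) \<in> K"
      "\<And>X. X \<in> K \<Longrightarrow> \<exists>x y w. X = red (mat22 x (P * y) 0 w)"
    and swap: "\<And>x w. red (mat22 x 0 0 w) \<in> H \<longleftrightarrow> red (mat22 w 0 0 x) \<in> K"
  shows "swapped_pair H K"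
proof -
  have *: "upper_group (S \<inter> split_Cartan (p\<^sup>2)) = S" "subgroup (S \<inter> split_Cartan (p\<^sup>2)) G"
    if S: "subgroup S G" "I_plus p (mat22 0 1 0 0) \<in> S"
      "\<And>X. X \<in> S \<Longrightarrow> \<exists>x y w. X = red (mat22 x (P * y) 0 w)" for S
  proof -
    show "subgroup (S \<inter> split_Cartan (p\<^sup>2)) G"
      by (rule subgroups_Inter_pair[OF S(1) subgroup_split_Cartan])
    have unit: "\<not> P dvd x \<and> \<not> P dvd w" if "red (mat22 x (P * y) 0 w) \<in> S" for x y w
      using subgroup.mem_carrier[OF S(1) that] by simp
    show "upper_group (S \<inter> split_Cartan (p\<^sup>2)) = S"
    proof
      show "upper_group (S \<inter> split_Cartan (p\<^sup>2)) \<subseteq> S"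
        using upper_mem_iff[OF S(1,2)] unit[of _ 0] unfolding upper_group_def by auto
      show "S \<subseteq> upper_group (S \<inter> split_Cartan (p\<^sup>2))"
      proof
        fix X assume X: "X \<in> S"
        then obtain x y w where xyw: "X = red (mat22 x (P * y) 0 w)"
          using S(3) by blast
        then have "red (mat22 x 0 0 w) \<in> S" "red (mat22 x 0 0 w) \<in> split_Cartan (p\<^sup>2)"
          using upper_mem_iff[OF S(1,2)] unit X split_Cartan_iff by blast+
        then show "X \<in> upper_group (S \<inter> split_Cartan (p\<^sup>2))"
          unfolding xyw upper_group_iff by simp
      qed
    qed
  qed
  have "red (mat22 x 0 0 w) \<in> split_Cartan (p\<^sup>2) \<longleftrightarrow> red (mat22 w 0 0 x) \<in> split_Cartan (p\<^sup>2)" for x w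
    unfolding split_Cartan_iff red_eq_iff
    using subgroup.mem_carrier[OF subgroup_split_Cartan] by blast
  then have "diagonal_swaps (H \<inter> split_Cartan (p\<^sup>2)) (K \<inter> split_Cartan (p\<^sup>2))"
    using swap by (subst diagonal_swaps_iff) auto
  then show ?thesis
    unfolding swapped_pair_def using *[OF H] *[OF K] H(1) K(1)
    by (intro exI[of _ "H \<inter> split_Cartan (p\<^sup>2)"] exI[of _ "K \<inter> split_Cartan (p\<^sup>2)"])
      (simp add: conjugate_subgroups_refl subgroup.subset)
qed

section \<open>Groups with scalar reduction\<close>

lemma fermat_int: "P dvd a ^ p - a"
proof (cases "P dvd a")
  case True
  then show ?thesis
    using p_ge_3 by (intro dvd_diff) (auto intro: dvd_power_iff dvd_trans[OF _ dvd_power])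
next
  case False
  define n where "n = nat (a mod P)"
  have n: "int n = a mod P"
    using p_ge_3 by (simp add: n_def)
  then have "\<not> p dvd n"
    using False by (metis dvd_mod_iff dvd_refl int_dvd_int_iff)
  then have "[n ^ (p - 1) = 1] (mod p)"
    using prime_p fermat_theorem by blast
  then have "[int n ^ (p - 1) = 1] (mod P)"
    by (metis cong_int_iff of_nat_1 of_nat_power)
  then have "[a ^ (p - 1) = 1] (mod P)"
    unfolding n by (simp add: cong_def power_mod)
  then have "[a ^ (p - 1) * a = 1 * a] (mod P)"
    by (rule cong_scalar_right)
  moreover have "a ^ (p - 1) * a = a ^ p"
    using p_ge_3 by (metis Suc_diff_1 not_numeral_le_zero not_gr_zero power_Suc2)
  ultimately show ?thesis
    by (simp add: cong_iff_dvd_diff)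
qed

lemma fermat_int_unit:
  assumes "\<not> P dvd a"
  shows "P dvd a ^ (p - 1) - 1"
proof -
  have "a * (a ^ (p - 1) - 1) = a ^ p - a"
    using p_ge_3 by (simp add: right_diff_distrib flip: power_Suc)
  then show ?thesis
    using fermat_int[of a] assms dvd_mult_iff by metis
qed

text \<open>The quotient \<open>(x\<^sup>p - y\<^sup>p) / (x - y)\<close> is a sum of \<open>p\<close> terms that are congruent modulo \<open>p\<close>.\<close>

lemma power_p_cong:
  assumes "P dvd x - y"
  shows "P\<^sup>2 dvd x ^ p - y ^ p"
proof -
  have "[(\<Sum>i<p. y ^ (p - Suc i) * x ^ i) = (\<Sum>i<p. x ^ (p - 1))] (mod P)"
  proof (rule cong_sum)
    fix i assume "i \<in> {..<p}"
    then have "x ^ (p - 1) = x ^ (p - Suc i) * x ^ i"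
      by (simp flip: power_add)
    moreover have "[y = x] (mod P)"
      using assms by (simp add: cong_iff_dvd_diff dvd_diff_commute)
    ultimately show "[y ^ (p - Suc i) * x ^ i = x ^ (p - 1)] (mod P)"
      by (metis cong_pow cong_scalar_right)
  qed
  then have "P dvd (\<Sum>i<p. y ^ (p - Suc i) * x ^ i)"
    by (simp add: cong_dvd_iff)
  then show ?thesis
    unfolding power_diff_sumr2 power2_eq_square using assms by (rule mult_dvd_mono[rotated])
qed

text \<open>The \<open>p\<close>-th powers are the Teichmueller representatives of the residues modulo \<open>p\<close>.\<close>

lemma power_p_power_p: "P\<^sup>2 dvd (a ^ p) ^ p - a ^ p"
  using power_p_cong[OF fermat_int] .

lemma dvd_power_p_iff [simp]: "P dvd a ^ n \<longleftrightarrow> P dvd a \<and> n \<noteq> 0"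
  using prime_P by (metis not_dvd_1 power_0 prime_dvd_power_iff neq0_conv)

lemma red_diag_power:
  "\<not> P dvd x \<Longrightarrow> \<not> P dvd w \<Longrightarrow> red (mat22 x 0 0 w) [^]\<^bsub>G\<^esub> (n::nat) = red (mat22 (x ^ n) 0 0 (w ^ n))"
  by (induction n) (simp_all add: one_eq_red mult.commute)

lemma subgroup_power_mem:
  assumes "subgroup H G" "x \<in> H"
  shows "x [^]\<^bsub>G\<^esub> (n::nat) \<in> H"
  using assms by (induction n) (auto intro: subgroup.one_closed subgroup.m_closed)

lemma I_plus_power: "I_plus p A [^]\<^bsub>G\<^esub> (n::nat) = I_plus p (smul (int n) A)"
proof (induction n)
  case 0
  then show ?case
    by (cases A rule: mat22_cases) simp
next
  case (Suc n)
  have "smul (int n) A + A = smul (int (Suc n)) A"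
    by (cases A rule: mat22_cases) (simp add: algebra_simps)
  with Suc show ?case
    by (simp add: I_plus_mult)
qed

definition scalar_mod_p :: "(int^2^2) set \<Rightarrow> bool" where
  "scalar_mod_p H \<longleftrightarrow> subgroup H G \<and>
    (\<forall>a b c d. red (mat22 a b c d) \<in> H \<longrightarrow> P dvd b \<and> P dvd c \<and> P dvd a - d)"

lemma scalar_mod_p_subgroup: "scalar_mod_p H \<Longrightarrow> subgroup H G"
  by (simp add: scalar_mod_p_def)

text \<open>Every element is a Teichmueller scalar times some \<open>I + pA\<close>. As \<open>I + pA\<close> has order dividing
  \<open>p\<close>, the scalar is the \<open>p\<close>-th power of the element and belongs to the group.\<close>

lemma scalar_mod_p_factor:
  assumes H: "scalar_mod_p H" and X: "X \<in> H"
  obtains t A where "\<not> P dvd t" "red (mat22 t 0 0 t) \<in> H" "I_plus p A \<in> H"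
    "X = red (mat22 t 0 0 t) \<otimes>\<^bsub>G\<^esub> I_plus p A"
proof -
  note sg = scalar_mod_p_subgroup[OF H]
  obtain a b c d where X22: "X = mat22 a b c d"
    using mat22_cases by blast
  have Xred: "red (mat22 a b c d) = X" and Xc: "X \<in> carrier G"
    using X subgroup.mem_carrier[OF sg] X22 red_carrier by auto
  have bcd: "P dvd b" "P dvd c" "P dvd a - d"
    using H X unfolding scalar_mod_p_def Xred[symmetric] by blast+
  have u: "\<not> P dvd a * d - b * c"
    using Xc carrier_iff[of X] unfolding X22 by simp
  have a: "\<not> P dvd a"
    using u bcd(1) by auto
  define t where "t = a ^ p"
  have t: "\<not> P dvd t"
    using a by (simp add: t_def)
  have sol: "\<exists>z. P\<^sup>2 dvd t * (P * z) - x" if "P dvd x" for x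
  proof -
    obtain y where y: "x = P * y"
      using \<open>P dvd x\<close> by auto
    obtain z where "P dvd t * z - y"
      using solve_mod[OF t] by blast
    moreover have "t * (P * z) - x = P * (t * z - y)"
      by (simp add: y algebra_simps)
    ultimately show ?thesis
      by (metis sq_dvd_iff)
  qed
  have "P dvd a - t" "P dvd d - t"
    using fermat_int[of a] bcd(3) unfolding t_def
    by (metis dvd_diff_commute, metis diff_add_cancel diff_diff_eq2 dvd_add dvd_diff_commute add.commute diff_add_eq)
  then obtain A11 A12 A21 A22 where
    A: "P\<^sup>2 dvd t * (P * A11) - (a - t)" "P\<^sup>2 dvd t * (P * A12) - b"
      "P\<^sup>2 dvd t * (P * A21) - c" "P\<^sup>2 dvd t * (P * A22) - (d - t)"
    using sol bcd by meson
  define A where "A = mat22 A11 A12 A21 A22"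
  have XA: "X = red (mat22 t 0 0 t) \<otimes>\<^bsub>G\<^esub> I_plus p A"
    unfolding Xred[symmetric] A_def I_plus_eq_red red_mult mat22_mult red_eq_iff
    using A by (simp add: algebra_simps dvd_diff_commute)
  have comm: "red (mat22 t 0 0 t) \<otimes>\<^bsub>G\<^esub> I_plus p A = I_plus p A \<otimes>\<^bsub>G\<^esub> red (mat22 t 0 0 t)"
    unfolding A_def I_plus_eq_red red_mult mat22_mult by (simp add: mult.commute)
  have "I_plus p A [^]\<^bsub>G\<^esub> p = \<one>\<^bsub>G\<^esub>"
    unfolding I_plus_power I_plus_0[symmetric] I_plus_eq_iff by (simp add: A_def mat2_mod_mat22_eq_iff)
  then have "X [^]\<^bsub>G\<^esub> p = red (mat22 (t ^ p) 0 0 (t ^ p))"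
    unfolding XA using pow_mult_distrib[OF comm] t by (simp add: red_diag_power)
  also have "\<dots> = red (mat22 t 0 0 t)"
    using power_p_power_p[of a] by (simp add: red_eq_iff t_def)
  finally have tH: "red (mat22 t 0 0 t) \<in> H"
    using subgroup_power_mem[OF sg X, of p] by simp
  moreover have "I_plus p A \<in> H"
  proof -
    have "I_plus p A \<otimes>\<^bsub>G\<^esub> red (mat22 t 0 0 t) \<in> H"
      using X XA comm by simp
    then show ?thesis
      using mult_mem_cancel[OF sg I_plus_carrier tH] by simp
  qed
  ultimately show ?thesis
    using that t XA by blast
qed

lemma scalar_central:
  assumes "\<not> P dvd t" "g \<in> carrier G"
  shows "conjugation G g (red (mat22 t 0 0 t)) = red (mat22 t 0 0 t)"
proof -
  have "red g \<otimes>\<^bsub>G\<^esub> red (mat22 t 0 0 t) = red (mat22 t 0 0 t) \<otimes>\<^bsub>G\<^esub> red g"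
    unfolding red_mult by (cases g rule: mat22_cases) (simp add: mult.commute)
  then show ?thesis
    using assms by (simp add: conjugation_eq_iff)
qed

text \<open>Scalar matrices are central, so locally conjugate groups contain the same ones, and only the
  elements \<open>I + pA\<close> have to be conjugated.\<close>

lemma scalar_conjugateI:
  assumes H: "scalar_mod_p H" and K: "scalar_mod_p K" and lc: "locally_conjugate G H K"
    and g: "g \<in> carrier G" "\<And>A. I_plus p A \<in> H \<Longrightarrow> conjugation G g (I_plus p A) \<in> K"
  shows "conjugate_subgroups G H K"
proof (rule conjugate_subgroups_if_subset[OF g(1)])
  note sH = scalar_mod_p_subgroup[OF H] and sK = scalar_mod_p_subgroup[OF K]
  show "H \<subseteq> carrier G" "finite K"
    using sH sK subgroup.subset finite_carrier finite_subset by blast+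
  show "card H = card K"
    by (rule locally_conjugate_card[OF lc])
  show "conjugation G g X \<in> K" if "X \<in> H" for X
  proof -
    obtain t A where t: "\<not> P dvd t" "red (mat22 t 0 0 t) \<in> H" "I_plus p A \<in> H"
      "X = red (mat22 t 0 0 t) \<otimes>\<^bsub>G\<^esub> I_plus p A"
      using scalar_mod_p_factor[OF H \<open>X \<in> H\<close>] by blast
    have "red (mat22 t 0 0 t) \<in> K"
      using locally_conjugateE[OF lc t(2)] scalar_central[OF t(1)] by metis
    then have "red (mat22 t 0 0 t) \<otimes>\<^bsub>G\<^esub> conjugation G g (I_plus p A) \<in> K"
      using g(2)[OF t(3)] subgroup.m_closed[OF sK] by blast
    then show ?thesis
      unfolding t(4) using t(1) g(1) by (simp add: conjugation_mult scalar_central)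
  qed
qed

lemma scalar_conjugateI_mod_p:
  assumes H: "scalar_mod_p H" and K: "scalar_mod_p K" and lc: "locally_conjugate G H K"
    and g: "\<not> P dvd det g"
      "\<And>A. I_plus p A \<in> H \<Longrightarrow> \<exists>B. I_plus p B \<in> K \<and> mat2_mod p (g ** A) = mat2_mod p (B ** g)"
  shows "conjugate_subgroups G H K"
proof (rule scalar_conjugateI[OF H K lc, of "red g"])
  show "conjugation G (red g) (I_plus p A) \<in> K" if "I_plus p A \<in> H" for A
    using g(2)[OF that] conjugation_I_plus[OF g(1)] by metis
qed (use g(1) in simp)

end

context odd_prime
begin

text \<open>Under \<open>A \<mapsto> I + pA\<close> the following two groups correspond to all matrices over \<open>\<int>/p\<int>\<close> and to those
  of trace zero.\<close>

definition ker :: "(int^2^2) set" where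
  "ker = range (I_plus p)"

definition ker0 :: "(int^2^2) set" where
  "ker0 = I_plus p ` {A. P dvd A $ 1 $ 1 + A $ 2 $ 2}"

lemma I_plus_mem_ker [simp]: "I_plus p A \<in> ker"
  by (simp add: ker_def)

lemma I_plus_mem_ker0_iff: "I_plus p A \<in> ker0 \<longleftrightarrow> P dvd A $ 1 $ 1 + A $ 2 $ 2"
proof
  assume "I_plus p A \<in> ker0"
  then obtain B where B: "P dvd B $ 1 $ 1 + B $ 2 $ 2" "mat2_mod p A = mat2_mod p B"
    unfolding ker0_def by (auto simp: I_plus_eq_iff)
  then have "P dvd A $ 1 $ 1 - B $ 1 $ 1" "P dvd A $ 2 $ 2 - B $ 2 $ 2"
    using mat2_mod_eq_iff by auto
  then have "P dvd (A $ 1 $ 1 - B $ 1 $ 1) + (A $ 2 $ 2 - B $ 2 $ 2) + (B $ 1 $ 1 + B $ 2 $ 2)"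
    using B(1) dvd_add by blast
  then show "P dvd A $ 1 $ 1 + A $ 2 $ 2"
    by simp
qed (auto simp: ker0_def)

lemma subgroup_ker: "subgroup ker G"
  by (rule finite_subgroupI[OF finite_carrier]) (auto simp: ker_def I_plus_mult)

lemma subgroup_ker0: "subgroup ker0 G"
proof (rule finite_subgroupI[OF finite_carrier])
  show "ker0 \<subseteq> carrier G"
    by (auto simp: ker0_def)
  have "I_plus p (mat22 0 0 0 0) \<in> ker0"
    by (simp only: I_plus_mem_ker0_iff mat22_nth add_0 dvd_0_right)
  then show "ker0 \<noteq> {}"
    by blast
  fix a b assume "a \<in> ker0" "b \<in> ker0"
  then obtain A B where AB: "a = I_plus p A" "P dvd A $ 1 $ 1 + A $ 2 $ 2"
    "b = I_plus p B" "P dvd B $ 1 $ 1 + B $ 2 $ 2"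
    by (auto simp: ker0_def)
  show "a \<otimes>\<^bsub>G\<^esub> b \<in> ker0"
    unfolding AB I_plus_mult I_plus_mem_ker0_iff
    using dvd_add[OF AB(2,4)] by (simp add: algebra_simps)
qed

lemma conjugation_I_plus_ex:
  assumes "g \<in> carrier G"
  obtains B where "conjugation G g (I_plus p A) = I_plus p B"
    "mat2_mod p (g ** A) = mat2_mod p (B ** g)"
proof -
  have u: "\<not> P dvd det g" "red g = g"
    using assms carrier_iff by auto
  then obtain B where "mat2_mod p (g ** A) = mat2_mod p (B ** g)"
    using conj_mod_p_ex by blast
  then show ?thesis
    using that conjugation_I_plus[OF u(1)] u(2) by metis
qed

lemma conjugation_ker: "g \<in> carrier G \<Longrightarrow> x \<in> ker \<Longrightarrow> conjugation G g x \<in> ker"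
  unfolding ker_def by (metis conjugation_I_plus_ex image_iff rangeI)

lemma trace_conj_mod_p:
  assumes "\<not> P dvd det g" "mat2_mod p (g ** A) = mat2_mod p (B ** g)"
  shows "P dvd A $ 1 $ 1 + A $ 2 $ 2 \<longleftrightarrow> P dvd B $ 1 $ 1 + B $ 2 $ 2"
  using conj_invariants(1)[OF _ assms(2)] assms(1) coprime_P_iff
  by (metis diff_add_cancel dvd_add_right_iff)

lemma conjugation_ker0: "g \<in> carrier G \<Longrightarrow> x \<in> ker0 \<Longrightarrow> conjugation G g x \<in> ker0"
proof -
  assume g: "g \<in> carrier G" and "x \<in> ker0"
  then obtain A where A: "x = I_plus p A" "P dvd A $ 1 $ 1 + A $ 2 $ 2"
    by (auto simp: ker0_def)
  obtain B where B: "conjugation G g (I_plus p A) = I_plus p B"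
    "mat2_mod p (g ** A) = mat2_mod p (B ** g)"
    using conjugation_I_plus_ex[OF g] by blast
  then show "conjugation G g x \<in> ker0"
    using trace_conj_mod_p[OF _ B(2)] A g carrier_iff[of g] by (simp add: I_plus_mem_ker0_iff)
qed

lemma conjugation_mem_iff_if_closed:
  assumes "\<And>g x. g \<in> carrier G \<Longrightarrow> x \<in> S \<Longrightarrow> conjugation G g x \<in> S"
    and "g \<in> carrier G" "x \<in> carrier G"
  shows "conjugation G g x \<in> S \<longleftrightarrow> x \<in> S"
  using assms by (metis conjugation_inv_cancel(1) inv_closed)

lemma inj_residues: "a \<in> {0..<P} \<Longrightarrow> b \<in> {0..<P} \<Longrightarrow> P dvd a - b \<Longrightarrow> a = b"
  by (metis atLeastLessThan_iff mod_eq_dvd_iff mod_pos_pos_trivial)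

lemma card_ker: "card ker = p ^ 4"
proof -
  let ?R = "{0..<P}"
  let ?F = "\<lambda>(a, b, c, d). I_plus p (mat22 a b c d)"
  have "inj_on ?F (?R \<times> ?R \<times> ?R \<times> ?R)"
    using inj_residues by (auto simp: inj_on_def I_plus_eq_iff mat2_mod_mat22_eq_iff)
  moreover have "?F ` (?R \<times> ?R \<times> ?R \<times> ?R) = ker"
  proof
    show "ker \<subseteq> ?F ` (?R \<times> ?R \<times> ?R \<times> ?R)"
    proof
      fix x assume "x \<in> ker"
      then obtain a b c d where "x = I_plus p (mat22 a b c d)"
        unfolding ker_def by (metis imageE mat22_cases)
      then have "x = ?F (a mod P, b mod P, c mod P, d mod P)"
        by (simp add: I_plus_eq_iff mat2_mod_mat22_eq_iff dvd_minus_mod)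
      moreover have "(a mod P, b mod P, c mod P, d mod P) \<in> ?R \<times> ?R \<times> ?R \<times> ?R"
        using p_ge_3 by simp
      ultimately show "x \<in> ?F ` (?R \<times> ?R \<times> ?R \<times> ?R)"
        by (rule image_eqI)
    qed
  qed auto
  ultimately have "card ker = card (?R \<times> ?R \<times> ?R \<times> ?R)"
    using card_image by fastforce
  then show ?thesis
    by (simp add: card_cartesian_product power4_eq_xxxx)
qed

lemma card_ker0: "card ker0 = p ^ 3"
proof -
  let ?R = "{0..<P}"
  let ?F = "\<lambda>(a, b, c). I_plus p (mat22 a b c (- a))"
  have "inj_on ?F (?R \<times> ?R \<times> ?R)"
    using inj_residues by (auto simp: inj_on_def I_plus_eq_iff mat2_mod_mat22_eq_iff)
  moreover have "?F ` (?R \<times> ?R \<times> ?R) = ker0"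
  proof
    show "?F ` (?R \<times> ?R \<times> ?R) \<subseteq> ker0"
      by (auto simp: I_plus_mem_ker0_iff)
    show "ker0 \<subseteq> ?F ` (?R \<times> ?R \<times> ?R)"
    proof
      fix x assume "x \<in> ker0"
      then obtain a b c d where x: "x = I_plus p (mat22 a b c d)" "P dvd a + d"
      proof -
        obtain A where "x = I_plus p A" "P dvd A $ 1 $ 1 + A $ 2 $ 2"
          using \<open>x \<in> ker0\<close> by (auto simp: ker0_def)
        then show ?thesis
          using that by (cases A rule: mat22_cases) auto
      qed
      have "P dvd d - - (a mod P)"
        using dvd_diff[OF x(2) dvd_minus_mod[of P a]] by (simp add: algebra_simps)
      then have "x = ?F (a mod P, b mod P, c mod P)"
        using x(1) by (simp add: I_plus_eq_iff mat2_mod_mat22_eq_iff dvd_minus_mod)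
      moreover have "(a mod P, b mod P, c mod P) \<in> ?R \<times> ?R \<times> ?R"
        using p_ge_3 by simp
      ultimately show "x \<in> ?F ` (?R \<times> ?R \<times> ?R)"
        by (rule image_eqI)
    qed
  qed
  ultimately have "card ker0 = card (?R \<times> ?R \<times> ?R)"
    using card_image by fastforce
  then show ?thesis
    by (simp add: card_cartesian_product power3_eq_cube)
qed

lemma finite_ker: "finite ker"
  using card_ker p_ge_3 card_gt_0_iff by fastforce

lemma card_Int_ker:
  assumes "subgroup H G"
  obtains k where "k \<le> 4" "card (H \<inter> ker) = p ^ k"
proof -
  have "subgroup (H \<inter> ker) (G\<lparr>carrier := ker\<rparr>)"
    using subgroup_incl[OF subgroups_Inter_pair[OF assms subgroup_ker] subgroup_ker] by auto
  then have "card (H \<inter> ker) dvd order (G\<lparr>carrier := ker\<rparr>)"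
    using group.lagrange[OF subgroup_imp_group[OF subgroup_ker]] by (metis dvd_triv_right)
  then have "card (H \<inter> ker) dvd p ^ 4"
    by (simp add: order_def card_ker)
  then show ?thesis
    using that divides_primepow_nat[OF prime_p] by auto
qed

lemma locally_conjugate_Int_ker:
  assumes "H \<subseteq> carrier G" "locally_conjugate G H K"
  shows "locally_conjugate G (H \<inter> ker) (K \<inter> ker)" "card (H \<inter> ker) = card (K \<inter> ker)"
proof -
  show "locally_conjugate G (H \<inter> ker) (K \<inter> ker)"
    by (rule locally_conjugate_Int[OF assms(2,1)])
      (rule conjugation_mem_iff_if_closed[OF conjugation_ker])
  then show "card (H \<inter> ker) = card (K \<inter> ker)"
    by (rule locally_conjugate_card)
qed

definition independent2 :: "int^2^2 \<Rightarrow> int^2^2 \<Rightarrow> bool" where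
  "independent2 Z X \<longleftrightarrow> (\<forall>a b. mat2_mod p (smul a Z + smul b X) = mat2_mod p (mat22 0 0 0 0) \<longrightarrow>
    P dvd a \<and> P dvd b)"

text \<open>The combinations of two independent elements already make up \<open>p\<^sup>2\<close> elements.\<close>

lemma spanned_by_two:
  assumes H: "subgroup H G" and card: "card (H \<inter> ker) = p\<^sup>2"
    and mem: "I_plus p Z \<in> H" "I_plus p X \<in> H" and ind: "independent2 Z X"
    and A: "I_plus p A \<in> H"
  obtains a b where "mat2_mod p A = mat2_mod p (smul a Z + smul b X)"
proof -
  let ?R = "{0..<P}"
  let ?F = "\<lambda>(a, b). I_plus p (smul a Z + smul b X)"
  have "inj_on ?F (?R \<times> ?R)"
  proof (rule inj_onI, clarify)
    fix a b a' b' assume R: "a \<in> ?R" "b \<in> ?R" "a' \<in> ?R" "b' \<in> ?R"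
      and "I_plus p (smul a Z + smul b X) = I_plus p (smul a' Z + smul b' X)"
    then have "mat2_mod p (smul (a - a') Z + smul (b - b') X) = mat2_mod p (mat22 0 0 0 0)"
      unfolding I_plus_eq_iff by (cases X rule: mat22_cases; cases Z rule: mat22_cases)
        (simp add: mat2_mod_mat22_eq_iff algebra_simps)
    then show "a = a' \<and> b = b'"
      using ind R inj_residues unfolding independent2_def by blast
  qed
  then have "card (?F ` (?R \<times> ?R)) = card (?R \<times> ?R)"
    by (rule card_image)
  then have "card (?F ` (?R \<times> ?R)) = card (H \<inter> ker)"
    by (simp add: card card_cartesian_product power2_eq_square)
  moreover have "?F ` (?R \<times> ?R) \<subseteq> H \<inter> ker"
    using I_plus_combination_mem[OF H mem] by auto
  moreover have "finite (H \<inter> ker)"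
    using finite_ker by blast
  ultimately have "?F ` (?R \<times> ?R) = H \<inter> ker"
    by (intro card_subset_eq)
  then have "I_plus p A \<in> ?F ` (?R \<times> ?R)"
    using A by auto
  then show ?thesis
    using that I_plus_eq_iff by auto
qed

lemma nonzero_entry:
  assumes "mat2_mod p Z \<noteq> mat2_mod p (mat22 0 0 0 0)"
  obtains i j where "\<not> P dvd Z $ i $ j"
  using assms by (auto simp: mat2_mod_eq_iff forall_2)

lemma spanned_by_one:
  assumes H: "subgroup H G" and card: "card (H \<inter> ker) = p"
    and mem: "I_plus p Z \<in> H" and nz: "mat2_mod p Z \<noteq> mat2_mod p (mat22 0 0 0 0)"
    and A: "I_plus p A \<in> H"
  obtains a where "mat2_mod p A = mat2_mod p (smul a Z)"
proof -
  let ?R = "{0..<P}"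
  let ?F = "\<lambda>a. I_plus p (smul a Z)"
  have "inj_on ?F ?R"
  proof (rule inj_onI)
    fix a a' assume R: "a \<in> ?R" "a' \<in> ?R" and eq: "?F a = ?F a'"
    then have "P dvd (a - a') * Z $ i $ j" for i j
      unfolding I_plus_eq_iff mat2_mod_eq_iff by (simp add: left_diff_distrib)
    moreover obtain i j where "\<not> P dvd Z $ i $ j"
      using nonzero_entry[OF nz] by blast
    ultimately show "a = a'"
      using R inj_residues dvd_mult_iff by blast
  qed
  then have "card (?F ` ?R) = card (H \<inter> ker)"
    by (simp add: card_image card)
  moreover have "?F ` ?R \<subseteq> H \<inter> ker"
    using I_plus_smul_mem[OF H mem] by auto
  moreover have "finite (H \<inter> ker)"
    using finite_ker by blast
  ultimately have "?F ` ?R = H \<inter> ker"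
    by (intro card_subset_eq)
  then have "I_plus p A \<in> ?F ` ?R"
    using A by auto
  then show ?thesis
    using that I_plus_eq_iff by auto
qed

lemma independent_ex:
  assumes H: "subgroup H G" and card: "card (H \<inter> ker) = p\<^sup>2"
    and nz: "mat2_mod p Z \<noteq> mat2_mod p (mat22 0 0 0 0)"
  obtains X where "I_plus p X \<in> H" "independent2 Z X"
proof -
  let ?S = "(\<lambda>a. I_plus p (smul a Z)) ` {0..<P}"
  have "card ?S \<le> p"
    using card_image_le[of "{0..<P}" "\<lambda>a. I_plus p (smul a Z)"] by simp
  also have "p < p\<^sup>2"
    using p_ge_3 by (simp add: power2_eq_square)
  finally have "\<not> H \<inter> ker \<subseteq> ?S"
    using card card_mono[of ?S "H \<inter> ker"] by auto
  then obtain X where X: "I_plus p X \<in> H" "I_plus p X \<notin> ?S"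
    unfolding ker_def by auto
  have "P dvd a \<and> P dvd b"
    if "mat2_mod p (smul a Z + smul b X) = mat2_mod p (mat22 0 0 0 0)" for a b
  proof -
    have e: "P dvd a * Z $ i $ j + b * X $ i $ j" for i j
      using that exhaust_2[of i] exhaust_2[of j] by (auto simp: mat2_mod_eq_iff forall_2)
    have "P dvd b"
    proof (rule ccontr)
      assume "\<not> P dvd b"
      then obtain c where c: "P dvd b * c - (- a)"
        using solve_mod by blast
      have "P dvd b * (X $ i $ j - (c mod P) * Z $ i $ j)" for i j
      proof -
        have "b * (X $ i $ j - (c mod P) * Z $ i $ j) = (a * Z $ i $ j + b * X $ i $ j)
            - (b * c - (- a)) * Z $ i $ j + b * (c - c mod P) * Z $ i $ j"
          by (simp add: algebra_simps)
        moreover have "P dvd c - c mod P"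
          by simp
        ultimately show ?thesis
          using e c by (metis dvd_add dvd_diff dvd_mult dvd_mult2)
      qed
      then have "mat2_mod p X = mat2_mod p (smul (c mod P) Z)"
        using \<open>\<not> P dvd b\<close> by (simp add: mat2_mod_eq_iff)
      then have "I_plus p X \<in> ?S"
        using p_ge_3 by (intro image_eqI[of _ _ "c mod P"]) (auto simp: I_plus_eq_iff)
      then show False
        using X by simp
    qed
    then have "P dvd a * Z $ i $ j" for i j
      using e[of i j] by (metis dvd_add_left_iff dvd_mult2)
    moreover obtain i j where "\<not> P dvd Z $ i $ j"
      using nonzero_entry[OF nz] by blast
    ultimately show ?thesis
      using \<open>P dvd b\<close> dvd_mult_iff by blast
  qed
  then show ?thesis
    using that X(1) independent2_def by blast
qed

lemma intertwine_smul:
  assumes "mat2_mod p (g ** Z) = mat2_mod p (Z' ** g)"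
  shows "mat2_mod p (g ** smul a Z) = mat2_mod p (smul a Z' ** g)"
proof -
  have "g ** smul a Z = smul a (g ** Z)" "smul a Z' ** g = smul a (Z' ** g)"
    by (simp_all add: vec_eq_iff matrix_matrix_mult_def sum_distrib_left mult_ac)
  then show ?thesis
    using assms by (simp add: mat2_mod_eq_iff flip: right_diff_distrib)
qed

lemma intertwine_add:
  assumes "mat2_mod p (g ** Z) = mat2_mod p (Z' ** g)" "mat2_mod p (g ** X) = mat2_mod p (X' ** g)"
  shows "mat2_mod p (g ** (Z + X)) = mat2_mod p ((Z' + X') ** g)"
proof -
  have "P dvd (u - u') + (v - v')" if "P dvd u - u'" "P dvd v - v'" for u u' v v'
    using that by (rule dvd_add)
  moreover have "g ** (Z + X) = g ** Z + g ** X" "(Z' + X') ** g = Z' ** g + X' ** g"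
    by (simp_all add: vec_eq_iff matrix_matrix_mult_def sum.distrib algebra_simps)
  ultimately show ?thesis
    using assms unfolding mat2_mod_eq_iff by (simp add: add_diff_add)
qed

lemma scalar_conjugate_two_generators:
  assumes H: "scalar_mod_p H" and K: "scalar_mod_p K" and lc: "locally_conjugate G H K"
    and card: "card (H \<inter> ker) = p\<^sup>2"
    and mem: "I_plus p Z \<in> H" "I_plus p X \<in> H" "independent2 Z X" "I_plus p Z' \<in> K" "I_plus p X' \<in> K"
    and g: "\<not> P dvd det g" "mat2_mod p (g ** Z) = mat2_mod p (Z' ** g)"
      "mat2_mod p (g ** X) = mat2_mod p (X' ** g)"
  shows "conjugate_subgroups G H K"
proof (rule scalar_conjugateI_mod_p[OF H K lc g(1)])
  fix A assume "I_plus p A \<in> H"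
  then obtain a b where A: "mat2_mod p A = mat2_mod p (smul a Z + smul b X)"
    using spanned_by_two[OF scalar_mod_p_subgroup[OF H] card mem(1,2,3)] by blast
  let ?B = "smul a Z' + smul b X'"
  have "mat2_mod p (g ** A) = mat2_mod p (g ** (smul a Z + smul b X))"
    using A by (rule mat2_mod_mult_cong[OF refl])
  also have "\<dots> = mat2_mod p (?B ** g)"
    using g by (intro intertwine_add intertwine_smul)
  finally show "\<exists>B. I_plus p B \<in> K \<and> mat2_mod p (g ** A) = mat2_mod p (B ** g)"
    using I_plus_combination_mem[OF scalar_mod_p_subgroup[OF K] mem(4,5)] by blast
qed

lemma scalar_mod_p_conjugation:
  assumes H: "scalar_mod_p H" and g: "g \<in> carrier G"
  shows "scalar_mod_p (conjugation G g ` H)"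
  unfolding scalar_mod_p_def
proof (intro conjI allI impI)
  show "subgroup (conjugation G g ` H) G"
    by (rule conjugation_image_subgroup[OF scalar_mod_p_subgroup[OF H] g])
  fix a b c d assume "red (mat22 a b c d) \<in> conjugation G g ` H"
  then obtain X where X: "X \<in> H" "red (mat22 a b c d) = conjugation G g X"
    by auto
  obtain t A where t: "\<not> P dvd t" "X = red (mat22 t 0 0 t) \<otimes>\<^bsub>G\<^esub> I_plus p A"
    using scalar_mod_p_factor[OF H X(1)] by metis
  obtain B where "conjugation G g (I_plus p A) = I_plus p B"
    using conjugation_I_plus_ex[OF g] by metis
  then have "red (mat22 a b c d) = red (mat22 t 0 0 t) \<otimes>\<^bsub>G\<^esub> I_plus p B"
    unfolding X(2) t(2) using t(1) g by (simp add: conjugation_mult scalar_central)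
  also obtain a' b' c' d' where "B = mat22 a' b' c' d'"
    using mat22_cases by blast
  finally have "red (mat22 a b c d) = red (mat22 (t * (1 + P * a')) (t * (P * b')) (t * (P * c')) (t * (1 + P * d')))"
    by (simp add: I_plus_eq_red)
  then have e: "P dvd a - t * (1 + P * a')" "P dvd b - t * (P * b')" "P dvd c - t * (P * c')"
      "P dvd d - t * (1 + P * d')"
    unfolding red_eq_iff by (auto dest: sq_dvd_imp_dvd)
  then show "P dvd b" "P dvd c"
    by (metis dvd_diff_left_iff dvd_mult dvd_triv_left)+
  have "a - d = (a - t * (1 + P * a')) - (d - t * (1 + P * d')) + P * (t * (a' - d'))"
    by (simp add: algebra_simps)
  then show "P dvd a - d"
    using e by (metis dvd_add dvd_diff dvd_triv_left)
qed


section \<open>Classification of the groups with scalar reduction\<close>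

lemma mat2_mod_eqI:
  "\<lbrakk>A = B + mat22 a b c d; int n dvd a; int n dvd b; int n dvd c; int n dvd d\<rbrakk> \<Longrightarrow>
    mat2_mod n A = mat2_mod n B"
  by (simp add: mat2_mod_eq_iff forall_2)

lemma not_dvd_4: "\<not> P dvd 4"
  using not_dvd_2 dvd_mult_iff[of 2 2] by simp

lemma nonsquare_ex: "\<exists>n. \<forall>x. \<not> P dvd x * x - n"
proof (rule ccontr)
  assume "\<not> ?thesis"
  then have sq: "\<exists>x. P dvd x * x - n" for n
    by blast
  let ?f = "\<lambda>x. x * x mod P"
  have "{0..<P} \<subseteq> ?f ` {0..<P}"
  proof
    fix n assume n: "n \<in> {0..<P}"
    obtain x where "P dvd x * x - n"
      using sq by blast
    then have "x * x mod P = n mod P"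
      by (simp add: mod_eq_dvd_iff)
    then have "(x mod P) * (x mod P) mod P = n"
      using n by (simp add: mod_mult_eq)
    moreover have "x mod P \<in> {0..<P}"
      using p_ge_3 by simp
    ultimately show "n \<in> ?f ` {0..<P}"
      by (rule image_eqI[OF sym])
  qed
  then have "inj_on ?f {0..<P}"
    by (rule finite_surj_inj[OF finite_atLeastLessThan_int])
  moreover have "?f 1 = ?f (P - 1)"
  proof -
    have "(P - 1) * (P - 1) - 1 * 1 = P * (P - 2)"
      by (simp add: algebra_simps)
    then show ?thesis
      by (metis dvd_triv_left mod_eq_dvd_iff)
  qed
  moreover have "1 \<in> {0..<P}" "P - 1 \<in> {0..<P}" "1 \<noteq> P - 1"
    using p_ge_3 by auto
  ultimately show False
    by (meson inj_onD)
qed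

text \<open>The squares modulo \<open>p\<close> are not invariant under any nontrivial translation, as otherwise
  all residues would be squares.\<close>

lemma squares_not_translation_invariant:
  assumes "\<And>m. \<exists>n. P dvd m * m + d - n * n"
  shows "P dvd d"
proof (rule ccontr)
  assume d: "\<not> P dvd d"
  have *: "\<exists>n. P dvd int k * d - n * n" for k
  proof (induction k)
    case 0
    then show ?case
      by (intro exI[of _ 0]) simp
  next
    case (Suc k)
    then obtain n where n: "P dvd int k * d - n * n"
      by blast
    obtain m where m: "P dvd n * n + d - m * m"
      using assms by blast
    have "int (Suc k) * d - m * m = (int k * d - n * n) + (n * n + d - m * m)"
      by (simp add: algebra_simps)
    then show ?case
      using n m dvd_add by metis
  qed
  obtain s where s: "\<not> P dvd x * x - s" for x
    using nonsquare_ex by blast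
  obtain t where t: "P dvd d * t - s"
    using solve_mod[OF d] by blast
  obtain n where n: "P dvd int (nat (t mod P)) * d - n * n"
    using * by blast
  have "int (nat (t mod P)) = t mod P"
    using p_ge_3 by simp
  then have "n * n - s = (d * t - s) - (int (nat (t mod P)) * d - n * n) - (t - t mod P) * d"
    by (simp add: algebra_simps)
  moreover have "P dvd t - t mod P"
    by simp
  ultimately have "P dvd n * n - s"
    using t n by (metis dvd_diff dvd_mult2)
  then show False
    using s by blast
qed

lemma scalar_conjugate_hyperplane:
  assumes H: "scalar_mod_p H" and K: "scalar_mod_p K" and lc: "locally_conjugate G H K"
    and N: "subgroup N G" "\<And>g x. g \<in> carrier G \<Longrightarrow> x \<in> N \<Longrightarrow> conjugation G g x \<in> N"
    and sub: "H \<inter> ker \<subseteq> N" "K \<inter> ker \<subseteq> N"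
    and card: "card (H \<inter> ker) = p ^ k" "card N = p ^ Suc k"
  shows "conjugate_subgroups G H K"
proof -
  note sH = scalar_mod_p_subgroup[OF H] and sK = scalar_mod_p_subgroup[OF K]
  have "conjugate_subgroups G (H \<inter> ker) (K \<inter> ker)"
    using locally_conjugate_Int_ker(1)[OF subgroup.subset[OF sH] lc] finite_carrier prime_p N
      subgroups_Inter_pair[OF sH subgroup_ker] sub(1) subgroups_Inter_pair[OF sK subgroup_ker] sub(2) card
    by (rule locally_conjugate_hyperplanes)
  then obtain g where g: "g \<in> carrier G" "K \<inter> ker = conjugation G g ` (H \<inter> ker)"
    using conjugate_subgroups_iff by auto
  show ?thesis
  proof (rule scalar_conjugateI[OF H K lc g(1)])
    show "conjugation G g (I_plus p A) \<in> K" if "I_plus p A \<in> H" for A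
    proof -
      have "conjugation G g (I_plus p A) \<in> conjugation G g ` (H \<inter> ker)"
        using that by simp
      then show ?thesis
        unfolding g(2)[symmetric] by simp
    qed
  qed
qed

lemma traceless_companion_form:
  assumes tr: "P dvd Z $ 1 $ 1 + Z $ 2 $ 2" and nz: "mat2_mod p Z \<noteq> mat2_mod p (mat22 0 0 0 0)"
  obtains g z where "\<not> P dvd det g" "mat2_mod p (g ** Z) = mat2_mod p (mat22 0 1 z 0 ** g)"
proof -
  obtain a b c d where Z: "Z = mat22 a b c d"
    using mat22_cases by blast
  have ad: "P dvd a + d"
    using tr Z by simp
  have eq: "mat2_mod p Z = mat2_mod p (mat22 a b c (- a))"
    using ad by (simp add: Z mat2_mod_mat22_eq_iff add.commute)
  \<comment> \<open>The rows of the conjugating matrix are a cyclic vector \<open>(r, s)\<close> and its image.\<close>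
  define g where "g r s = mat22 r s (r * a + s * c) (r * b - s * a)" for r s
  have int: "mat2_mod p (g r s ** Z) = mat2_mod p (mat22 0 1 (a * a + b * c) 0 ** g r s)" for r s
  proof -
    have "g r s ** mat22 a b c (- a) = mat22 0 1 (a * a + b * c) 0 ** g r s"
      by (simp add: g_def algebra_simps)
    then show ?thesis
      using mat2_mod_mult_cong[OF refl eq] by metis
  qed
  consider "\<not> P dvd b" | "\<not> P dvd c" | "P dvd b" "P dvd c" "\<not> P dvd a"
    using nz ad unfolding Z mat2_mod_mat22_eq_iff by (metis diff_zero dvd_add_right_iff)
  then show ?thesis
  proof cases
    case 1
    then show ?thesis
      by (intro that[OF _ int[of 1 0]]) (simp add: g_def)
  next
    case 2
    then show ?thesis
      by (intro that[OF _ int[of 0 1]]) (simp add: g_def)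
  next
    case 3
    have "\<not> P dvd det (g 1 1)"
    proof
      assume "P dvd det (g 1 1)"
      then have "P dvd det (g 1 1) - b + c"
        using 3 by (intro dvd_add dvd_diff)
      moreover have "det (g 1 1) - b + c = - (2 * a)"
        by (simp add: g_def)
      ultimately show False
        using 3 dvd_2_mult_iff by simp
    qed
    then show ?thesis
      using that int by blast
  qed
qed

text \<open>Scaling makes the trace equal to 2, and subtracting a multiple of \<open>Z\<close> clears the upper right
  entry.\<close>

lemma trace_two_normal_form:
  assumes H: "subgroup H G" and Z: "I_plus p (mat22 0 1 z 0) \<in> H"
    and I: "I_plus p (mat22 1 0 0 1) \<notin> H"
    and tr: "I_plus p X \<in> H" "\<not> P dvd X $ 1 $ 1 + X $ 2 $ 2"
  obtains y u where "I_plus p (mat22 (1 + y) 0 u (1 - y)) \<in> H" "\<not> (P dvd y \<and> P dvd u)"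
proof -
  obtain a b c d where X: "X = mat22 a b c d"
    using mat22_cases by blast
  obtain s where s: "P dvd (a + d) * s - 2"
    using tr(2) solve_mod[of "a + d" 2] unfolding X by auto
  let ?y = "s * a - 1" and ?u = "s * c - s * b * z"
  have "I_plus p (smul s X + smul (- s * b) (mat22 0 1 z 0)) \<in> H"
    by (rule I_plus_combination_mem[OF H tr(1) Z])
  moreover have "s * d - (1 - ?y) = (a + d) * s - 2"
    by (simp add: algebra_simps)
  then have "mat2_mod p (smul s X + smul (- s * b) (mat22 0 1 z 0)) =
      mat2_mod p (mat22 (1 + ?y) 0 ?u (1 - ?y))"
    using s unfolding X smul_mat22 mat22_add mat2_mod_mat22_eq_iff by (simp add: algebra_simps)
  ultimately have mem: "I_plus p (mat22 (1 + ?y) 0 ?u (1 - ?y)) \<in> H"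
    by (rule I_plus_mem_cong)
  moreover have "\<not> (P dvd ?y \<and> P dvd ?u)"
  proof
    assume "P dvd ?y \<and> P dvd ?u"
    then have "mat2_mod p (mat22 (1 + ?y) 0 ?u (1 - ?y)) = mat2_mod p (mat22 1 0 0 1)"
      by (auto simp: mat2_mod_mat22_eq_iff dvd_diff_commute)
    then show False
      using I_plus_mem_cong[OF mem] I by blast
  qed
  ultimately show ?thesis
    using that by blast
qed

lemma independent_traceless:
  assumes "\<not> P dvd X $ 1 $ 1 + X $ 2 $ 2"
  shows "independent2 (mat22 0 1 z 0) X"
  unfolding independent2_def
proof (intro allI impI)
  fix \<alpha> \<beta> assume eq: "mat2_mod p (smul \<alpha> (mat22 0 1 z 0) + smul \<beta> X) = mat2_mod p (mat22 0 0 0 0)"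
  obtain a b c d where X: "X = mat22 a b c d"
    using mat22_cases by blast
  have e: "P dvd \<beta> * a" "P dvd \<alpha> + \<beta> * b" "P dvd \<beta> * d"
    using eq unfolding X by (simp_all add: mat2_mod_mat22_eq_iff)
  have "P dvd \<beta> * (a + d)"
    using dvd_add[OF e(1,3)] by (simp only: distrib_left)
  then have "P dvd \<beta>"
    using assms X by simp
  then show "P dvd \<alpha> \<and> P dvd \<beta>"
    using e(2) by (metis dvd_add_left_iff dvd_mult2)
qed

text \<open>Elements of trace 2 are matched with elements of trace 2, and then their determinants agree.\<close>

lemma trace_two_determinants:
  assumes K: "subgroup K G" and card: "card (K \<inter> ker) = p\<^sup>2" and lc: "locally_conjugate G H K"
    and H: "subgroup H G" "I_plus p (mat22 0 1 z 0) \<in> H" "I_plus p (mat22 (1 + y) 0 u (1 - y)) \<in> H"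
    and KZ: "I_plus p (mat22 0 1 z 0) \<in> K" "I_plus p (mat22 (1 + y') 0 u' (1 - y')) \<in> K"
  shows "\<exists>b. P dvd (y * y + a * u + a * a * z) - (y' * y' + b * u' + b * b * z)"
proof -
  let ?X = "mat22 (1 + y) a (u + a * z) (1 - y)"
  have "I_plus p (mat22 (1 + y) 0 u (1 - y) + smul a (mat22 0 1 z 0)) \<in> H"
    using H by (intro I_plus_add_mem I_plus_smul_mem)
  then have "I_plus p ?X \<in> H"
    by simp
  then obtain g B where g: "\<not> P dvd det g" "I_plus p B \<in> K" "mat2_mod p (g ** ?X) = mat2_mod p (B ** g)"
    using I_plus_conj_ex[OF lc] by blast
  have "independent2 (mat22 0 1 z 0) (mat22 (1 + y') 0 u' (1 - y'))"
    using not_dvd_2 by (intro independent_traceless) simp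
  then obtain b c where "mat2_mod p B = mat2_mod p (smul b (mat22 0 1 z 0) + smul c (mat22 (1 + y') 0 u' (1 - y')))"
    using spanned_by_two[OF K card KZ _ g(2)] by blast
  then have B: "mat2_mod p B = mat2_mod p (mat22 (c * (1 + y')) b (b * z + c * u') (c * (1 - y')))"
    by simp
  then have eq: "mat2_mod p (g ** ?X) = mat2_mod p (mat22 (c * (1 + y')) b (b * z + c * u') (c * (1 - y')) ** g)"
    using g(3) mat2_mod_mult_cong[OF B refl] by metis
  note inv = conj_invariants_mod_p[OF g(1) eq]
  have "1 + y + (1 - y) - (c * (1 + y') + c * (1 - y')) = 2 * (1 - c)"
    by (simp add: algebra_simps)
  then have c: "P dvd 1 - c"
    using inv(1) dvd_2_mult_iff by metis
  have "(y * y + a * u + a * a * z) - (y' * y' + b * u' + b * b * z) =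
      - ((1 + y) * (1 - y) - a * (u + a * z) - (c * (1 + y') * (c * (1 - y')) - b * (b * z + c * u')))
      + (1 - c) * ((1 + c) * (1 - y' * y') - b * u')"
    by (simp add: algebra_simps)
  moreover have "P dvd \<dots>"
    by (rule dvd_add; (rule dvd_mult2[OF c])?) (use inv(2) in \<open>simp only: dvd_minus_iff\<close>)
  ultimately have "P dvd (y * y + a * u + a * a * z) - (y' * y' + b * u' + b * b * z)"
    by (simp only:)
  then show ?thesis
    by blast
qed

text \<open>The case of an isotropic \<open>Y\<close>, which needs \<open>Z\<close> to have the eigenvalues \<open>\<plusminus>e\<close> modulo
  \<open>p\<close>. For \<open>\<sigma> = 1\<close> the two traceless matrices are proportional, and an element of the
  centralizer of \<open>Z\<close> rescales one to the other; for \<open>\<sigma> = - 1\<close> their sum intertwines them.\<close>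

lemma scalar_conjugate_isotropic:
  assumes H: "scalar_mod_p H" and K: "scalar_mod_p K" and lc: "locally_conjugate G H K"
    and card: "card (H \<inter> ker) = p\<^sup>2" and units: "\<not> P dvd e" "\<not> P dvd y1" "\<not> P dvd y2"
    and HZ: "I_plus p (mat22 0 1 (e * e) 0) \<in> H" "I_plus p (mat22 (1 + y1) 0 (2 * e * y1) (1 - y1)) \<in> H"
    and KZ: "I_plus p (mat22 0 1 (e * e) 0) \<in> K"
      "I_plus p (mat22 (1 + y2) 0 (\<sigma> * (2 * e * y2)) (1 - y2)) \<in> K"
    and \<sigma>: "\<sigma> = 1 \<or> \<sigma> = - 1"
  shows "conjugate_subgroups G H K"
proof -
  note sH = scalar_mod_p_subgroup[OF H] and sK = scalar_mod_p_subgroup[OF K]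
  let ?Z = "mat22 0 1 (e * e) 0"
  define W1 where "W1 = mat22 (e * (1 + y1)) (- y1) (e * e * y1) (e * (1 - y1))"
  define W2 where "W2 = mat22 (e * (1 + y2)) (- \<sigma> * y2) (\<sigma> * e * e * y2) (e * (1 - y2))"
  have "smul e (mat22 (1 + y1) 0 (2 * e * y1) (1 - y1)) + smul (- y1) ?Z = W1"
    by (simp add: W1_def algebra_simps)
  then have W1: "I_plus p W1 \<in> H"
    using I_plus_combination_mem[OF sH HZ(2,1)] by metis
  have "smul e (mat22 (1 + y2) 0 (\<sigma> * (2 * e * y2)) (1 - y2)) + smul (- \<sigma> * y2) ?Z = W2"
    by (simp add: W2_def algebra_simps)
  then have W2: "I_plus p W2 \<in> K"
    using I_plus_combination_mem[OF sK KZ(2,1)] by metis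
  have "e * (1 + y1) + e * (1 - y1) = 2 * e"
    by (simp add: algebra_simps)
  then have ind: "independent2 ?Z W1"
    using units not_dvd_2 by (intro independent_traceless) (simp add: W1_def)
  define g where "g = (if \<sigma> = 1 then mat22 (e * (y1 + y2)) (y2 - y1) ((y2 - y1) * (e * e)) (e * (y1 + y2))
    else mat22 (e * (y1 + y2)) (y2 - y1) (e * e * (y1 - y2)) (- e * (y1 + y2)))"
  have "det g = \<sigma> * (2 * (2 * (e * e * (y1 * y2))))"
    using \<sigma> by (auto simp: g_def algebra_simps)
  moreover have "\<not> P dvd \<sigma>"
    using \<sigma> not_dvd_1 by auto
  ultimately have "\<not> P dvd det g"
    using units not_dvd_4 by simp
  moreover have "g ** W1 = W2 ** g" "g ** ?Z = smul \<sigma> ?Z ** g"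
    using \<sigma> by (auto simp: g_def W1_def W2_def algebra_simps)
  ultimately show ?thesis
    using scalar_conjugate_two_generators[OF H K lc card HZ(1) W1 ind I_plus_smul_mem[OF sK KZ(1)] W2]
    by metis
qed

text \<open>The nondegenerate case. After completing the square, the part of trace 2 is governed by the
  traceless matrix \<open>Y\<close> orthogonal to \<open>Z\<close>, and local conjugacy fixes the determinant of \<open>Y\<close>.\<close>

lemma scalar_conjugate_nondegenerate:
  assumes H: "scalar_mod_p H" and K: "scalar_mod_p K" and lc: "locally_conjugate G H K"
    and card: "card (H \<inter> ker) = p\<^sup>2" "card (K \<inter> ker) = p\<^sup>2" and z: "\<not> P dvd z"
    and HZ: "I_plus p (mat22 0 1 z 0) \<in> H" "I_plus p (mat22 (1 + y1) 0 u1 (1 - y1)) \<in> H"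
    and KZ: "I_plus p (mat22 0 1 z 0) \<in> K" "I_plus p (mat22 (1 + y2) 0 u2 (1 - y2)) \<in> K"
    and nz: "\<not> (P dvd y1 \<and> P dvd u1)" "\<not> (P dvd y2 \<and> P dvd u2)"
  shows "conjugate_subgroups G H K"
proof -
  note sH = scalar_mod_p_subgroup[OF H] and sK = scalar_mod_p_subgroup[OF K]
  let ?Z = "mat22 0 1 z 0"
  define X where "X y u = mat22 (2 * z * (1 + y)) (- u) (z * u) (2 * z * (1 - y))" for y u
  define \<delta>1 where "\<delta>1 = 4 * z * y1 * y1 - u1 * u1"
  define \<delta>2 where "\<delta>2 = 4 * z * y2 * y2 - u2 * u2"
  have X_mem: "I_plus p (X y u) \<in> S"
    if "subgroup S G" "I_plus p ?Z \<in> S" "I_plus p (mat22 (1 + y) 0 u (1 - y)) \<in> S" for S y u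
  proof -
    have "smul (2 * z) (mat22 (1 + y) 0 u (1 - y)) + smul (- u) ?Z = X y u"
      by (simp add: X_def algebra_simps)
    then show ?thesis
      using I_plus_combination_mem[OF that(1,3,2), of "2 * z" "- u"] by metis
  qed
  have ind: "independent2 ?Z (X y u)" for y u
  proof -
    have "2 * z * (1 + y) + 2 * z * (1 - y) = 2 * (2 * z)"
      by (simp add: algebra_simps)
    then show ?thesis
      using z not_dvd_4 by (intro independent_traceless) (simp add: X_def)
  qed
  have conj: ?thesis
    if "\<not> P dvd det g" "mat2_mod p (g ** X y1 u1) = mat2_mod p (X y2 u2 ** g)"
      "mat2_mod p (g ** ?Z) = mat2_mod p (smul e ?Z ** g)" for g e
    using scalar_conjugate_two_generators[OF H K lc card(1) HZ(1) X_mem[OF sH HZ] ind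
        I_plus_smul_mem[OF sK KZ(1)] X_mem[OF sK KZ] that(1,3,2)] .
  \<comment> \<open>The map \<open>a \<mapsto> 2za + u\<close> completes the square.\<close>
  have \<delta>: "P dvd \<delta>1 - \<delta>2"
  proof (rule squares_not_translation_invariant)
    fix m
    obtain a where a: "P dvd (2 * z) * a - (m - u1)"
      using solve_mod[of "2 * z"] z not_dvd_2 by auto
    obtain b where b: "P dvd (y1 * y1 + a * u1 + a * a * z) - (y2 * y2 + b * u2 + b * b * z)"
      using trace_two_determinants[OF sK card(2) lc sH HZ KZ] by blast
    have "m * m + (\<delta>1 - \<delta>2) - (2 * z * b + u2) * (2 * z * b + u2) =
        4 * z * ((y1 * y1 + a * u1 + a * a * z) - (y2 * y2 + b * u2 + b * b * z))
        - ((2 * z) * a - (m - u1)) * (2 * z * a + u1 + m)"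
      by (simp add: \<delta>1_def \<delta>2_def algebra_simps)
    then show "\<exists>n. P dvd m * m + (\<delta>1 - \<delta>2) - n * n"
      using a b by (metis dvd_diff dvd_mult dvd_mult2)
  qed
  have \<delta>z: "P dvd z * (\<delta>1 - \<delta>2)" "P dvd z * (\<delta>1 - \<delta>2) * z"
    using \<delta> by (auto intro: dvd_mult dvd_mult2)
  \<comment> \<open>The sum \<open>Y\<^sub>1 + Y\<^sub>2\<close> intertwines \<open>Y\<^sub>1\<close> with \<open>Y\<^sub>2\<close>, because their squares are the same scalar.\<close>
  define g1 where "g1 = mat22 (2 * z * (y1 + y2)) (- (u1 + u2)) (z * (u1 + u2)) (- 2 * z * (y1 + y2))"
  have g1: ?thesis if "\<not> P dvd det g1"
  proof (rule conj[OF that, of "- 1"])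
    have "g1 ** X y1 u1 = X y2 u2 ** g1 + mat22 (z * (\<delta>1 - \<delta>2)) 0 0 (z * (\<delta>1 - \<delta>2))"
      by (simp add: g1_def X_def \<delta>1_def \<delta>2_def algebra_simps)
    then show "mat2_mod p (g1 ** X y1 u1) = mat2_mod p (X y2 u2 ** g1)"
      using \<delta>z(1) by (simp add: mat2_mod_eq_iff forall_2)
    show "mat2_mod p (g1 ** ?Z) = mat2_mod p (smul (- 1) ?Z ** g1)"
      by (simp add: g1_def algebra_simps)
  qed
  define g2 where "g2 = mat22 (- z * (u1 - u2)) (2 * z * (y1 - y2)) (- 2 * z * z * (y1 - y2)) (z * (u1 - u2))"
  have g2: ?thesis if "\<not> P dvd det g2"
  proof (rule conj[OF that, of "- 1"])
    have "g2 ** X y1 u1 = X y2 u2 ** g2 + mat22 0 (- (z * (\<delta>1 - \<delta>2))) (- (z * (\<delta>1 - \<delta>2) * z)) 0"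
      by (simp add: g2_def X_def \<delta>1_def \<delta>2_def algebra_simps)
    then show "mat2_mod p (g2 ** X y1 u1) = mat2_mod p (X y2 u2 ** g2)"
      using \<delta>z by (simp add: mat2_mod_eq_iff forall_2)
    show "mat2_mod p (g2 ** ?Z) = mat2_mod p (smul (- 1) ?Z ** g2)"
      by (simp add: g2_def algebra_simps)
  qed
  show ?thesis
  proof (cases "P dvd \<delta>1")
    case False
    have "z * det g1 - det g2 = - (4 * z * z * \<delta>1) + 2 * z * z * (\<delta>1 - \<delta>2)"
      by (simp add: g1_def g2_def \<delta>1_def \<delta>2_def algebra_simps)
    then have eq: "4 * z * z * \<delta>1 = 2 * z * z * (\<delta>1 - \<delta>2) - (z * det g1 - det g2)"
      by simp
    have "\<not> P dvd z * det g1 - det g2"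
    proof
      assume "P dvd z * det g1 - det g2"
      then have "P dvd 4 * z * z * \<delta>1"
        unfolding eq by (rule dvd_diff[OF dvd_mult[OF \<delta>]])
      then show False
        using False z not_dvd_4 by simp
    qed
    then show ?thesis
      using g1 g2 by (meson dvd_diff dvd_mult)
  next
    case True
    have y: "\<not> P dvd y1" "\<not> P dvd y2"
    proof -
      have *: "\<not> P dvd y" if "P dvd 4 * z * y * y - u * u" "\<not> (P dvd y \<and> P dvd u)" for y u
        using that by (metis dvd_diff_right_iff dvd_mult dvd_mult_iff)
      have "\<delta>2 = \<delta>1 - (\<delta>1 - \<delta>2)"
        by simp
      then have "P dvd \<delta>2"
        using True \<delta> dvd_diff by metis
      then show "\<not> P dvd y1" "\<not> P dvd y2"
        using * True nz unfolding \<delta>1_def \<delta>2_def by blast+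
    qed
    obtain e where e: "P dvd (2 * y1) * e - u1"
      using solve_mod[of "2 * y1"] y not_dvd_2 by auto
    have "4 * y1 * y1 * (z - e * e) = \<delta>1 - ((2 * y1) * e - u1) * ((2 * y1) * e + u1)"
      by (simp add: \<delta>1_def algebra_simps)
    then have "P dvd 4 * y1 * y1 * (z - e * e)"
      using True e by (metis dvd_diff dvd_mult2)
    then have ze: "P dvd z - e * e"
      using y dvd_2_mult_iff[of "2 * y1 * y1 * (z - e * e)"] not_dvd_2 by simp
    have "(2 * e * y2 - u2) * (2 * e * y2 + u2) = \<delta>1 - (\<delta>1 - \<delta>2) - 4 * y2 * y2 * (z - e * e)"
      by (simp add: \<delta>2_def algebra_simps)
    then have "P dvd (2 * e * y2 - u2) * (2 * e * y2 + u2)"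
      using True ze \<delta> by (metis dvd_diff dvd_mult)
    then have "\<exists>\<sigma>. (\<sigma> = 1 \<or> \<sigma> = - 1) \<and> P dvd u2 - \<sigma> * (2 * e * y2)"
      by (auto simp: dvd_diff_commute add.commute)
    then obtain \<sigma> where \<sigma>: "\<sigma> = 1 \<or> \<sigma> = - 1" "P dvd u2 - \<sigma> * (2 * e * y2)"
      by blast
    have "P dvd u1 - 2 * e * y1"
      using e by (simp add: dvd_diff_commute mult_ac)
    then have mem: "I_plus p (mat22 0 1 (e * e) 0) \<in> H" "I_plus p (mat22 (1 + y1) 0 (2 * e * y1) (1 - y1)) \<in> H"
      "I_plus p (mat22 0 1 (e * e) 0) \<in> K" "I_plus p (mat22 (1 + y2) 0 (\<sigma> * (2 * e * y2)) (1 - y2)) \<in> K"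
      using ze \<sigma>(2) by - (rule I_plus_mem_cong[OF HZ(1)] I_plus_mem_cong[OF HZ(2)]
          I_plus_mem_cong[OF KZ(1)] I_plus_mem_cong[OF KZ(2)], simp only: mat2_mod_mat22_eq_iff, simp)+
    have "\<not> P dvd e"
      using ze z by (metis diff_add_cancel dvd_add dvd_mult)
    then show ?thesis
      using scalar_conjugate_isotropic[OF H K lc card(1) _ y mem \<sigma>(1)] by blast
  qed
qed

text \<open>Every element of \<open>H\<close> is a scalar, which \<open>K\<close> also contains, times
  \<open>I + p(aE\<^sub>1\<^sub>2 + b diag(1 + y, 1 - y))\<close>.\<close>

lemma swap_mem_if_scalar:
  assumes H: "scalar_mod_p H" and K: "scalar_mod_p K" and lc: "locally_conjugate G H K"
    and card: "card (H \<inter> ker) = p\<^sup>2"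
    and HZ: "I_plus p (mat22 0 1 0 0) \<in> H" "I_plus p (mat22 (1 + y) 0 0 (1 - y)) \<in> H"
    and KZ: "I_plus p (mat22 (1 - y) 0 0 (1 + y)) \<in> K"
  shows "X \<in> H \<Longrightarrow> \<exists>x c w. X = red (mat22 x (P * c) 0 w)"
    and "red (mat22 x 0 0 w) \<in> H \<Longrightarrow> red (mat22 w 0 0 x) \<in> K"
proof -
  note sH = scalar_mod_p_subgroup[OF H] and sK = scalar_mod_p_subgroup[OF K]
  have ind: "independent2 (mat22 0 1 0 0) (mat22 (1 + y) 0 0 (1 - y))"
    using not_dvd_2 by (intro independent_traceless) simp
  have form: "\<exists>t a b. red (mat22 t 0 0 t) \<in> H \<and> \<not> P dvd t \<and>
      X = red (mat22 (t * (1 + P * (b * (1 + y)))) (P * (t * a)) 0 (t * (1 + P * (b * (1 - y)))))"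
    if "X \<in> H" for X
  proof -
    obtain t A where t: "\<not> P dvd t" "red (mat22 t 0 0 t) \<in> H" "I_plus p A \<in> H"
      "X = red (mat22 t 0 0 t) \<otimes>\<^bsub>G\<^esub> I_plus p A"
      using scalar_mod_p_factor[OF H \<open>X \<in> H\<close>] by blast
    obtain a b where "mat2_mod p A = mat2_mod p (smul a (mat22 0 1 0 0) + smul b (mat22 (1 + y) 0 0 (1 - y)))"
      using spanned_by_two[OF sH card HZ ind t(3)] by blast
    then have "I_plus p A = I_plus p (mat22 (b * (1 + y)) a 0 (b * (1 - y)))"
      by (simp add: I_plus_eq_iff)
    then have "X = red (mat22 (t * (1 + P * (b * (1 + y)))) (P * (t * a)) 0 (t * (1 + P * (b * (1 - y)))))"
      unfolding t(4) by (simp add: I_plus_eq_red mult_ac)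
    then show ?thesis
      using t(1,2) by blast
  qed
  show "X \<in> H \<Longrightarrow> \<exists>x c w. X = red (mat22 x (P * c) 0 w)"
    using form by blast
  assume "red (mat22 x 0 0 w) \<in> H"
  then obtain t a b where t: "red (mat22 t 0 0 t) \<in> H" "\<not> P dvd t"
    "red (mat22 x 0 0 w) = red (mat22 (t * (1 + P * (b * (1 + y)))) (P * (t * a)) 0 (t * (1 + P * (b * (1 - y)))))"
    using form by blast
  have "red (mat22 t 0 0 t) \<in> K"
    using locally_conjugateE[OF lc t(1)] scalar_central[OF t(2)] by metis
  then have "red (mat22 t 0 0 t) \<otimes>\<^bsub>G\<^esub> I_plus p (smul b (mat22 (1 - y) 0 0 (1 + y))) \<in> K"
    using I_plus_smul_mem[OF sK KZ] subgroup.m_closed[OF sK] by blast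
  moreover have "red (mat22 t 0 0 t) \<otimes>\<^bsub>G\<^esub> I_plus p (smul b (mat22 (1 - y) 0 0 (1 + y))) = red (mat22 w 0 0 x)"
    using t(3) by (simp add: I_plus_eq_red red_eq_iff dvd_diff_commute)
  ultimately show "red (mat22 w 0 0 x) \<in> K"
    by simp
qed

text \<open>For \<open>Z = E\<^sub>1\<^sub>2\<close> the determinant is an affine function on \<open>Y + \<langle>Z\<rangle>\<close>. If it is not constant, all
  planes of this kind are conjugate. If it is constant, the plane is
  \<open>\<langle>E\<^sub>1\<^sub>2, diag(1 + y, 1 - y)\<rangle>\<close> and \<open>y\<close> is determined only up to the sign.\<close>

lemma scalar_resolved_nilpotent:
  assumes H: "scalar_mod_p H" and K: "scalar_mod_p K" and lc: "locally_conjugate G H K"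
    and card: "card (H \<inter> ker) = p\<^sup>2" "card (K \<inter> ker) = p\<^sup>2"
    and HZ: "I_plus p (mat22 0 1 0 0) \<in> H" "I_plus p (mat22 (1 + y1) 0 u1 (1 - y1)) \<in> H"
    and KZ: "I_plus p (mat22 0 1 0 0) \<in> K" "I_plus p (mat22 (1 + y2) 0 u2 (1 - y2)) \<in> K"
  shows "resolved H K"
proof -
  note sH = scalar_mod_p_subgroup[OF H] and sK = scalar_mod_p_subgroup[OF K]
  have lc': "locally_conjugate G K H"
    by (rule locally_conjugate_sym[OF subgroup.subset[OF sH] lc])
  have ind: "independent2 (mat22 0 1 0 0) (mat22 (1 + y1) 0 u1 (1 - y1))"
    using not_dvd_2 by (intro independent_traceless) simp
  have vals: "\<exists>b. P dvd (y1 * y1 + a * u1) - (y2 * y2 + b * u2)" for a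
    using trace_two_determinants[OF sK card(2) lc sH HZ KZ] by simp
  have vals': "\<exists>b. P dvd (y2 * y2 + a * u2) - (y1 * y1 + b * u1)" for a
    using trace_two_determinants[OF sH card(1) lc' sK KZ HZ] by simp
  have const: "P dvd u" if vals: "\<And>a. \<exists>b. P dvd (y * y + a * u) - (y' * y' + b * u')" and u': "P dvd u'"
    for y y' u u'
  proof (rule ccontr)
    assume "\<not> P dvd u"
    then obtain a where a: "P dvd u * a - (y' * y' + 1 - y * y)"
      using solve_mod by blast
    obtain b where b: "P dvd (y * y + a * u) - (y' * y' + b * u')"
      using vals by blast
    have "1 = ((y * y + a * u) - (y' * y' + b * u')) - (u * a - (y' * y' + 1 - y * y)) + b * u'"
      by (simp add: algebra_simps)
    then have "P dvd 1"
      using a b u' by (metis dvd_add dvd_diff dvd_mult)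
    then show False
      using not_dvd_1 by blast
  qed
  show ?thesis
  proof (cases "P dvd u1")
    case False
    have u2: "\<not> P dvd u2"
      using const[OF vals] False by blast
    define b where "b = y2 - y1"
    obtain a where a: "P dvd u2 * a - (- b * (y1 + y2))"
      using solve_mod[OF u2] by blast
    let ?g = "mat22 u1 b 0 u2" and ?X2 = "mat22 (1 + y2) 0 u2 (1 - y2) + smul a (mat22 0 1 0 0)"
    have "?g ** mat22 (1 + y1) 0 u1 (1 - y1) = ?X2 ** ?g + mat22 0 (- (u2 * a - (- b * (y1 + y2)))) 0 0"
      by (simp add: b_def algebra_simps)
    then have 1: "mat2_mod p (?g ** mat22 (1 + y1) 0 u1 (1 - y1)) = mat2_mod p (?X2 ** ?g)"
      by (rule mat2_mod_eqI) (simp_all only: dvd_minus_iff dvd_0_right a)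
    obtain c where c: "P dvd u2 * c - u1"
      using solve_mod[OF u2] by blast
    have 2: "mat2_mod p (?g ** mat22 0 1 0 0) = mat2_mod p (smul c (mat22 0 1 0 0) ** ?g)"
      using c by (simp add: mat2_mod_mat22_eq_iff dvd_diff_commute mult.commute)
    have "conjugate_subgroups G H K"
      using scalar_conjugate_two_generators[OF H K lc card(1) HZ ind I_plus_smul_mem[OF sK KZ(1)]
          I_plus_add_mem[OF sK KZ(2) I_plus_smul_mem[OF sK KZ(1)]] _ 2 1] False u2 by simp
    then show ?thesis
      by (simp add: resolved_def)
  next
    case True
    have u2: "P dvd u2"
      using const[OF vals' True] .
    obtain b where b: "P dvd (y1 * y1 + 0 * u1) - (y2 * y2 + b * u2)"
      using vals by blast
    have "(y1 - y2) * (y1 + y2) = ((y1 * y1 + 0 * u1) - (y2 * y2 + b * u2)) + b * u2"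
      by (simp add: algebra_simps)
    then have "P dvd (y1 - y2) * (y1 + y2)"
      using b u2 by (metis dvd_add dvd_mult)
    then consider "P dvd y1 - y2" | "P dvd y1 + y2"
      by auto
    then show ?thesis
    proof cases
      case 1
      have "P dvd u1 - u2"
        using True u2 by (rule dvd_diff)
      then have "I_plus p (mat22 (1 + y1) 0 u1 (1 - y1)) \<in> K"
        using 1 by (intro I_plus_mem_cong[OF KZ(2)]) (simp add: mat2_mod_mat22_eq_iff dvd_diff_commute)
      then have "conjugate_subgroups G H K"
        using scalar_conjugate_two_generators[OF H K lc card(1) HZ ind KZ(1), of _ "mat22 1 0 0 1"]
          not_dvd_1 by simp
      then show ?thesis
        by (simp add: resolved_def)
    next
      case 2
      have "I_plus p (mat22 (1 + y1) 0 0 (1 - y1)) \<in> H"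
        using True by (intro I_plus_mem_cong[OF HZ(2)]) (simp add: mat2_mod_mat22_eq_iff)
      moreover have "P dvd 1 + y2 - (1 - y1)" "P dvd 1 - y2 - (1 + y1)"
        using 2 dvd_minus_iff[of P "y1 + y2"] by (simp_all add: algebra_simps)
      then have K2: "I_plus p (mat22 (1 - y1) 0 0 (1 + y1)) \<in> K"
        using u2 by (intro I_plus_mem_cong[OF KZ(2)]) (simp add: mat2_mod_mat22_eq_iff)
      moreover have "I_plus p (mat22 (1 + - y1) 0 0 (1 - - y1)) \<in> K"
        using K2 by simp
      moreover have "I_plus p (mat22 (1 - - y1) 0 0 (1 + - y1)) \<in> H"
        using calculation(1) by simp
      ultimately have "swapped_pair H K"
        using swap_mem_if_scalar[OF H K lc card(1) HZ(1), of y1] swap_mem_if_scalar[OF K H lc' card(2) KZ(1), of "- y1"]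
        by (intro swapped_pairI sH sK HZ(1) KZ(1)) blast+
      then show ?thesis
        by (simp add: resolved_def)
    qed
  qed
qed

lemma scalar_resolved_common_traceless:
  assumes H: "scalar_mod_p H" and K: "scalar_mod_p K" and lc: "locally_conjugate G H K"
    and card: "card (H \<inter> ker) = p\<^sup>2" "card (K \<inter> ker) = p\<^sup>2"
    and Z: "I_plus p (mat22 0 1 z 0) \<in> H" "I_plus p (mat22 0 1 z 0) \<in> K"
    and I: "I_plus p (mat22 1 0 0 1) \<notin> H" "I_plus p (mat22 1 0 0 1) \<notin> K"
    and tr: "I_plus p X \<in> H" "\<not> P dvd X $ 1 $ 1 + X $ 2 $ 2"
      "I_plus p Y \<in> K" "\<not> P dvd Y $ 1 $ 1 + Y $ 2 $ 2"
  shows "resolved H K"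
proof -
  note sH = scalar_mod_p_subgroup[OF H] and sK = scalar_mod_p_subgroup[OF K]
  obtain y1 u1 where 1: "I_plus p (mat22 (1 + y1) 0 u1 (1 - y1)) \<in> H" "\<not> (P dvd y1 \<and> P dvd u1)"
    using trace_two_normal_form[OF sH Z(1) I(1) tr(1,2)] by blast
  obtain y2 u2 where 2: "I_plus p (mat22 (1 + y2) 0 u2 (1 - y2)) \<in> K" "\<not> (P dvd y2 \<and> P dvd u2)"
    using trace_two_normal_form[OF sK Z(2) I(2) tr(3,4)] by blast
  show ?thesis
  proof (cases "P dvd z")
    case True
    then have "I_plus p (mat22 0 1 0 0) \<in> H" "I_plus p (mat22 0 1 0 0) \<in> K"
      using I_plus_mem_cong[OF Z(1), of "mat22 0 1 0 0"] I_plus_mem_cong[OF Z(2), of "mat22 0 1 0 0"]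
      by (simp_all add: mat2_mod_mat22_eq_iff)
    then show ?thesis
      using scalar_resolved_nilpotent[OF H K lc card _ 1(1) _ 2(1)] by blast
  next
    case False
    then show ?thesis
      using scalar_conjugate_nondegenerate[OF H K lc card False Z(1) 1(1) Z(2) 2(1) 1(2) 2(2)]
      by (simp add: resolved_def)
  qed
qed

lemma I_plus_scalar: "I_plus p (mat22 1 0 0 1) = red (mat22 (1 + P) 0 0 (1 + P))" "\<not> P dvd 1 + P"
  using not_dvd_1 by (simp_all add: I_plus_eq_red)

text \<open>Planes that contain the identity are determined by one further element, planes of trace zero
  are hyperplanes of the space of trace zero, and all others contain, besides elements of nonzero
  trace, an element of trace zero, which may be assumed to be the same for both groups.\<close>

lemma scalar_resolved_plane:
  assumes H: "scalar_mod_p H" and K: "scalar_mod_p K" and lc: "locally_conjugate G H K"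
    and card: "card (H \<inter> ker) = p\<^sup>2"
  shows "resolved H K"
proof -
  note sH = scalar_mod_p_subgroup[OF H] and sK = scalar_mod_p_subgroup[OF K]
  have lc': "locally_conjugate G K H"
    by (rule locally_conjugate_sym[OF subgroup.subset[OF sH] lc])
  have cardK: "card (K \<inter> ker) = p\<^sup>2"
    using card locally_conjugate_Int_ker(2)[OF subgroup.subset[OF sH] lc] by simp
  have I_iff: "I_plus p (mat22 1 0 0 1) \<in> H \<longleftrightarrow> I_plus p (mat22 1 0 0 1) \<in> K"
    using locally_conjugateE[OF lc] locally_conjugateE[OF lc'] scalar_central[OF I_plus_scalar(2)]
    unfolding I_plus_scalar(1) by metis
  have tr: "\<exists>Y. I_plus p Y \<in> S' \<and> \<not> P dvd Y $ 1 $ 1 + Y $ 2 $ 2"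
    if lc: "locally_conjugate G S S'" and X: "I_plus p X \<in> S" "\<not> P dvd X $ 1 $ 1 + X $ 2 $ 2" for S S' X
    using I_plus_conj_ex[OF lc X(1)] X(2) trace_conj_mod_p by metis
  consider (scalars) "I_plus p (mat22 1 0 0 1) \<in> H"
    | (traceless) "\<And>X. I_plus p X \<in> H \<Longrightarrow> P dvd X $ 1 $ 1 + X $ 2 $ 2"
    | (mixed) X where "I_plus p (mat22 1 0 0 1) \<notin> H" "I_plus p X \<in> H" "\<not> P dvd X $ 1 $ 1 + X $ 2 $ 2"
    by blast
  then show ?thesis
  proof cases
    case scalars
    have "mat2_mod p (mat22 1 0 0 1) \<noteq> mat2_mod p (mat22 0 0 0 0)"
      using not_dvd_1 by (simp add: mat2_mod_mat22_eq_iff)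
    then obtain X where X: "I_plus p X \<in> H" "independent2 (mat22 1 0 0 1) X"
      using independent_ex[OF sH card] by blast
    obtain g Y where g: "\<not> P dvd det g" "I_plus p Y \<in> K" "mat2_mod p (g ** X) = mat2_mod p (Y ** g)"
      using I_plus_conj_ex[OF lc X(1)] by blast
    have "mat2_mod p (g ** mat22 1 0 0 1) = mat2_mod p (mat22 1 0 0 1 ** g)"
      by (simp flip: mat_1_eq_mat22)
    then have "conjugate_subgroups G H K"
      using scalar_conjugate_two_generators[OF H K lc card scalars X _ g(2) g(1) _ g(3)] scalars I_iff
      by blast
    then show ?thesis
      by (simp add: resolved_def)
  next
    case traceless
    then have "P dvd X $ 1 $ 1 + X $ 2 $ 2" if "I_plus p X \<in> K" for X
      using tr[OF lc' that] by blast
    then have "conjugate_subgroups G H K"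
      using traceless card card_ker0
      by (intro scalar_conjugate_hyperplane[OF H K lc subgroup_ker0 conjugation_ker0, of 2])
        (auto simp: ker_def I_plus_mem_ker0_iff eval_nat_numeral)
    then show ?thesis
      by (simp add: resolved_def)
  next
    case (mixed X)
    have "mat2_mod p X \<noteq> mat2_mod p (mat22 0 0 0 0)"
      using mixed(3) by (auto simp: mat2_mod_eq_iff forall_2)
    then obtain Y where Y: "I_plus p Y \<in> H" "independent2 X Y"
      using independent_ex[OF sH card] by blast
    define Z where "Z = smul (Y $ 1 $ 1 + Y $ 2 $ 2) X + smul (- (X $ 1 $ 1 + X $ 2 $ 2)) Y"
    have Z: "I_plus p Z \<in> H"
      unfolding Z_def by (rule I_plus_combination_mem[OF sH mixed(2) Y(1)])
    have "mat2_mod p Z \<noteq> mat2_mod p (mat22 0 0 0 0)"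
      using Y(2) mixed(3) unfolding independent2_def Z_def by (metis dvd_minus_iff)
    moreover have "Z $ 1 $ 1 + Z $ 2 $ 2 = 0"
      by (simp add: Z_def algebra_simps)
    ultimately obtain g z where g: "\<not> P dvd det g" "mat2_mod p (g ** Z) = mat2_mod p (mat22 0 1 z 0 ** g)"
      using traceless_companion_form by (metis dvd_0_right)
    \<comment> \<open>Conjugate first \<open>H\<close> and then \<open>K\<close> so that both contain the companion form of \<open>Z\<close>.\<close>
    define H' where "H' = conjugation G (red g) ` H"
    have gc: "red g \<in> carrier G"
      using g(1) by simp
    have H': "scalar_mod_p H'"
      unfolding H'_def by (rule scalar_mod_p_conjugation[OF H gc])
    have ZH': "I_plus p (mat22 0 1 z 0) \<in> H'"
      using conjugation_I_plus[OF g] Z unfolding H'_def by force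
    have HH': "conjugate_subgroups G H H'"
      unfolding H'_def by (rule conjugate_subgroupsI[OF gc])
    have lcH: "locally_conjugate G H H'"
      by (rule conjugate_imp_locally_conjugate[OF subgroup.subset[OF sH] HH'])
    note sH' = scalar_mod_p_subgroup[OF H']
    have lcH': "locally_conjugate G H' K"
      using lcH lc locally_conjugate_sym locally_conjugate_trans subgroup.subset[OF sH] subgroup.subset[OF sH']
      by meson
    obtain h where h: "h \<in> carrier G" "conjugation G h (I_plus p (mat22 0 1 z 0)) \<in> K"
      using locally_conjugateE[OF lcH' ZH'] by blast
    define K' where "K' = conjugation G (inv\<^bsub>G\<^esub> h) ` K"
    have K': "scalar_mod_p K'"
      unfolding K'_def using h by (intro scalar_mod_p_conjugation[OF K]) simp
    note sK' = scalar_mod_p_subgroup[OF K']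
    have ZK': "I_plus p (mat22 0 1 z 0) \<in> K'"
      unfolding K'_def using h by (intro image_eqI[OF _ h(2)]) simp
    have KK': "conjugate_subgroups G K K'"
      unfolding K'_def using h by (intro conjugate_subgroupsI) simp
    have lcK: "locally_conjugate G K K'"
      by (rule conjugate_imp_locally_conjugate[OF subgroup.subset[OF sK] KK'])
    have lc'': "locally_conjugate G H' K'"
      by (rule locally_conjugate_trans[OF subgroup.subset[OF sH'] lcH' lcK])
    have cards: "card (H' \<inter> ker) = p\<^sup>2" "card (K' \<inter> ker) = p\<^sup>2"
      using card cardK locally_conjugate_Int_ker(2)[OF subgroup.subset[OF sH] lcH]
        locally_conjugate_Int_ker(2)[OF subgroup.subset[OF sK] lcK] by simp_all
    have I_conj: "I_plus p (mat22 1 0 0 1) \<in> S" if "locally_conjugate G S S'" "subgroup S G"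
        "I_plus p (mat22 1 0 0 1) \<in> S'" for S S'
      using that locally_conjugateE[OF locally_conjugate_sym[OF subgroup.subset[OF that(2)] that(1)]]
        scalar_central[OF I_plus_scalar(2)] unfolding I_plus_scalar(1) by metis
    have I': "I_plus p (mat22 1 0 0 1) \<notin> H'" "I_plus p (mat22 1 0 0 1) \<notin> K'"
      using mixed(1) I_iff I_conj[OF lcH sH] I_conj[OF lcK sK] by blast+
    obtain X1 where X1: "I_plus p X1 \<in> H'" "\<not> P dvd X1 $ 1 $ 1 + X1 $ 2 $ 2"
      using tr[OF lcH mixed(2,3)] by blast
    obtain X2 where X2: "I_plus p X2 \<in> K'" "\<not> P dvd X2 $ 1 $ 1 + X2 $ 2 $ 2"
      using tr[OF lc'' X1] by blast
    have "resolved H' K'"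
      by (rule scalar_resolved_common_traceless[OF H' K' lc'' cards ZH' ZK' I' X1 X2])
    then show ?thesis
      by (rule resolved_conjugate[OF sH sK HH' KK'])
  qed
qed

text \<open>The cases are the dimensions of the space of all \<open>A\<close> with \<open>I + pA\<close> in the group.\<close>

lemma scalar_resolved:
  assumes H: "scalar_mod_p H" and K: "scalar_mod_p K" and lc: "locally_conjugate G H K"
  shows "resolved H K"
proof -
  note sH = scalar_mod_p_subgroup[OF H] and sK = scalar_mod_p_subgroup[OF K]
  obtain k where k: "k \<le> 4" "card (H \<inter> ker) = p ^ k"
    using card_Int_ker[OF sH] by blast
  have cardK: "card (K \<inter> ker) = p ^ k"
    using k locally_conjugate_Int_ker(2)[OF subgroup.subset[OF sH] lc] by simp
  have triv: "conjugate_subgroups G H K" if "H \<inter> ker \<subseteq> K"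
    using that by (intro scalar_conjugateI[OF H K lc one_closed]) auto
  consider "k = 0" | "k = 1" | "k = 2" | "k = 3" | "k = 4"
    using k(1) by linarith
  then show ?thesis
  proof cases
    case 1
    then obtain x where "H \<inter> ker = {x}"
      using k(2) by (auto simp: card_1_singleton_iff)
    then have "H \<inter> ker \<subseteq> K"
      using subgroup.one_closed[OF sH] subgroup.one_closed[OF subgroup_ker] subgroup.one_closed[OF sK] by auto
    then show ?thesis
      using triv by (simp add: resolved_def)
  next
    case 2
    have "\<not> H \<inter> ker \<subseteq> {\<one>\<^bsub>G\<^esub>}"
      using k(2) 2 p_ge_3 card_mono[of "{\<one>\<^bsub>G\<^esub>}" "H \<inter> ker"] by auto
    then obtain Z where Z: "I_plus p Z \<in> H" "I_plus p Z \<noteq> I_plus p (mat22 0 0 0 0)"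
      unfolding ker_def by auto
    have nz: "mat2_mod p Z \<noteq> mat2_mod p (mat22 0 0 0 0)"
      using Z(2) unfolding I_plus_eq_iff .
    have cardp: "card (H \<inter> ker) = p"
      using k(2) 2 by simp
    obtain g Y where g: "\<not> P dvd det g" "I_plus p Y \<in> K" "mat2_mod p (g ** Z) = mat2_mod p (Y ** g)"
      using I_plus_conj_ex[OF lc Z(1)] by blast
    have "conjugate_subgroups G H K"
    proof (rule scalar_conjugateI_mod_p[OF H K lc g(1)])
      fix A assume "I_plus p A \<in> H"
      then obtain a where "mat2_mod p A = mat2_mod p (smul a Z)"
        using spanned_by_one[OF sH cardp Z(1) nz] by blast
      then have "mat2_mod p (g ** A) = mat2_mod p (smul a Y ** g)"
        using intertwine_smul[OF g(3)] mat2_mod_mult_cong[OF refl] by metis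
      then show "\<exists>B. I_plus p B \<in> K \<and> mat2_mod p (g ** A) = mat2_mod p (B ** g)"
        using I_plus_smul_mem[OF sK g(2)] by blast
    qed
    then show ?thesis
      by (simp add: resolved_def)
  next
    case 3
    then show ?thesis
      using scalar_resolved_plane[OF H K lc] k(2) by simp
  next
    case 4
    then have "conjugate_subgroups G H K"
      using k(2) card_ker
      by (intro scalar_conjugate_hyperplane[OF H K lc subgroup_ker conjugation_ker, of 3])
        (auto simp: eval_nat_numeral)
    then show ?thesis
      by (simp add: resolved_def)
  next
    case 5
    then have "K \<inter> ker = ker"
      using cardK card_ker finite_ker by (intro card_subset_eq) auto
    then show ?thesis
      using triv by (auto simp: resolved_def)
  qed
qed


section \<open>Groups with an element that is regular modulo \<open>p\<close>\<close>

definition diagonal_mod_p :: "(int^2^2) set \<Rightarrow> bool" where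
  "diagonal_mod_p H \<longleftrightarrow> subgroup H G \<and> (\<forall>a b c d. red (mat22 a b c d) \<in> H \<longrightarrow> P dvd b \<and> P dvd c)"

text \<open>A diagonal matrix whose entries differ modulo \<open>p\<close> is regular: it commutes modulo \<open>p\<close> with
  diagonal matrices only.\<close>

definition regular_split :: "(int^2^2) set \<Rightarrow> bool" where
  "regular_split H \<longleftrightarrow> diagonal_mod_p H \<and> (\<exists>x w. red (mat22 x 0 0 w) \<in> H \<and> \<not> P dvd x - w)"

lemma diagonal_mod_p_subgroup: "diagonal_mod_p H \<Longrightarrow> subgroup H G"
  by (simp add: diagonal_mod_p_def)

lemma regular_split_subgroup: "regular_split H \<Longrightarrow> subgroup H G"
  by (simp add: regular_split_def diagonal_mod_p_def)

lemma red_mem_unit: "subgroup H G \<Longrightarrow> red A \<in> H \<Longrightarrow> \<not> P dvd det A"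
  using subgroup.mem_carrier by fastforce

lemma mem_red_mat22:
  assumes "subgroup H G" "X \<in> H"
  obtains a b c d where "X = red (mat22 a b c d)"
  using assms subgroup.mem_carrier red_carrier mat22_cases by metis

lemma mult_mem_cancel_left:
  assumes H: "subgroup H G" and ab: "a \<in> H" "b \<in> carrier G"
  shows "a \<otimes>\<^bsub>G\<^esub> b \<in> H \<longleftrightarrow> b \<in> H"
proof
  assume "a \<otimes>\<^bsub>G\<^esub> b \<in> H"
  then have "inv\<^bsub>G\<^esub> a \<otimes>\<^bsub>G\<^esub> (a \<otimes>\<^bsub>G\<^esub> b) \<in> H"
    using subgroup.m_closed[OF H subgroup.m_inv_closed[OF H ab(1)]] by blast
  moreover have "inv\<^bsub>G\<^esub> a \<otimes>\<^bsub>G\<^esub> (a \<otimes>\<^bsub>G\<^esub> b) = b"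
    using ab subgroup.mem_carrier[OF H ab(1)] by (simp flip: m_assoc)
  ultimately show "b \<in> H"
    by simp
qed (use assms in \<open>auto intro: subgroup.m_closed\<close>)

text \<open>Hensel's lemma for a matrix with different eigenvalues modulo \<open>p\<close>: it is diagonalized by a
  matrix congruent to the identity.\<close>

lemma regular_split_ex:
  assumes H: "diagonal_mod_p H" and X: "red (mat22 a b c d) \<in> H" "\<not> P dvd a - d"
  obtains g where "g \<in> carrier G" "regular_split (conjugation G g ` H)"
proof -
  note sH = diagonal_mod_p_subgroup[OF H]
  obtain b' c' where bc: "b = P * b'" "c = P * c'"
    using H X(1) unfolding diagonal_mod_p_def by blast
  have ad: "\<not> P dvd a * d"
    using red_mem_unit[OF sH X(1)] unfolding bc
    by (metis det_mat22 dvd_diff_left_iff dvd_mult2 dvd_triv_left mult.assoc)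
  obtain \<beta> where \<beta>: "P dvd (a - d) * \<beta> - b'"
    using solve_mod[OF X(2)] by blast
  obtain \<gamma> where \<gamma>: "P dvd (a - d) * \<gamma> - (- c')"
    using solve_mod[OF X(2)] by blast
  let ?g = "mat22 1 (P * \<beta>) (P * \<gamma>) 1"
  have g: "\<not> P dvd det ?g"
    using not_dvd_1 by (metis det_mat22 dvd_diff_left_iff dvd_mult2 dvd_triv_left mult_1)
  have "?g ** mat22 a b c d = mat22 a 0 0 d ** ?g + mat22 (P\<^sup>2 * (\<beta> * c')) (P * (- ((a - d) * \<beta> - b')))
      (P * ((a - d) * \<gamma> - (- c'))) (P\<^sup>2 * (\<gamma> * b'))"
    by (simp add: bc algebra_simps power2_eq_square)
  then have "red (?g ** mat22 a b c d) = red (mat22 a 0 0 d ** ?g)"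
    by (rule mat2_mod_eqI) (use \<beta> \<gamma> in \<open>simp_all only: sq_dvd_iff of_nat_power dvd_minus_iff dvd_triv_left\<close>)
  then have "conjugation G (red ?g) (red (mat22 a b c d)) = red (mat22 a 0 0 d)"
    using g red_mem_unit[OF sH X(1)] ad by (subst conjugation_red_eq_iff) auto
  then have "red (mat22 a 0 0 d) \<in> conjugation G (red ?g) ` H"
    using X(1) by (metis image_eqI)
  moreover have "diagonal_mod_p (conjugation G (red ?g) ` H)"
    unfolding diagonal_mod_p_def
  proof (intro conjI allI impI)
    have gc: "red ?g \<in> carrier G"
      using g red_carrier_iff by blast
    show "subgroup (conjugation G (red ?g) ` H) G"
      by (rule conjugation_image_subgroup[OF sH gc])
    fix a' b' c' d' assume "red (mat22 a' b' c' d') \<in> conjugation G (red ?g) ` H"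
    then obtain Y where Y: "Y \<in> H" "red (mat22 a' b' c' d') = conjugation G (red ?g) Y"
      by blast
    obtain a1 b1 c1 d1 where Y1: "Y = red (mat22 a1 b1 c1 d1)"
      using mem_red_mat22[OF sH Y(1)] .
    have bc1: "P dvd b1" "P dvd c1"
      using H Y(1) unfolding Y1 diagonal_mod_p_def by blast+
    have "red ?g \<otimes>\<^bsub>G\<^esub> Y = red (mat22 a' b' c' d') \<otimes>\<^bsub>G\<^esub> red ?g"
      using Y gc subgroup.mem_carrier[OF sH Y(1)] conjugation_eq_iff by (metis conjugation_closed)
    then have "red (?g ** mat22 a1 b1 c1 d1) = red (mat22 a' b' c' d' ** ?g)"
      unfolding Y1 red_mult .
    then have "P dvd b1 + P * \<beta> * d1 - (a' * (P * \<beta>) + b')" "P dvd P * \<gamma> * a1 + c1 - (c' + d' * (P * \<gamma>))"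
      unfolding mat22_mult red_eq_iff by (auto dest!: sq_dvd_imp_dvd)
    moreover have "b' = b1 - (b1 + P * \<beta> * d1 - (a' * (P * \<beta>) + b')) + P * (\<beta> * d1 - a' * \<beta>)"
      "c' = c1 - (P * \<gamma> * a1 + c1 - (c' + d' * (P * \<gamma>))) + P * (\<gamma> * a1 - d' * \<gamma>)"
      by (simp_all add: algebra_simps)
    ultimately show "P dvd b'" "P dvd c'"
      using bc1 by (metis dvd_add dvd_diff dvd_triv_left)+
  qed
  ultimately have "regular_split (conjugation G (red ?g) ` H)"
    using X(2) unfolding regular_split_def by blast
  then show ?thesis
    using that g red_carrier_iff by blast
qed

lemma anti_diagonal_factor:
  "I_plus p (mat22 0 y z 0) \<otimes>\<^bsub>G\<^esub> red (mat22 x 0 0 w) = red (mat22 x (P * (w * y)) (P * (x * z)) w)"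
  by (simp add: I_plus_eq_red mult_ac)

text \<open>A diagonal element \<open>h\<close> with different eigenvalues \<open>a\<close>, \<open>d\<close> modulo \<open>p\<close> acts on antidiagonal
  matrices by conjugation \<open>T\<close> with eigenvalues \<open>a/d\<close> and \<open>d/a\<close>, so \<open>T - 1\<close> is invertible and its
  inverse is a polynomial in \<open>T\<close>. For \<open>k\<close> in the group, the commutator of \<open>h\<close> and \<open>k\<close> is \<open>I + pB\<close>
  with \<open>B\<close> the image under \<open>T - 1\<close> of the antidiagonal part of \<open>k\<close>, and this part is thereby
  recovered within the group.\<close>

lemma regular_split_decompose:
  assumes H: "regular_split H" and k: "red (mat22 x (P * y) (P * z) w) \<in> H"
  obtains C1 C2 where "I_plus p (mat22 0 C1 C2 0) \<in> H" "red (mat22 x 0 0 w) \<in> H"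
    "P dvd w * C1 - y" "P dvd x * C2 - z"
proof -
  note sH = regular_split_subgroup[OF H]
  obtain a d where h: "red (mat22 a 0 0 d) \<in> H" and ad: "\<not> P dvd a - d"
    using H regular_split_def by blast
  have uh: "\<not> P dvd a" "\<not> P dvd d"
    using red_mem_unit[OF sH h] by auto
  have uk: "\<not> P dvd x" "\<not> P dvd w"
    using red_mem_unit[OF sH k] by auto
  obtain \<beta> where \<beta>: "P dvd (w * d) * \<beta> - (a - d) * y"
    using solve_mod[of "w * d"] uh uk by auto
  obtain \<gamma> where \<gamma>: "P dvd (x * a) * \<gamma> - (d - a) * z"
    using solve_mod[of "x * a"] uh uk by auto
  let ?h = "red (mat22 a 0 0 d)" and ?k = "red (mat22 x (P * y) (P * z) w)"
  have B: "I_plus p (mat22 0 \<beta> \<gamma> 0) \<in> H"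
  proof -
    have "mat22 a 0 0 d ** mat22 x (P * y) (P * z) w =
        mat22 1 (P * \<beta>) (P * \<gamma>) 1 ** (mat22 x (P * y) (P * z) w ** mat22 a 0 0 d) +
        mat22 (P\<^sup>2 * (- (\<beta> * z * a))) (P * (- ((w * d) * \<beta> - (a - d) * y)))
          (P * (- ((x * a) * \<gamma> - (d - a) * z))) (P\<^sup>2 * (- (\<gamma> * y * d)))"
      by (simp add: algebra_simps power2_eq_square)
    then have "red (mat22 a 0 0 d ** mat22 x (P * y) (P * z) w) =
        red (mat22 1 (P * \<beta>) (P * \<gamma>) 1 ** (mat22 x (P * y) (P * z) w ** mat22 a 0 0 d))"
      by (rule mat2_mod_eqI) (use \<beta> \<gamma> in \<open>simp_all only: sq_dvd_iff of_nat_power dvd_minus_iff dvd_triv_left\<close>)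
    then have "?h \<otimes>\<^bsub>G\<^esub> ?k = I_plus p (mat22 0 \<beta> \<gamma> 0) \<otimes>\<^bsub>G\<^esub> (?k \<otimes>\<^bsub>G\<^esub> ?h)"
      by (simp only: I_plus_eq_red red_mult mult_zero_right add_0_right)
    then show ?thesis
      using mult_mem_cancel[OF sH I_plus_carrier] subgroup.m_closed[OF sH] h k by metis
  qed
  obtain \<beta>' where \<beta>': "P dvd d * \<beta>' - a * \<beta>"
    using solve_mod uh by blast
  obtain \<gamma>' where \<gamma>': "P dvd a * \<gamma>' - d * \<gamma>"
    using solve_mod uh by blast
  have B': "I_plus p (mat22 0 \<beta>' \<gamma>' 0) \<in> H"
  proof -
    have "conjugation G ?h (I_plus p (mat22 0 \<beta> \<gamma> 0)) = I_plus p (mat22 0 \<beta>' \<gamma>' 0)"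
      using uh \<beta>' \<gamma>' by (intro conjugation_I_plus)
        (auto simp: mat2_mod_mat22_eq_iff dvd_diff_commute mult.commute)
    then show ?thesis
      unfolding conjugation_def using h B subgroup.m_closed[OF sH] subgroup.m_inv_closed[OF sH] by metis
  qed
  obtain s where s: "P dvd ((a - d) * (a - d)) * s - 1"
    using solve_mod[of "(a - d) * (a - d)"] ad by auto
  define m where "m = a * a + d * d - a * d"
  define C1 where "C1 = s * (a * d) * \<beta>' + (- s * m) * \<beta>"
  define C2 where "C2 = s * (a * d) * \<gamma>' + (- s * m) * \<gamma>"
  have C: "I_plus p (mat22 0 C1 C2 0) \<in> H"
    using I_plus_combination_mem[OF sH B' B, of "s * (a * d)" "- s * m"] by (simp add: C1_def C2_def)
  have "w * C1 - y = w * s * a * (d * \<beta>' - a * \<beta>) + s * (a - d) * ((w * d) * \<beta> - (a - d) * y)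
      + y * (((a - d) * (a - d)) * s - 1)"
    by (simp add: C1_def m_def algebra_simps)
  then have C1: "P dvd w * C1 - y"
    using \<beta> \<beta>' s by (metis dvd_add dvd_mult)
  have "x * C2 - z = x * s * d * (a * \<gamma>' - d * \<gamma>) + s * (d - a) * ((x * a) * \<gamma> - (d - a) * z)
      + z * (((a - d) * (a - d)) * s - 1)"
    by (simp add: C2_def m_def algebra_simps)
  then have C2: "P dvd x * C2 - z"
    using \<gamma> \<gamma>' s by (metis dvd_add dvd_mult)
  have "?k = I_plus p (mat22 0 C1 C2 0) \<otimes>\<^bsub>G\<^esub> red (mat22 x 0 0 w)"
    unfolding anti_diagonal_factor red_eq_iff using C1 C2
    by (simp add: dvd_diff_commute flip: right_diff_distrib)
  then have "red (mat22 x 0 0 w) \<in> H"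
    using mult_mem_cancel_left[OF sH C, of "red (mat22 x 0 0 w)"] k uk by simp
  then show ?thesis
    using that C C1 C2 by blast
qed

lemma regular_split_mem:
  assumes H: "regular_split H" and X: "X \<in> H"
  obtains x w y z where "X = red (mat22 x (P * (w * y)) (P * (x * z)) w)" "red (mat22 x 0 0 w) \<in> H"
    "I_plus p (mat22 0 y z 0) \<in> H" "\<not> P dvd x" "\<not> P dvd w"
proof -
  note sH = regular_split_subgroup[OF H]
  obtain a b c d where X1: "X = red (mat22 a b c d)"
    using mem_red_mat22[OF sH X] .
  then obtain b' c' where bc: "b = P * b'" "c = P * c'"
    using H X unfolding regular_split_def diagonal_mod_p_def by blast
  obtain C1 C2 where C: "I_plus p (mat22 0 C1 C2 0) \<in> H" "red (mat22 a 0 0 d) \<in> H"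
    "P dvd d * C1 - b'" "P dvd a * C2 - c'"
    using regular_split_decompose[OF H] X X1 bc by metis
  have "X = red (mat22 a (P * (d * C1)) (P * (a * C2)) d)"
    unfolding X1 bc red_eq_iff using C(3,4) by (simp add: dvd_diff_commute flip: right_diff_distrib)
  then show ?thesis
    using that C(1,2) red_mem_unit[OF sH C(2)] by simp
qed

lemma regular_split_conjugateI:
  assumes H: "regular_split H" and K: "regular_split K" and lc: "locally_conjugate G H K"
    and D: "\<And>x w. red (mat22 x 0 0 w) \<in> H \<Longrightarrow> red (mat22 x 0 0 w) \<in> K"
    and u: "\<not> P dvd \<alpha>" "\<not> P dvd \<delta>"
    and W: "\<And>y z. I_plus p (mat22 0 y z 0) \<in> H \<Longrightarrow>
      \<exists>y' z'. I_plus p (mat22 0 y' z' 0) \<in> K \<and> P dvd \<alpha> * y - \<delta> * y' \<and> P dvd \<delta> * z - \<alpha> * z'"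
  shows "conjugate_subgroups G H K"
proof (rule conjugate_subgroups_if_subset)
  note sH = regular_split_subgroup[OF H] and sK = regular_split_subgroup[OF K]
  let ?g = "mat22 \<alpha> 0 0 \<delta>"
  show g: "red ?g \<in> carrier G"
    using u by simp
  show "H \<subseteq> carrier G" "finite K"
    using sH sK subgroup.subset finite_carrier finite_subset by blast+
  show "card H = card K"
    by (rule locally_conjugate_card[OF lc])
  fix X assume "X \<in> H"
  then obtain x w y z where X: "X = red (mat22 x (P * (w * y)) (P * (x * z)) w)" "red (mat22 x 0 0 w) \<in> H"
    "I_plus p (mat22 0 y z 0) \<in> H" "\<not> P dvd x" "\<not> P dvd w"
    using regular_split_mem[OF H] by blast
  obtain y' z' where y': "I_plus p (mat22 0 y' z' 0) \<in> K" "P dvd \<alpha> * y - \<delta> * y'" "P dvd \<delta> * z - \<alpha> * z'"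
    using W X(3) by blast
  have "I_plus p (mat22 0 y' z' 0) \<otimes>\<^bsub>G\<^esub> red (mat22 x 0 0 w) \<in> K"
    using subgroup.m_closed[OF sK y'(1) D[OF X(2)]] .
  moreover have "conjugation G (red ?g) X = I_plus p (mat22 0 y' z' 0) \<otimes>\<^bsub>G\<^esub> red (mat22 x 0 0 w)"
    unfolding X(1) anti_diagonal_factor
  proof (subst conjugation_red_eq_iff)
    show "\<not> P dvd det ?g"
      using u by simp
    show "\<not> P dvd det (mat22 x (P * (w * y)) (P * (x * z)) w)" "\<not> P dvd det (mat22 x (P * (w * y')) (P * (x * z')) w)"
      using X(4,5) by (simp_all add: mult.assoc dvd_diff_left_iff)
    have "?g ** mat22 x (P * (w * y)) (P * (x * z)) w = mat22 x (P * (w * y')) (P * (x * z')) w ** ?g +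
        mat22 0 (P * (w * (\<alpha> * y - \<delta> * y'))) (P * (x * (\<delta> * z - \<alpha> * z'))) 0"
      by (simp add: algebra_simps)
    then show "red (?g ** mat22 x (P * (w * y)) (P * (x * z)) w) = red (mat22 x (P * (w * y')) (P * (x * z')) w ** ?g)"
      by (rule mat2_mod_eqI) (use y'(2,3) in \<open>simp_all only: sq_dvd_iff of_nat_power dvd_0_right dvd_mult\<close>)
  qed
  ultimately show "conjugation G (red ?g) X \<in> K"
    by simp
qed

abbreviation "flip \<equiv> conjugation G (red (mat22 0 1 1 0))"

lemma flip_carrier: "red (mat22 0 1 1 0) \<in> carrier G"
  using not_dvd_1 by simp

lemma flip_red:
  assumes "\<not> P dvd det (mat22 a b c d)"
  shows "flip (red (mat22 a b c d)) = red (mat22 d c b a)"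
proof (subst conjugation_red_eq_iff)
  show "\<not> P dvd det (mat22 0 1 1 0)"
    using not_dvd_1 by simp
  show "\<not> P dvd det (mat22 d c b a)"
    using assms by (simp add: mult.commute)
qed (use assms in simp_all)

lemma mem_flip_iff:
  assumes H: "subgroup H G"
  shows "red (mat22 a b c d) \<in> flip ` H \<longleftrightarrow> red (mat22 d c b a) \<in> H"
proof
  assume "red (mat22 a b c d) \<in> flip ` H"
  then obtain X where X: "X \<in> H" "red (mat22 a b c d) = flip X"
    by blast
  obtain a' b' c' d' where X': "X = red (mat22 a' b' c' d')"
    using mem_red_mat22[OF H X(1)] .
  then have "flip X = red (mat22 d' c' b' a')"
    using flip_red red_mem_unit[OF H] X(1) by blast
  then have "red (mat22 d c b a) = X"
    using X(2) X' by (simp add: red_eq_iff)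
  then show "red (mat22 d c b a) \<in> H"
    using X(1) by simp
next
  assume *: "red (mat22 d c b a) \<in> H"
  then have "flip (red (mat22 d c b a)) = red (mat22 a b c d)"
    using flip_red red_mem_unit[OF H] by blast
  then show "red (mat22 a b c d) \<in> flip ` H"
    using * by (metis image_eqI)
qed

lemma subgroup_flip: "subgroup H G \<Longrightarrow> subgroup (flip ` H) G"
  by (rule conjugation_image_subgroup[OF _ flip_carrier])

lemma regular_split_flip:
  assumes "regular_split H"
  shows "regular_split (flip ` H)"
  using assms mem_flip_iff[OF regular_split_subgroup[OF assms]] subgroup_flip
  unfolding regular_split_def diagonal_mod_p_def by (metis dvd_diff_commute)

lemma I_plus_flip_iff:
  "subgroup H G \<Longrightarrow> I_plus p (mat22 a b c d) \<in> flip ` H \<longleftrightarrow> I_plus p (mat22 d c b a) \<in> H"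
  by (simp add: I_plus_eq_red mem_flip_iff)

end

section \<open>The diagonal part is determined up to the swap\<close>

text \<open>A subgroup of pairs of units modulo \<open>m\<close>, with each pair of residues represented by all its pairs
  of integers. Cancellation stands for closure under inverses.\<close>

definition mult_saturated :: "int \<Rightarrow> (int \<times> int) set \<Rightarrow> bool" where
  "mult_saturated m S \<longleftrightarrow>
    (\<forall>x w x' w'. (x, w) \<in> S \<longrightarrow> (x', w') \<in> S \<longrightarrow> (x * x', w * w') \<in> S) \<and>
    (\<forall>x w x' w'. (x, w) \<in> S \<longrightarrow> (x * x', w * w') \<in> S \<longrightarrow> (x', w') \<in> S) \<and>
    (\<forall>x w x' w'. (x, w) \<in> S \<longrightarrow> m dvd x - x' \<longrightarrow> m dvd w - w' \<longrightarrow> (x', w') \<in> S)"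

lemma mult_saturatedD:
  assumes "mult_saturated m S"
  shows "(x, w) \<in> S \<Longrightarrow> (x', w') \<in> S \<Longrightarrow> (x * x', w * w') \<in> S"
    and "(x, w) \<in> S \<Longrightarrow> (x * x', w * w') \<in> S \<Longrightarrow> (x', w') \<in> S"
    and "(x, w) \<in> S \<Longrightarrow> m dvd x - x' \<Longrightarrow> m dvd w - w' \<Longrightarrow> (x', w') \<in> S"
  using assms unfolding mult_saturated_def by blast+

lemma mult_saturated_power:
  assumes "mult_saturated m S" "(x, w) \<in> S" "n > 0"
  shows "(x ^ n, w ^ n) \<in> S"
  using assms(3)
proof (induction n rule: nat_induct_non_zero)
  case 1
  then show ?case
    using assms(2) by simp
next
  case (Suc n)
  then show ?case
    using mult_saturatedD(1)[OF assms(1,2)] by simp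
qed

text \<open>A group is not the union of two proper subgroups.\<close>

lemma subset_of_union:
  assumes E: "mult_saturated m E" and F: "mult_saturated m F"
    and T: "\<And>x w x' w'. (x, w) \<in> T \<Longrightarrow> (x', w') \<in> T \<Longrightarrow> (x * x', w * w') \<in> T"
    and sub: "T \<subseteq> E \<union> F"
  shows "T \<subseteq> E \<or> T \<subseteq> F"
proof (rule ccontr)
  assume "\<not> ?thesis"
  then obtain x w x' w' where a: "(x, w) \<in> T" "(x, w) \<notin> E" and b: "(x', w') \<in> T" "(x', w') \<notin> F"
    by auto
  then have ab: "(x, w) \<in> F" "(x', w') \<in> E"
    using sub by auto
  have "(x * x', w * w') \<in> E \<or> (x * x', w * w') \<in> F"
    using T[OF a(1) b(1)] sub by blast
  then show False
    using a(2) b(2) mult_saturatedD(2)[OF E ab(2), of x w] mult_saturatedD(2)[OF F ab(1), of x' w']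
    by (auto simp: mult.commute)
qed

context odd_prime
begin

text \<open>Let every element of \<open>S\<close> with different entries modulo \<open>p\<close> lie in \<open>E\<close> or \<open>F\<close>, and the
  \<open>p\<close>-th powers of the others in both. Each element is the product of its \<open>p\<close>-th power, a
  Teichmueller representative, and its \<open>(p - 1)\<^sup>2\<close>-th power, which is \<open>1\<close> modulo \<open>p\<close>. The first factors
  lie all in \<open>E\<close> or all in \<open>F\<close>, and multiplying the second ones by a fixed first factor with
  different entries shows the same for them.\<close>

lemma subset_of_union_regular_half:
  assumes S: "mult_saturated (P\<^sup>2) S" and E: "mult_saturated (P\<^sup>2) E" and F: "mult_saturated (P\<^sup>2) F"
    and unit: "\<And>x w. (x, w) \<in> S \<Longrightarrow> \<not> P dvd x \<and> \<not> P dvd w"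
    and reg: "\<And>x w. (x, w) \<in> S \<Longrightarrow> \<not> P dvd x - w \<Longrightarrow> (x, w) \<in> E \<union> F"
    and sc: "\<And>x w. (x, w) \<in> S \<Longrightarrow> P dvd x - w \<Longrightarrow> (x ^ p, w ^ p) \<in> E \<inter> F"
    and ex: "(x0, w0) \<in> S" "\<not> P dvd x0 - w0"
    and T: "\<And>x w. (x, w) \<in> S \<Longrightarrow> (x ^ p, w ^ p) \<in> E"
  shows "S \<subseteq> E \<or> S \<subseteq> F"
proof -
  define m where "m = (p - 1) * (p - 1)"
  have p0: "p > 0" "m > 0"
    using p_ge_3 by (auto simp: m_def)
  have regp: "\<not> P dvd x ^ p - w ^ p" if "\<not> P dvd x - w" for x w
  proof
    assume "P dvd x ^ p - w ^ p"
    moreover have "x - w = (x ^ p - w ^ p) - (x ^ p - x) + (w ^ p - w)"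
      by simp
    ultimately show False
      using that fermat_int[of x] fermat_int[of w] by (metis dvd_add dvd_diff)
  qed
  have m1: "P dvd x ^ m - 1" if "\<not> P dvd x" for x
  proof -
    have "P dvd (x ^ (p - 1)) ^ (p - 1) - 1 ^ (p - 1)"
      using fermat_int_unit[OF that] by (meson cong_iff_dvd_diff cong_pow)
    then show ?thesis
      by (simp add: m_def power_mult)
  qed
  have fac: "P\<^sup>2 dvd x ^ m * x ^ p - x" if "\<not> P dvd x" for x
  proof -
    have "m + p = Suc ((p - 1) * p)"
      unfolding m_def using p_ge_3 by (cases p) auto
    then have "x ^ m * x ^ p = x * (x ^ (p - 1)) ^ p"
      by (metis power_Suc power_add power_mult)
    moreover have "P\<^sup>2 dvd (x ^ (p - 1)) ^ p - 1 ^ p"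
      by (rule power_p_cong[OF fermat_int_unit[OF that]])
    then have "P\<^sup>2 dvd x * ((x ^ (p - 1)) ^ p - 1)"
      by simp
    ultimately show ?thesis
      by (simp add: right_diff_distrib)
  qed
  have collect: "S \<subseteq> X" if X: "mult_saturated (P\<^sup>2) X"
    and "\<And>x w. (x, w) \<in> S \<Longrightarrow> (x ^ p, w ^ p) \<in> X" "\<And>x w. (x, w) \<in> S \<Longrightarrow> (x ^ m, w ^ m) \<in> X" for X
  proof
    fix a assume a: "a \<in> S"
    obtain x w where xw: "a = (x, w)"
      by (cases a)
    have "(x ^ m * x ^ p, w ^ m * w ^ p) \<in> X"
      using a that(2,3) mult_saturatedD(1)[OF X] unfolding xw by blast
    then show "a \<in> X"
      unfolding xw using a xw unit fac by (blast intro: mult_saturatedD(3)[OF X])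
  qed
  \<comment> \<open>Multiplication of a principal unit by a regular Teichmueller element.\<close>
  have prod: "(t ^ p * x ^ m, u ^ p * w ^ m) \<in> E \<union> F"
    if "(t, u) \<in> S" "\<not> P dvd t - u" "(x, w) \<in> S" for t u x w
  proof (rule reg)
    show "(t ^ p * x ^ m, u ^ p * w ^ m) \<in> S"
      using that(1,3) mult_saturated_power[OF S] p0 mult_saturatedD(1)[OF S] by blast
    have "t ^ p * x ^ m - u ^ p * w ^ m = (t ^ p - u ^ p) + t ^ p * (x ^ m - 1) - u ^ p * (w ^ m - 1)"
      by (simp add: algebra_simps)
    then have eq: "t ^ p - u ^ p = (t ^ p * x ^ m - u ^ p * w ^ m) - t ^ p * (x ^ m - 1) + u ^ p * (w ^ m - 1)"
      by simp
    show "\<not> P dvd t ^ p * x ^ m - u ^ p * w ^ m"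
    proof
      assume "P dvd t ^ p * x ^ m - u ^ p * w ^ m"
      then have "P dvd t ^ p - u ^ p"
        unfolding eq using m1[of x] m1[of w] unit[OF that(3)] by (metis dvd_add dvd_diff dvd_mult)
      then show False
        using regp[OF that(2)] by blast
    qed
  qed
  show ?thesis
  proof (cases "\<exists>t u. (t, u) \<in> S \<and> (t ^ p, u ^ p) \<notin> F")
    case True
    then obtain t u where t: "(t, u) \<in> S" "(t ^ p, u ^ p) \<notin> F"
      by blast
    then have tu: "\<not> P dvd t - u"
      using sc by blast
    have "(x ^ m, w ^ m) \<in> E" if xw: "(x, w) \<in> S" for x w
    proof -
      have "(t ^ p * x ^ m, u ^ p * w ^ m) \<notin> F"
      proof
        assume "(t ^ p * x ^ m, u ^ p * w ^ m) \<in> F"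
        then have F1: "((t ^ p * x ^ m) ^ p, (u ^ p * w ^ m) ^ p) \<in> F"
          using mult_saturated_power[OF F] p0 by blast
        have "P\<^sup>2 dvd (t ^ p * x ^ m) ^ p - t ^ p" if "\<not> P dvd x" for t x
        proof -
          have "P dvd (t ^ p * x ^ m) - t"
          proof -
            have "(t ^ p * x ^ m) - t = t ^ p * (x ^ m - 1) + (t ^ p - t)"
              by (simp add: algebra_simps)
            then show ?thesis
              using m1[OF that] fermat_int[of t] by (metis dvd_add dvd_mult)
          qed
          then show ?thesis
            by (rule power_p_cong)
        qed
        then have "(t ^ p, u ^ p) \<in> F"
          using mult_saturatedD(3)[OF F F1] unit[OF xw] by blast
        then show False
          using t by blast
      qed
      then have "(t ^ p * x ^ m, u ^ p * w ^ m) \<in> E"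
        using prod[OF t(1) tu xw] by blast
      then show ?thesis
        using mult_saturatedD(2)[OF E T[OF t(1)]] by blast
    qed
    then show ?thesis
      using collect[OF E T] by blast
  next
    case False
    have "(x ^ m, w ^ m) \<in> E \<union> F" if xw: "(x, w) \<in> S" for x w
      using prod[OF ex xw] mult_saturatedD(2)[OF E T[OF ex(1)]] mult_saturatedD(2)[OF F] False ex(1) by blast
    then have "{(x ^ m, w ^ m) | x w. (x, w) \<in> S} \<subseteq> E \<union> F"
      by auto
    moreover have "(a * a', b * b') \<in> {(x ^ m, w ^ m) | x w. (x, w) \<in> S}"
      if "(a, b) \<in> {(x ^ m, w ^ m) | x w. (x, w) \<in> S}" "(a', b') \<in> {(x ^ m, w ^ m) | x w. (x, w) \<in> S}" for a b a' b'
      using that mult_saturatedD(1)[OF S] by (auto simp flip: power_mult_distrib) blast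
    ultimately have "{(x ^ m, w ^ m) | x w. (x, w) \<in> S} \<subseteq> E \<or> {(x ^ m, w ^ m) | x w. (x, w) \<in> S} \<subseteq> F"
      by (intro subset_of_union[OF E F])
    then consider "{(x ^ m, w ^ m) | x w. (x, w) \<in> S} \<subseteq> E" | "{(x ^ m, w ^ m) | x w. (x, w) \<in> S} \<subseteq> F"
      by blast
    then show ?thesis
    proof cases
      case 1
      then show ?thesis
        using collect[OF E T] by blast
    next
      case 2
      then show ?thesis
        using collect[OF F] False by blast
    qed
  qed
qed

lemma subset_of_union_regular:
  assumes S: "mult_saturated (P\<^sup>2) S" and E: "mult_saturated (P\<^sup>2) E" and F: "mult_saturated (P\<^sup>2) F"
    and unit: "\<And>x w. (x, w) \<in> S \<Longrightarrow> \<not> P dvd x \<and> \<not> P dvd w"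
    and reg: "\<And>x w. (x, w) \<in> S \<Longrightarrow> \<not> P dvd x - w \<Longrightarrow> (x, w) \<in> E \<union> F"
    and sc: "\<And>x w. (x, w) \<in> S \<Longrightarrow> P dvd x - w \<Longrightarrow> (x ^ p, w ^ p) \<in> E \<inter> F"
    and ex: "(x0, w0) \<in> S" "\<not> P dvd x0 - w0"
  shows "S \<subseteq> E \<or> S \<subseteq> F"
proof -
  let ?T = "{(x ^ p, w ^ p) | x w. (x, w) \<in> S}"
  have p0: "p > 0"
    using p_ge_3 by simp
  have "(x ^ p, w ^ p) \<in> E \<union> F" if "(x, w) \<in> S" for x w
    using reg[OF that] sc[OF that] mult_saturated_power[OF E _ p0] mult_saturated_power[OF F _ p0] by blast
  then have "?T \<subseteq> E \<union> F"
    by auto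
  moreover have "(a * a', b * b') \<in> ?T" if "(a, b) \<in> ?T" "(a', b') \<in> ?T" for a b a' b'
    using that mult_saturatedD(1)[OF S] by (auto simp flip: power_mult_distrib) blast
  ultimately have "?T \<subseteq> E \<or> ?T \<subseteq> F"
    by (intro subset_of_union[OF E F])
  then consider "?T \<subseteq> E" | "?T \<subseteq> F"
    by blast
  then show ?thesis
  proof cases
    case 1
    then show ?thesis
      using subset_of_union_regular_half[OF S E F unit reg sc ex] by blast
  next
    case 2
    have "S \<subseteq> F \<or> S \<subseteq> E"
    proof (rule subset_of_union_regular_half[OF S F E unit _ _ ex])
      show "(x, w) \<in> F \<union> E" if "(x, w) \<in> S" "\<not> P dvd x - w" for x w
        using reg[OF that] by blast
      show "(x ^ p, w ^ p) \<in> F \<inter> E" if "(x, w) \<in> S" "P dvd x - w" for x w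
        using sc[OF that] by blast
      show "(x ^ p, w ^ p) \<in> F" if "(x, w) \<in> S" for x w
        using 2 that by blast
    qed
    then show ?thesis
      by blast
  qed
qed

text \<open>All representatives of the residues are included, so that entries can be multiplied and raised to
  powers as integers.\<close>

definition diagonals :: "(int^2^2) set \<Rightarrow> (int \<times> int) set" where
  "diagonals H = {(x, w). red (mat22 x 0 0 w) \<in> H}"

lemma mem_diagonals [simp]: "(x, w) \<in> diagonals H \<longleftrightarrow> red (mat22 x 0 0 w) \<in> H"
  by (simp add: diagonals_def)

lemma mult_saturated_diagonals:
  assumes H: "subgroup H G"
  shows "mult_saturated (P\<^sup>2) (diagonals H)"
proof -
  have mult: "red (mat22 (x * x') 0 0 (w * w')) = red (mat22 x 0 0 w) \<otimes>\<^bsub>G\<^esub> red (mat22 x' 0 0 w')" for x w x' w'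
    by simp
  show ?thesis
    unfolding mult_saturated_def mem_diagonals
  proof (intro conjI allI impI)
    fix x w x' w' assume xw: "red (mat22 x 0 0 w) \<in> H"
    show "red (mat22 (x * x') 0 0 (w * w')) \<in> H" if "red (mat22 x' 0 0 w') \<in> H"
      unfolding mult using subgroup.m_closed[OF H xw that] .
    show "red (mat22 x' 0 0 w') \<in> H" if xw': "red (mat22 (x * x') 0 0 (w * w')) \<in> H"
    proof -
      have "red (mat22 x' 0 0 w') \<in> carrier G"
        using red_mem_unit[OF H xw'] by simp
      then show ?thesis
        using mult_mem_cancel_left[OF H xw] xw' unfolding mult by blast
    qed
    show "red (mat22 x' 0 0 w') \<in> H" if "P\<^sup>2 dvd x - x'" "P\<^sup>2 dvd w - w'"
    proof -
      have "red (mat22 x 0 0 w) = red (mat22 x' 0 0 w')"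
        using that by (simp add: red_eq_iff)
      then show ?thesis
        using xw by simp
    qed
  qed
qed

lemma mult_saturated_swap:
  assumes S: "mult_saturated m S"
  shows "mult_saturated m (prod.swap ` S)"
proof -
  have iff: "(x, w) \<in> prod.swap ` S \<longleftrightarrow> (w, x) \<in> S" for x w
    by force
  show ?thesis
    unfolding mult_saturated_def iff
  proof (intro conjI allI impI)
    fix x w x' w' assume xw: "(w, x) \<in> S"
    show "(w * w', x * x') \<in> S" if "(w', x') \<in> S"
      by (rule mult_saturatedD(1)[OF S xw that])
    show "(w', x') \<in> S" if "(w * w', x * x') \<in> S"
      by (rule mult_saturatedD(2)[OF S xw that])
    show "(w', x') \<in> S" if "m dvd x - x'" "m dvd w - w'"
      by (rule mult_saturatedD(3)[OF S xw that(2,1)])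
  qed
qed

lemma mem_swap_diagonals: "(x, w) \<in> prod.swap ` diagonals H \<longleftrightarrow> red (mat22 w 0 0 x) \<in> H"
  unfolding mem_diagonals[symmetric] by force

text \<open>The antidiagonal entries of an element of \<open>K\<close> change its determinant only by a multiple of \<open>p\<^sup>2\<close>.
  So its diagonal entries have the same sum and the same product as \<open>x\<close> and \<open>w\<close>.\<close>

lemma locally_conjugate_diagonals:
  assumes H: "regular_split H" and K: "regular_split K" and lc: "locally_conjugate G H K"
    and xw: "red (mat22 x 0 0 w) \<in> H"
  obtains x' w' where "red (mat22 x' 0 0 w') \<in> K" "P\<^sup>2 dvd (x + w) - (x' + w')" "P\<^sup>2 dvd (x - x') * (x - w')"
proof -
  note sH = regular_split_subgroup[OF H] and sK = regular_split_subgroup[OF K]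
  obtain g where g: "g \<in> carrier G" "conjugation G g (red (mat22 x 0 0 w)) \<in> K"
    using locally_conjugateE[OF lc xw] by blast
  obtain x' w' y z where K': "conjugation G g (red (mat22 x 0 0 w)) = red (mat22 x' (P * (w' * y)) (P * (x' * z)) w')"
    "red (mat22 x' 0 0 w') \<in> K"
    using regular_split_mem[OF K g(2)] by metis
  have "red (mat22 x' (P * (w' * y)) (P * (x' * z)) w') \<in> carrier G"
    using g(2) K'(1) subgroup.mem_carrier[OF sK] by metis
  note inv = conjugation_conj_invariants[OF g(1) subgroup.mem_carrier[OF sH xw] this K'(1)]
  have "(x - x') * (x - w') = x * ((x + w) - (x' + w'))
      - (x * w - 0 * 0 - (x' * w' - P * (w' * y) * (P * (x' * z)))) + P\<^sup>2 * (w' * y * x' * z)"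
    by (simp add: algebra_simps power2_eq_square)
  then have "P\<^sup>2 dvd (x - x') * (x - w')"
    using inv by (metis dvd_add dvd_diff dvd_mult dvd_triv_left)
  then show ?thesis
    using that K'(2) inv(1) by blast
qed

text \<open>Entries that differ modulo \<open>p\<close> are determined modulo \<open>p\<^sup>2\<close> by their sum and product. Entries that
  agree modulo \<open>p\<close> are only determined modulo \<open>p\<close>, which is enough to know their \<open>p\<close>-th powers.\<close>

lemma diagonals_subset:
  assumes H: "regular_split H" and K: "regular_split K" and lc: "locally_conjugate G H K"
  shows "diagonals H \<subseteq> diagonals K \<or> diagonals H \<subseteq> prod.swap ` diagonals K"
proof -
  note sH = regular_split_subgroup[OF H] and sK = regular_split_subgroup[OF K]
  note satK = mult_saturated_diagonals[OF sK]
  obtain x0 w0 where ex: "(x0, w0) \<in> diagonals H" "\<not> P dvd x0 - w0"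
    using H unfolding regular_split_def by auto
  show ?thesis
  proof (rule subset_of_union_regular[OF mult_saturated_diagonals[OF sH] satK mult_saturated_swap[OF satK] _ _ _ ex])
    fix x w assume xw: "(x, w) \<in> diagonals H"
    show "\<not> P dvd x \<and> \<not> P dvd w"
      using red_mem_unit[OF sH] xw by force
    obtain x' w' where x'w': "(x', w') \<in> diagonals K" and
      tr: "P\<^sup>2 dvd (x + w) - (x' + w')" and pr: "P\<^sup>2 dvd (x - x') * (x - w')"
      using locally_conjugate_diagonals[OF H K lc] xw by (metis mem_diagonals)
    have trp: "P dvd (x + w) - (x' + w')"
      by (rule sq_dvd_imp_dvd[OF tr])
    show "(x, w) \<in> diagonals K \<union> prod.swap ` diagonals K" if reg: "\<not> P dvd x - w"
    proof (cases "P dvd x - x'")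
      case True
      have "x - w = (x - w') + (x - x') - ((x + w) - (x' + w'))"
        by simp
      then have "\<not> P dvd x - w'"
        using reg True trp by (metis dvd_add dvd_diff)
      then have "P\<^sup>2 dvd x - x'"
        using pr cancel_mod_sq[of "x - w'" "x - x'"] by (simp add: mult.commute)
      moreover have "w - w' = ((x + w) - (x' + w')) - (x - x')"
        by simp
      ultimately have "P\<^sup>2 dvd x' - x" "P\<^sup>2 dvd w' - w"
        using tr by (metis dvd_diff dvd_diff_commute)+
      then show ?thesis
        using mult_saturatedD(3)[OF satK x'w'] by blast
    next
      case False
      then have "P\<^sup>2 dvd x - w'"
        using pr cancel_mod_sq by blast
      moreover have "w - x' = ((x + w) - (x' + w')) - (x - w')"
        by simp
      ultimately have "P\<^sup>2 dvd w' - x" "P\<^sup>2 dvd x' - w"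
        using tr by (metis dvd_diff dvd_diff_commute)+
      then have "(w, x) \<in> diagonals K"
        using mult_saturatedD(3)[OF satK x'w'] by blast
      then show ?thesis
        by (metis UnI2 image_eqI swap_simp)
    qed
    show "(x ^ p, w ^ p) \<in> diagonals K \<inter> prod.swap ` diagonals K" if sc: "P dvd x - w"
    proof -
      have eqs: "w - w' = ((x + w) - (x' + w')) - (x - x')" "w - x' = ((x + w) - (x' + w')) - (x - w')"
        "x - w' = (x - w) + (w - w')" "x - x' = (x - w) + (w - x')"
        by simp_all
      have "P dvd x - x' \<or> P dvd x - w'"
        using sq_dvd_imp_dvd[OF pr] by simp
      then have all: "P dvd x - x'" "P dvd w - w'" "P dvd x - w'" "P dvd w - x'"
        using eqs sc trp by (metis dvd_add dvd_diff)+
      then have "P\<^sup>2 dvd x' ^ p - x ^ p" "P\<^sup>2 dvd w' ^ p - w ^ p" "P\<^sup>2 dvd x' ^ p - w ^ p" "P\<^sup>2 dvd w' ^ p - x ^ p"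
        by (intro power_p_cong; simp add: dvd_diff_commute)+
      moreover have "(x' ^ p, w' ^ p) \<in> diagonals K"
        using mult_saturated_power[OF satK x'w'] p_ge_3 by simp
      ultimately have "(x ^ p, w ^ p) \<in> diagonals K" "(w ^ p, x ^ p) \<in> diagonals K"
        using mult_saturatedD(3)[OF satK] by blast+
      then show ?thesis
        by (metis IntI image_eqI swap_simp)
    qed
  qed
qed

lemma diagonals_eq:
  assumes H: "regular_split H" and K: "regular_split K" and lc: "locally_conjugate G H K"
  shows "diagonals H = diagonals K \<or> diagonals H = prod.swap ` diagonals K"
proof -
  have lc': "locally_conjugate G K H"
    by (rule locally_conjugate_sym[OF subgroup.subset[OF regular_split_subgroup[OF H]] lc])
  have swap: "A \<subseteq> prod.swap ` B \<Longrightarrow> prod.swap ` A \<subseteq> B" for A B :: "(int \<times> int) set"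
    by force
  show ?thesis
    using diagonals_subset[OF H K lc] diagonals_subset[OF K H lc'] swap
    by (smt (verit, best) image_mono subset_antisym subset_trans)
qed


section \<open>The antidiagonal part\<close>

lemma product_of_nonsquares:
  assumes a: "\<And>x. \<not> P dvd x * x - a" and b: "\<And>x. \<not> P dvd x * x - b"
  shows "\<exists>x. P dvd x * x - a * b"
proof -
  have p2: "2 < p"
    using p_ge_3 by simp
  have quad: "QuadRes P c \<longleftrightarrow> (\<exists>x. P dvd x * x - c)" for c
    by (simp add: QuadRes_def cong_iff_dvd_diff power2_eq_square)
  have "\<not> P dvd a" "\<not> P dvd b"
    using a[of 0] b[of 0] by simp_all
  then have "Legendre a P = - 1" "Legendre b P = - 1"
    using a b by (simp_all add: Legendre_def quad cong_0_iff)
  then have "[- 1 = a ^ ((p - 1) div 2)] (mod P)" "[- 1 = b ^ ((p - 1) div 2)] (mod P)"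
    using euler_criterion[OF prime_p p2, of a] euler_criterion[OF prime_p p2, of b] by simp_all
  then have "[- 1 * - 1 = a ^ ((p - 1) div 2) * b ^ ((p - 1) div 2)] (mod P)"
    by (rule cong_mult)
  then have "[Legendre (a * b) P = 1] (mod P)"
    using euler_criterion[OF prime_p p2, of "a * b"]
    by (simp add: power_mult_distrib) (metis cong_sym cong_trans)
  moreover have "\<not> [- 1 = 1] (mod P)" "\<not> [0 = 1] (mod P)"
    using not_dvd_2 not_dvd_1 by (simp_all add: cong_iff_dvd_diff)
  ultimately have "QuadRes P (a * b)"
    unfolding Legendre_def by (auto split: if_splits)
  then show ?thesis
    by (simp add: quad)
qed

text \<open>The forms \<open>s\<^sup>2 + c\<^sub>1 x\<^sup>2\<close> and \<open>s\<^sup>2 + c\<^sub>2 x\<^sup>2\<close> represent the same values modulo \<open>p\<close> by nonzero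
  vectors. Zero and the nonsquares among these values tell the degenerate, the hyperbolic and the
  anisotropic case apart.\<close>

lemma binary_forms_equivalent:
  assumes 1: "\<And>s x. \<not> (P dvd s \<and> P dvd x) \<Longrightarrow>
      \<exists>s' x'. \<not> (P dvd s' \<and> P dvd x') \<and> P dvd (s * s + x * x * c1) - (s' * s' + x' * x' * c2)"
    and 2: "\<And>s x. \<not> (P dvd s \<and> P dvd x) \<Longrightarrow>
      \<exists>s' x'. \<not> (P dvd s' \<and> P dvd x') \<and> P dvd (s * s + x * x * c2) - (s' * s' + x' * x' * c1)"
  shows "\<exists>r. \<not> P dvd r \<and> P dvd c1 - r * r * c2"
proof -
  have root: "\<exists>e. P dvd e * e + c" if "\<not> (P dvd s \<and> P dvd x)" "P dvd s * s + x * x * c" for s x c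
  proof -
    have "\<not> P dvd x"
      using that by (metis dvd_add_left_iff dvd_mult2 dvd_mult_iff)
    then obtain e where e: "P dvd x * e - s"
      using solve_mod by blast
    have "x * x * (e * e + c) = (x * e - s) * (x * e + s) + (s * s + x * x * c)"
      by (simp add: algebra_simps)
    then have "P dvd x * x * (e * e + c)"
      using e that(2) by (metis dvd_add dvd_mult2)
    then show ?thesis
      using \<open>\<not> P dvd x\<close> by auto
  qed
  have isotropic: "\<exists>e. P dvd e * e + c'"
    if T: "\<And>s x. \<not> (P dvd s \<and> P dvd x) \<Longrightarrow>
      \<exists>s' x'. \<not> (P dvd s' \<and> P dvd x') \<and> P dvd (s * s + x * x * c) - (s' * s' + x' * x' * c')"
      and e: "P dvd e * e + c" for c c' e
  proof -
    obtain s' x' where s': "\<not> (P dvd s' \<and> P dvd x')" "P dvd (e * e + 1 * 1 * c) - (s' * s' + x' * x' * c')"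
      using T[of e 1] not_dvd_1 by blast
    have "s' * s' + x' * x' * c' = (e * e + c) - ((e * e + 1 * 1 * c) - (s' * s' + x' * x' * c'))"
      by simp
    then have "P dvd s' * s' + x' * x' * c'"
      using s'(2) e by (metis dvd_diff)
    then show ?thesis
      by (rule root[OF s'(1)])
  qed
  have degenerate: "P dvd c'"
    if T: "\<And>s x. \<not> (P dvd s \<and> P dvd x) \<Longrightarrow>
      \<exists>s' x'. \<not> (P dvd s' \<and> P dvd x') \<and> P dvd (s * s + x * x * c) - (s' * s' + x' * x' * c')"
      and T': "\<And>s x. \<not> (P dvd s \<and> P dvd x) \<Longrightarrow>
      \<exists>s' x'. \<not> (P dvd s' \<and> P dvd x') \<and> P dvd (s * s + x * x * c') - (s' * s' + x' * x' * c)"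
      and c: "P dvd c" for c c'
  proof (rule ccontr)
    assume c': "\<not> P dvd c'"
    obtain e where e: "P dvd e * e + c'"
      using isotropic[OF T, of 0] c by auto
    have ue: "\<not> P dvd e"
      using e c' by (metis dvd_add_right_iff dvd_mult)
    \<comment> \<open>A hyperbolic form represents everything, in particular a nonsquare \<open>n\<close>.\<close>
    obtain n where n: "\<not> P dvd x * x - n" for x
      using nonsquare_ex by blast
    obtain h where h: "P dvd 2 * h - 1"
      using solve_mod[OF not_dvd_2] by blast
    obtain x where x: "P dvd e * x - (n - 1) * h"
      using solve_mod[OF ue] by blast
    define s where "s = (n + 1) * h"
    have val: "P dvd (s * s + x * x * c') - n"
    proof -
      have "(s * s + x * x * c') - n = x * x * (e * e + c') - (e * x - (n - 1) * h) * (e * x + (n - 1) * h)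
          + n * (2 * h - 1) * (2 * h + 1)"
        by (simp add: s_def algebra_simps)
      then show ?thesis
        using e x h by (metis dvd_add dvd_diff dvd_mult dvd_mult2)
    qed
    have "\<not> (P dvd s \<and> P dvd x)"
    proof
      assume sx: "P dvd s \<and> P dvd x"
      have "0 * 0 - n = ((s * s + x * x * c') - n) - s * s - x * (x * c')"
        by simp
      then have "P dvd 0 * 0 - n"
        using val sx by (metis dvd_diff dvd_mult2)
      then show False
        using n by blast
    qed
    then obtain s' x' where s': "P dvd (s * s + x * x * c') - (s' * s' + x' * x' * c)"
      using T' by blast
    have "s' * s' - n = ((s * s + x * x * c') - n) - ((s * s + x * x * c') - (s' * s' + x' * x' * c)) - x' * x' * c"
      by simp
    then have "P dvd s' * s' - n"
      using s' val c by (metis dvd_diff dvd_mult)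
    then show False
      using n by blast
  qed
  consider "P dvd c1" "P dvd c2" | "\<not> P dvd c1" "\<not> P dvd c2"
    using degenerate[OF 1 2] degenerate[OF 2 1] by blast
  then show ?thesis
  proof cases
    case 1
    then show ?thesis
      using not_dvd_1 by (intro exI[of _ 1]) simp
  next
    case units: 2
    have "\<exists>m. P dvd m * m - c1 * c2"
    proof (cases "\<exists>e. P dvd e * e + c1")
      case True
      then obtain e1 where e1: "P dvd e1 * e1 + c1"
        by blast
      obtain e2 where e2: "P dvd e2 * e2 + c2"
        using isotropic[OF 1 e1] by blast
      have "(e1 * e2) * (e1 * e2) - c1 * c2 = (e1 * e1 + c1) * (e2 * e2) - c1 * (e2 * e2 + c2)"
        by (simp add: algebra_simps)
      then show ?thesis
        using e1 e2 by (metis dvd_diff dvd_mult dvd_mult2)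
    next
      case False
      then have "\<not> P dvd x * x - (- c1)" "\<not> P dvd x * x - (- c2)" for x
        using isotropic[OF 2] by auto
      then show ?thesis
        using product_of_nonsquares[of "- c1" "- c2"] by simp
    qed
    then obtain m where m: "P dvd m * m - c1 * c2"
      by blast
    obtain r where r: "P dvd c2 * r - m"
      using solve_mod[OF units(2)] by blast
    have "c2 * (c1 - r * r * c2) = - (m * m - c1 * c2) - (c2 * r - m) * (c2 * r + m)"
      by (simp add: algebra_simps)
    moreover have "P dvd \<dots>"
      by (intro dvd_diff dvd_mult2[OF r]) (use m in \<open>simp only: dvd_minus_iff\<close>)
    ultimately have res: "P dvd c1 - r * r * c2"
      using units(2) dvd_mult_iff by metis
    moreover have "\<not> P dvd r"
    proof
      assume "P dvd r"
      then have "P dvd (c1 - r * r * c2) + r * r * c2"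
        using res by (intro dvd_add dvd_mult2)
      then show False
        using units(1) by simp
    qed
    ultimately show ?thesis
      by blast
  qed
qed

lemma antidiagonal_full_or_line:
  assumes H: "subgroup H G" and yz: "I_plus p (mat22 0 y1 z1 0) \<in> H"
    and ne: "I_plus p (mat22 0 t1 t2 0) \<notin> H" and y: "I_plus p (mat22 0 y z 0) \<in> H"
  shows "P dvd y * z1 - y1 * z"
proof (rule ccontr)
  assume u: "\<not> P dvd y * z1 - y1 * z"
  \<comment> \<open>Cramer's rule.\<close>
  obtain a where a: "P dvd (y * z1 - y1 * z) * a - (t1 * z1 - y1 * t2)"
    using solve_mod[OF u] by blast
  obtain b where b: "P dvd (y * z1 - y1 * z) * b - (y * t2 - t1 * z)"
    using solve_mod[OF u] by blast
  have "(y * z1 - y1 * z) * ((a * y + b * y1) - t1) =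
      ((y * z1 - y1 * z) * a - (t1 * z1 - y1 * t2)) * y + ((y * z1 - y1 * z) * b - (y * t2 - t1 * z)) * y1"
    "(y * z1 - y1 * z) * ((a * z + b * z1) - t2) =
      ((y * z1 - y1 * z) * a - (t1 * z1 - y1 * t2)) * z + ((y * z1 - y1 * z) * b - (y * t2 - t1 * z)) * z1"
    by (simp_all add: algebra_simps)
  then have "P dvd (y * z1 - y1 * z) * ((a * y + b * y1) - t1)" "P dvd (y * z1 - y1 * z) * ((a * z + b * z1) - t2)"
    using a b by (metis dvd_add dvd_mult2)+
  then have "P dvd (a * y + b * y1) - t1" "P dvd (a * z + b * z1) - t2"
    using u dvd_mult_iff by blast+
  moreover have "I_plus p (mat22 0 (a * y + b * y1) (a * z + b * z1) 0) \<in> H"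
    using I_plus_combination_mem[OF H y yz, of a b] by simp
  ultimately have "I_plus p (mat22 0 t1 t2 0) \<in> H"
    by (elim I_plus_mem_cong) (simp add: mat2_mod_mat22_eq_iff)
  then show False
    using ne by blast
qed

lemma on_line_multiple:
  assumes nz: "\<not> (P dvd y1 \<and> P dvd z1)" and line: "P dvd y * z1 - y1 * z"
  obtains x where "P dvd y - x * y1" "P dvd z - x * z1"
proof (cases "P dvd y1")
  case False
  then obtain x where x: "P dvd y1 * x - y"
    using solve_mod by blast
  have "y1 * (z - x * z1) = - (y * z1 - y1 * z) - (y1 * x - y) * z1" "y - x * y1 = - (y1 * x - y)"
    by (simp_all add: algebra_simps)
  moreover have "P dvd - (y * z1 - y1 * z) - (y1 * x - y) * z1"
    by (intro dvd_diff dvd_mult2[OF x]) (use line in \<open>simp only: dvd_minus_iff\<close>)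
  ultimately have "P dvd y1 * (z - x * z1)" "P dvd y - x * y1"
    using x by (simp_all only: dvd_minus_iff)
  then show ?thesis
    using that False by auto
next
  case True
  then have z1: "\<not> P dvd z1"
    using nz by blast
  then obtain x where x: "P dvd z1 * x - z"
    using solve_mod by blast
  have "z1 * (y - x * y1) = (y * z1 - y1 * z) - (z1 * x - z) * y1" "z - x * z1 = - (z1 * x - z)"
    by (simp_all add: algebra_simps)
  moreover have "P dvd (y * z1 - y1 * z) - (z1 * x - z) * y1"
    by (rule dvd_diff[OF line dvd_mult2[OF x]])
  ultimately have "P dvd z1 * (y - x * y1)" "P dvd z - x * z1"
    using x by (simp_all only: dvd_minus_iff)
  then show ?thesis
    using that z1 by auto
qed

lemma on_line_mem:
  assumes H: "subgroup H G" and yz: "I_plus p (mat22 0 y1 z1 0) \<in> H"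
    and nz: "\<not> (P dvd y1 \<and> P dvd z1)" and line: "P dvd y * z1 - y1 * z"
  shows "I_plus p (mat22 0 y z 0) \<in> H"
proof -
  obtain x where "P dvd y - x * y1" "P dvd z - x * z1"
    using on_line_multiple[OF nz line] .
  then have "mat2_mod p (smul x (mat22 0 y1 z1 0)) = mat2_mod p (mat22 0 y z 0)"
    by (simp add: mat2_mod_mat22_eq_iff dvd_diff_commute)
  then show ?thesis
    using I_plus_smul_mem[OF H yz] I_plus_mem_cong by blast
qed

lemma regular_split_I_plus_parts:
  assumes H: "regular_split H" and A: "I_plus p (mat22 a b c d) \<in> H"
  shows "I_plus p (mat22 a 0 0 d) \<in> H" "I_plus p (mat22 0 b c 0) \<in> H"
proof -
  note sH = regular_split_subgroup[OF H]
  have "red (mat22 (1 + P * a) (P * b) (P * c) (1 + P * d)) \<in> H"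
    using A by (simp add: I_plus_eq_red)
  then have "red (mat22 (1 + P * a) 0 0 (1 + P * d)) \<in> H"
    using regular_split_decompose[OF H] by blast
  then show d: "I_plus p (mat22 a 0 0 d) \<in> H"
    by (simp add: I_plus_eq_red)
  show "I_plus p (mat22 0 b c 0) \<in> H"
    using I_plus_combination_mem[OF sH A d, of 1 "- 1"] by simp
qed

text \<open>Traceless elements \<open>I + pA\<close> are matched with such elements, and the determinants of the matrices
  \<open>A\<close> agree. Here the matrices \<open>A\<close> are the sums of an element of the antidiagonal line and, if
  \<open>diag(1, - 1)\<close> belongs to the group, of a multiple of this matrix.\<close>

lemma traceless_determinants:
  assumes H: "regular_split H" and K: "regular_split K" and lc: "locally_conjugate G H K"
    and H1: "I_plus p (mat22 0 y1 z1 0) \<in> H"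
    and K1: "\<not> (P dvd y2 \<and> P dvd z2)" "\<And>y z. I_plus p (mat22 0 y z 0) \<in> K \<Longrightarrow> P dvd y * z2 - y2 * z"
    and s: "I_plus p (mat22 s 0 0 (- s)) \<in> H" and nz: "\<not> (P dvd s \<and> P dvd x \<or> P dvd s \<and> P dvd y1 \<and> P dvd z1)"
  obtains s' x' where "\<not> (P dvd s' \<and> P dvd x')" "I_plus p (mat22 s' 0 0 (- s')) \<in> K"
    "P dvd (s * s + x * x * (y1 * z1)) - (s' * s' + x' * x' * (y2 * z2))"
proof -
  note sH = regular_split_subgroup[OF H] and sK = regular_split_subgroup[OF K]
  let ?A = "mat22 s (x * y1) (x * z1) (- s)"
  have "I_plus p (mat22 s 0 0 (- s) + smul x (mat22 0 y1 z1 0)) \<in> H"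
    by (rule I_plus_add_mem[OF sH s I_plus_smul_mem[OF sH H1]])
  then have A: "I_plus p ?A \<in> H"
    by simp
  obtain g B where g: "\<not> P dvd det g" "I_plus p B \<in> K" "mat2_mod p (g ** ?A) = mat2_mod p (B ** g)"
    using I_plus_conj_ex[OF lc A] by blast
  obtain a b c d where B: "B = mat22 a b c d"
    using mat22_cases by blast
  note inv = conj_invariants_mod_p[OF g(1) g(3)[unfolded B]]
  have ad: "P dvd a + d"
    using inv(1) by (simp add: dvd_diff_commute add.commute)
  note BK = regular_split_I_plus_parts[OF K g(2)[unfolded B]]
  have "mat2_mod p (mat22 a 0 0 d) = mat2_mod p (mat22 a 0 0 (- a))"
    using ad by (simp add: mat2_mod_mat22_eq_iff add.commute)
  then have aK: "I_plus p (mat22 a 0 0 (- a)) \<in> K"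
    using I_plus_mem_cong[OF BK(1)] by blast
  obtain x' where x': "P dvd b - x' * y2" "P dvd c - x' * z2"
    using on_line_multiple[OF K1(1) K1(2)[OF BK(2)]] .
  have "(s * s + x * x * (y1 * z1)) - (a * a + x' * x' * (y2 * z2)) =
      - ((s * - s - x * y1 * (x * z1)) - (a * d - b * c)) - a * (a + d) + (b - x' * y2) * c + (c - x' * z2) * (x' * y2)"
    by (simp add: algebra_simps)
  moreover have "P dvd \<dots>"
    by (intro dvd_add dvd_diff dvd_mult[OF ad] dvd_mult2[OF x'(1)] dvd_mult2[OF x'(2)])
      (use inv(2) in \<open>simp only: dvd_minus_iff\<close>)
  ultimately have det: "P dvd (s * s + x * x * (y1 * z1)) - (a * a + x' * x' * (y2 * z2))"
    by (simp only:)
  have "\<not> (P dvd a \<and> P dvd x')"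
  proof
    assume *: "P dvd a \<and> P dvd x'"
    then have "P dvd b" "P dvd c" "P dvd d"
      using x' ad by (metis dvd_diff_left_iff dvd_mult2, metis dvd_diff_left_iff dvd_mult2, metis dvd_add_right_iff)
    then have "mat2_mod p B = mat2_mod p (mat22 0 0 0 0)"
      using * by (simp add: B mat2_mod_mat22_eq_iff)
    then have "mat2_mod p (g ** ?A) = mat2_mod p (mat22 0 0 0 0 ** g)"
      using g(3) mat2_mod_mult_cong[OF _ refl] by metis
    then have "conjugation G (red g) (I_plus p ?A) = I_plus p (mat22 0 0 0 0)"
      by (rule conjugation_I_plus[OF g(1)])
    then have "I_plus p ?A = \<one>\<^bsub>G\<^esub>"
      using g(1) by (simp add: conjugation_eq_iff)
    then have "I_plus p ?A = I_plus p (mat22 0 0 0 0)"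
      by simp
    then show False
      unfolding I_plus_eq_iff mat2_mod_mat22_eq_iff using nz by auto
  qed
  then show ?thesis
    using that aK det by blast
qed

text \<open>If \<open>diag(1, - 1)\<close> belongs to neither space of matrices, the matrices of trace zero form the two
  lines, and one determinant suffices. Otherwise the determinant is a binary quadratic form on the
  matrices of trace zero.\<close>

lemma antidiagonal_lines_similar:
  assumes H: "regular_split H" and K: "regular_split K" and lc: "locally_conjugate G H K"
    and D: "diagonals H = diagonals K"
    and H1: "I_plus p (mat22 0 y1 z1 0) \<in> H" "\<not> (P dvd y1 \<and> P dvd z1)"
      "\<And>y z. I_plus p (mat22 0 y z 0) \<in> H \<Longrightarrow> P dvd y * z1 - y1 * z"
    and K1: "I_plus p (mat22 0 y2 z2 0) \<in> K" "\<not> (P dvd y2 \<and> P dvd z2)"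
      "\<And>y z. I_plus p (mat22 0 y z 0) \<in> K \<Longrightarrow> P dvd y * z2 - y2 * z"
  shows "\<exists>r. \<not> P dvd r \<and> P dvd y1 * z1 - r * r * (y2 * z2)"
proof -
  note sH = regular_split_subgroup[OF H] and sK = regular_split_subgroup[OF K]
  have lc': "locally_conjugate G K H"
    by (rule locally_conjugate_sym[OF subgroup.subset[OF sH] lc])
  have J_iff: "I_plus p (mat22 s 0 0 (- s)) \<in> H \<longleftrightarrow> I_plus p (mat22 s 0 0 (- s)) \<in> K" for s
    using D by (auto simp: I_plus_eq_red set_eq_iff diagonals_def)
  show ?thesis
  proof (cases "I_plus p (mat22 1 0 0 (- 1)) \<in> H")
    case True
    then have J: "I_plus p (mat22 s 0 0 (- s)) \<in> H" for s
      using I_plus_smul_mem[OF sH True, of s] by simp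
    then have J': "I_plus p (mat22 s 0 0 (- s)) \<in> K" for s
      using J_iff by blast
    show ?thesis
    proof (rule binary_forms_equivalent)
      fix s x assume sx: "\<not> (P dvd s \<and> P dvd x)"
      show "\<exists>s' x'. \<not> (P dvd s' \<and> P dvd x') \<and>
          P dvd (s * s + x * x * (y1 * z1)) - (s' * s' + x' * x' * (y2 * z2))"
        using traceless_determinants[OF H K lc H1(1) K1(2,3) J, of s x] sx H1(2) by blast
      show "\<exists>s' x'. \<not> (P dvd s' \<and> P dvd x') \<and>
          P dvd (s * s + x * x * (y2 * z2)) - (s' * s' + x' * x' * (y1 * z1))"
        using traceless_determinants[OF K H lc' K1(1) H1(2,3) J', of s x] sx K1(2) by blast
    qed
  next
    case False
    have "I_plus p (mat22 0 0 0 (- 0)) \<in> H"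
      using I_plus_zero_mem[OF sH] by simp
    then obtain s' x' where s': "\<not> (P dvd s' \<and> P dvd x')" "I_plus p (mat22 s' 0 0 (- s')) \<in> K"
      "P dvd (0 * 0 + 1 * 1 * (y1 * z1)) - (s' * s' + x' * x' * (y2 * z2))"
      using traceless_determinants[OF H K lc H1(1) K1(2,3), of 0 1] H1(2) not_dvd_1 by blast
    have "P dvd s'"
    proof (rule ccontr)
      assume "\<not> P dvd s'"
      then obtain t where "P dvd s' * t - 1"
        using solve_mod by blast
      then have "mat2_mod p (smul t (mat22 s' 0 0 (- s'))) = mat2_mod p (mat22 1 0 0 (- 1))"
        by (simp add: mat2_mod_mat22_eq_iff mult.commute dvd_diff_commute)
      then have "I_plus p (mat22 1 0 0 (- 1)) \<in> K"
        using I_plus_smul_mem[OF sK s'(2)] I_plus_mem_cong by blast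
      then show False
        using False J_iff by blast
    qed
    moreover have "y1 * z1 - x' * x' * (y2 * z2) = ((0 * 0 + 1 * 1 * (y1 * z1)) - (s' * s' + x' * x' * (y2 * z2))) + s' * s'"
      by simp
    ultimately show ?thesis
      using s' by (metis dvd_add dvd_mult)
  qed
qed

text \<open>The permutation matrix moves \<open>E\<^sub>2\<^sub>1\<close> to \<open>E\<^sub>1\<^sub>2\<close> and exchanges the two diagonal entries, so
  it turns \<open>K\<close> into the group of the shape of \<open>H\<close> whose diagonal part is swapped.\<close>

lemma swapped_pair_of_opposite_lines:
  assumes H: "regular_split H" and K: "regular_split K" and D: "diagonals H = diagonals K"
    and H1: "I_plus p (mat22 0 1 0 0) \<in> H" "\<And>y z. I_plus p (mat22 0 y z 0) \<in> H \<Longrightarrow> P dvd z"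
    and K1: "I_plus p (mat22 0 0 1 0) \<in> K" "\<And>y z. I_plus p (mat22 0 y z 0) \<in> K \<Longrightarrow> P dvd y"
  shows "swapped_pair H K"
proof -
  note sH = regular_split_subgroup[OF H] and sK = regular_split_subgroup[OF K]
  have upper: "\<exists>x y w. X = red (mat22 x (P * y) 0 w)"
    if S: "regular_split S" "\<And>y z. I_plus p (mat22 0 y z 0) \<in> S \<Longrightarrow> P dvd z" "X \<in> S" for S X
  proof -
    obtain x w y z where X: "X = red (mat22 x (P * (w * y)) (P * (x * z)) w)" "I_plus p (mat22 0 y z 0) \<in> S"
      using regular_split_mem[OF S(1,3)] by metis
    then have "X = red (mat22 x (P * (w * y)) 0 w)"
      using S(2) by (simp add: red_eq_iff)
    then show ?thesis
      by blast
  qed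
  have "swapped_pair H (flip ` K)"
  proof (rule swapped_pairI[OF sH H1(1) _ subgroup_flip[OF sK]])
    show "\<exists>x y w. X = red (mat22 x (P * y) 0 w)" if "X \<in> H" for X
      by (rule upper[OF H _ that]) (rule H1(2))
    show "I_plus p (mat22 0 1 0 0) \<in> flip ` K"
      using K1(1) by (simp add: I_plus_flip_iff[OF sK])
    show "\<exists>x y w. X = red (mat22 x (P * y) 0 w)" if "X \<in> flip ` K" for X
      by (rule upper[OF regular_split_flip[OF K] _ that]) (use K1(2) in \<open>simp add: I_plus_flip_iff[OF sK]\<close>)
    show "red (mat22 x 0 0 w) \<in> H \<longleftrightarrow> red (mat22 w 0 0 x) \<in> flip ` K" for x w
      using D mem_flip_iff[OF sK] by (auto simp: set_eq_iff)
  qed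
  moreover have "conjugate_subgroups G K (flip ` K)"
    by (rule conjugate_subgroupsI[OF flip_carrier])
  ultimately show ?thesis
    unfolding swapped_pair_def using conjugate_subgroups_trans[OF subgroup.subset[OF sK]] by blast
qed

text \<open>If one space of antidiagonal matrices contains the other, the orders show that the groups are
  equal. Otherwise the spaces are two different lines, which a diagonal matrix conjugates to each
  other unless they are spanned by \<open>E\<^sub>1\<^sub>2\<close> and \<open>E\<^sub>2\<^sub>1\<close>.\<close>

lemma regular_resolved_same_diagonals:
  assumes H: "regular_split H" and K: "regular_split K" and lc: "locally_conjugate G H K"
    and D: "diagonals H = diagonals K"
  shows "resolved H K"
proof -
  note sH = regular_split_subgroup[OF H] and sK = regular_split_subgroup[OF K]
  have lc': "locally_conjugate G K H"
    by (rule locally_conjugate_sym[OF subgroup.subset[OF sH] lc])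
  have D': "red (mat22 x 0 0 w) \<in> H \<longleftrightarrow> red (mat22 x 0 0 w) \<in> K" for x w
    using D by (auto simp: set_eq_iff)
  have conj1: "resolved H K" if "\<And>y z. I_plus p (mat22 0 y z 0) \<in> H \<Longrightarrow> I_plus p (mat22 0 y z 0) \<in> K"
  proof -
    have "conjugate_subgroups G H K"
      by (rule regular_split_conjugateI[OF H K lc _ not_dvd_1 not_dvd_1])
        (use D' that in \<open>auto intro!: exI\<close>)
    then show ?thesis
      by (simp add: resolved_def)
  qed
  have conj2: "resolved H K" if "\<And>y z. I_plus p (mat22 0 y z 0) \<in> K \<Longrightarrow> I_plus p (mat22 0 y z 0) \<in> H"
  proof -
    have "conjugate_subgroups G K H"
      by (rule regular_split_conjugateI[OF K H lc' _ not_dvd_1 not_dvd_1])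
        (use D' that in \<open>auto intro!: exI\<close>)
    then show ?thesis
      using conjugate_subgroups_sym[OF subgroup.subset[OF sK]] by (simp add: resolved_def)
  qed
  have zero: "I_plus p (mat22 0 y z 0) \<in> S" if "subgroup S G" "P dvd y" "P dvd z" for S y z
    using I_plus_mem_cong[OF I_plus_zero_mem[OF that(1)]] that by (simp add: mat2_mod_mat22_eq_iff)
  show ?thesis
  proof (cases "\<forall>y z. I_plus p (mat22 0 y z 0) \<in> H \<longrightarrow> I_plus p (mat22 0 y z 0) \<in> K")
    case True
    then show ?thesis
      using conj1 by blast
  next
    case HK: False
    show ?thesis
    proof (cases "\<forall>y z. I_plus p (mat22 0 y z 0) \<in> K \<longrightarrow> I_plus p (mat22 0 y z 0) \<in> H")
      case True
      then show ?thesis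
        using conj2 by blast
    next
      case KH: False
      \<comment> \<open>The two spaces of antidiagonal matrices are different lines.\<close>
      obtain y1 z1 where 1: "I_plus p (mat22 0 y1 z1 0) \<in> H" "I_plus p (mat22 0 y1 z1 0) \<notin> K"
        using HK by blast
      obtain y2 z2 where 2: "I_plus p (mat22 0 y2 z2 0) \<in> K" "I_plus p (mat22 0 y2 z2 0) \<notin> H"
        using KH by blast
      have nz: "\<not> (P dvd y1 \<and> P dvd z1)" "\<not> (P dvd y2 \<and> P dvd z2)"
        using 1 2 zero[OF sH] zero[OF sK] by blast+
      note lineH = antidiagonal_full_or_line[OF sH 1(1) 2(2)]
      note lineK = antidiagonal_full_or_line[OF sK 2(1) 1(2)]
      obtain r where r: "\<not> P dvd r" "P dvd y1 * z1 - r * r * (y2 * z2)"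
        using antidiagonal_lines_similar[OF H K lc D 1(1) nz(1) lineH 2(1) nz(2) lineK] by blast
      have c_iff: "P dvd y1 * z1 \<longleftrightarrow> P dvd y2 * z2"
      proof -
        have "P dvd y1 * z1 \<longleftrightarrow> P dvd r * r * (y2 * z2)"
          using r(2) by (metis dvd_diff_left_iff dvd_diff_right_iff)
        then show ?thesis
          using r(1) by simp
      qed
      show ?thesis
      proof (cases "P dvd y1 * z1")
        case False
        then have u: "\<not> P dvd y1" "\<not> P dvd z1" "\<not> P dvd y2" "\<not> P dvd z2"
          using c_iff by auto
        have "conjugate_subgroups G H K"
        proof (rule regular_split_conjugateI[OF H K lc])
          show "red (mat22 x 0 0 w) \<in> K" if "red (mat22 x 0 0 w) \<in> H" for x w
            using that D' by blast
          show ud: "\<not> P dvd r * y2" "\<not> P dvd y1"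
            using r u by simp_all
          fix y z assume yz: "I_plus p (mat22 0 y z 0) \<in> H"
          obtain y' where y': "P dvd y1 * y' - (r * y2) * y"
            using solve_mod[OF u(1)] by blast
          obtain z' where z': "P dvd (r * y2) * z' - y1 * z"
            using solve_mod[OF ud(1)] by blast
          have "y1 * (r * y2) * (y' * z2 - y2 * z') =
              (y1 * y' - (r * y2) * y) * (r * y2 * z2) - ((r * y2) * z' - y1 * z) * (y1 * y2)
              - (y1 * z1 - r * r * (y2 * z2)) * (y2 * y) + (y * z1 - y1 * z) * (y1 * y2)"
            by (simp add: algebra_simps)
          then have "P dvd y1 * (r * y2) * (y' * z2 - y2 * z')"
            using y' z' r(2) lineH[OF yz] by (metis dvd_add dvd_diff dvd_mult2)
          then have "P dvd y' * z2 - y2 * z'"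
            using u r(1) by simp
          then have "I_plus p (mat22 0 y' z' 0) \<in> K"
            using on_line_mem[OF sK 2(1) nz(2)] by blast
          then show "\<exists>y' z'. I_plus p (mat22 0 y' z' 0) \<in> K \<and> P dvd r * y2 * y - y1 * y' \<and> P dvd y1 * z - r * y2 * z'"
            using y' z' by (metis dvd_diff_commute)
        qed
        then show ?thesis
          by (simp add: resolved_def)
      next
        case True
        then have "P dvd y1 \<or> P dvd z1" "P dvd y2 \<or> P dvd z2"
          using c_iff by auto
        then consider (E12) "P dvd z1" "\<not> P dvd y1" "P dvd y2" "\<not> P dvd z2"
          | (E21) "P dvd z2" "\<not> P dvd y2" "P dvd y1" "\<not> P dvd z1"
          | (same) "P dvd y2 * z1 - y1 * z2"
          using nz by auto
        then show ?thesis
        proof cases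
          case E12
          have "swapped_pair H K"
          proof (rule swapped_pair_of_opposite_lines[OF H K D])
            show "I_plus p (mat22 0 1 0 0) \<in> H"
              by (rule on_line_mem[OF sH 1(1) nz(1)]) (use E12 in simp)
            show "I_plus p (mat22 0 0 1 0) \<in> K"
              by (rule on_line_mem[OF sK 2(1) nz(2)]) (use E12 in simp)
            show "P dvd z" if "I_plus p (mat22 0 y z 0) \<in> H" for y z
              using lineH[OF that] E12 by (metis dvd_diff_right_iff dvd_mult dvd_mult_iff)
            show "P dvd y" if "I_plus p (mat22 0 y z 0) \<in> K" for y z
              using lineK[OF that] E12 by (metis dvd_diff_left_iff dvd_mult2 dvd_mult_iff)
          qed
          then show ?thesis
            by (simp add: resolved_def)
        next
          case E21
          have "swapped_pair K H"
          proof (rule swapped_pair_of_opposite_lines[OF K H D[symmetric]])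
            show "I_plus p (mat22 0 1 0 0) \<in> K"
              by (rule on_line_mem[OF sK 2(1) nz(2)]) (use E21 in simp)
            show "I_plus p (mat22 0 0 1 0) \<in> H"
              by (rule on_line_mem[OF sH 1(1) nz(1)]) (use E21 in simp)
            show "P dvd z" if "I_plus p (mat22 0 y z 0) \<in> K" for y z
              using lineK[OF that] E21 by (metis dvd_diff_right_iff dvd_mult dvd_mult_iff)
            show "P dvd y" if "I_plus p (mat22 0 y z 0) \<in> H" for y z
              using lineH[OF that] E21 by (metis dvd_diff_left_iff dvd_mult2 dvd_mult_iff)
          qed
          then show ?thesis
            using swapped_pair_sym by (simp add: resolved_def)
        next
          case same
          then show ?thesis
            using on_line_mem[OF sH 1(1) nz(1)] 2(2) by blast
        qed
      qed
    qed
  qed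
qed

lemma regular_resolved:
  assumes H: "regular_split H" and K: "regular_split K" and lc: "locally_conjugate G H K"
  shows "resolved H K"
  using diagonals_eq[OF H K lc]
proof
  assume "diagonals H = diagonals K"
  then show ?thesis
    by (rule regular_resolved_same_diagonals[OF H K lc])
next
  note sH = regular_split_subgroup[OF H] and sK = regular_split_subgroup[OF K]
  assume D: "diagonals H = prod.swap ` diagonals K"
  have "(x, w) \<in> diagonals H \<longleftrightarrow> (x, w) \<in> diagonals (flip ` K)" for x w
    unfolding D mem_swap_diagonals mem_diagonals mem_flip_iff[OF sK] ..
  then have D': "diagonals H = diagonals (flip ` K)"
    by auto
  have KK': "conjugate_subgroups G K (flip ` K)"
    by (rule conjugate_subgroupsI[OF flip_carrier])
  have "locally_conjugate G H (flip ` K)"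
    using locally_conjugate_trans[OF subgroup.subset[OF sH] lc]
      conjugate_imp_locally_conjugate[OF subgroup.subset[OF sK] KK'] by blast
  then have "resolved H (flip ` K)"
    by (rule regular_resolved_same_diagonals[OF H regular_split_flip[OF K] _ D'])
  then show ?thesis
    by (rule resolved_conjugate[OF sH sK conjugate_subgroups_refl[OF subgroup.subset[OF sH]] KK'])
qed

section \<open>Conclusion\<close>

lemma scalar_mod_p_locally_conjugate:
  assumes H: "scalar_mod_p H" and K: "subgroup K G" and lc: "locally_conjugate G K H"
  shows "scalar_mod_p K"
  unfolding scalar_mod_p_def
proof (intro conjI[OF K] allI impI)
  fix a b c d assume X: "red (mat22 a b c d) \<in> K"
  obtain g where g: "g \<in> carrier G" "conjugation G g (red (mat22 a b c d)) \<in> H"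
    using locally_conjugateE[OF lc X] by blast
  have "red (mat22 a b c d) \<in> conjugation G (inv\<^bsub>G\<^esub> g) ` H"
    using g subgroup.mem_carrier[OF K X] by (intro image_eqI[OF _ g(2)]) simp
  moreover have "scalar_mod_p (conjugation G (inv\<^bsub>G\<^esub> g) ` H)"
    using g by (intro scalar_mod_p_conjugation[OF H]) simp
  ultimately show "P dvd b \<and> P dvd c \<and> P dvd a - d"
    unfolding scalar_mod_p_def by blast
qed

lemma locally_conjugate_resolved:
  assumes H: "diagonal_mod_p H" and K: "diagonal_mod_p K" and lc: "locally_conjugate G H K"
  shows "resolved H K"
proof -
  note sH = diagonal_mod_p_subgroup[OF H] and sK = diagonal_mod_p_subgroup[OF K]
  have lc': "locally_conjugate G K H"
    by (rule locally_conjugate_sym[OF subgroup.subset[OF sH] lc])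
  show ?thesis
  proof (cases "scalar_mod_p H")
    case True
    then show ?thesis
      using scalar_mod_p_locally_conjugate[OF True sK lc'] by (intro scalar_resolved lc)
  next
    case False
    then have "\<not> scalar_mod_p K"
      using scalar_mod_p_locally_conjugate[OF _ sH lc] by blast
    have ex: "\<exists>g\<in>carrier G. regular_split (conjugation G g ` S)"
      if S: "diagonal_mod_p S" "\<not> scalar_mod_p S" for S
    proof -
      obtain a b c d where "red (mat22 a b c d) \<in> S" "\<not> P dvd a - d"
        using S unfolding scalar_mod_p_def diagonal_mod_p_def by blast
      then show ?thesis
        using regular_split_ex[OF S(1)] by blast
    qed
    obtain g h where g: "g \<in> carrier G" "regular_split (conjugation G g ` H)"
      and h: "h \<in> carrier G" "regular_split (conjugation G h ` K)"
      using ex[OF H False] ex[OF K \<open>\<not> scalar_mod_p K\<close>] by blast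
    note HH' = conjugate_subgroupsI[OF g(1), of H] and KK' = conjugate_subgroupsI[OF h(1), of K]
    have sH': "conjugation G g ` H \<subseteq> carrier G"
      using regular_split_subgroup[OF g(2)] subgroup.subset by blast
    have "locally_conjugate G (conjugation G g ` H) H"
      using locally_conjugate_sym conjugate_imp_locally_conjugate HH' subgroup.subset[OF sH] by blast
    moreover have "locally_conjugate G K (conjugation G h ` K)"
      using conjugate_imp_locally_conjugate KK' subgroup.subset[OF sK] by blast
    ultimately have "locally_conjugate G (conjugation G g ` H) (conjugation G h ` K)"
      using locally_conjugate_trans[OF sH'] lc by blast
    then have "resolved (conjugation G g ` H) (conjugation G h ` K)"
      by (rule regular_resolved[OF g(2) h(2)])
    then show ?thesis
      by (rule resolved_conjugate[OF sH sK HH' KK'])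
  qed
qed

lemma nontrivially_locally_conjugate_iff:
  assumes H: "diagonal_mod_p H" and K: "diagonal_mod_p K"
  shows "nontrivially_locally_conjugate G H K \<longleftrightarrow>
    (\<exists>D D'. subgroup D G \<and> subgroup D' G \<and> D \<subseteq> split_Cartan (p\<^sup>2) \<and> D' \<subseteq> split_Cartan (p\<^sup>2) \<and>
      diagonal_swaps D D' \<and> D \<noteq> D' \<and>
      conjugate_subgroups G H (upper_group D) \<and> conjugate_subgroups G K (upper_group D'))"
    (is "?L \<longleftrightarrow> ?R")
proof
  note sH = diagonal_mod_p_subgroup[OF H] and sK = diagonal_mod_p_subgroup[OF K]
  note cH = subgroup.subset[OF sH] and cK = subgroup.subset[OF sK]
  {
    assume L: ?L
    then have "swapped_pair H K"
      using locally_conjugate_resolved[OF H K] unfolding nontrivially_locally_conjugate_def resolved_def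
      by blast
    moreover have "\<not> (conjugate_subgroups G H U \<and> conjugate_subgroups G K U)" for U
      using L conjugate_subgroups_trans[OF cH] conjugate_subgroups_sym[OF cK]
      unfolding nontrivially_locally_conjugate_def by blast
    ultimately show ?R
      unfolding swapped_pair_def by blast
  }
  assume ?R
  then obtain D D' where D: "subgroup D G" "D \<subseteq> split_Cartan (p\<^sup>2)" and D': "subgroup D' G" "D' \<subseteq> split_Cartan (p\<^sup>2)"
    and sw: "diagonal_swaps D D'" "D \<noteq> D'"
    and conj: "conjugate_subgroups G H (upper_group D)" "conjugate_subgroups G K (upper_group D')"
    by blast
  note cU = subgroup.subset[OF subgroup_upper_group[OF D]]
  have "locally_conjugate G (upper_group D) (upper_group D')"
    using upper_group_locally_conjugate[OF D] sw(1) unfolding diagonal_swaps_iff[OF D(2) D'(2)] by blast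
  then have "locally_conjugate G H K"
    using locally_conjugate_trans[OF cH] conjugate_imp_locally_conjugate[OF cH conj(1)]
      locally_conjugate_sym[OF cK conjugate_imp_locally_conjugate[OF cK conj(2)]] by blast
  moreover have "\<not> conjugate_subgroups G H K"
  proof
    assume "conjugate_subgroups G H K"
    then have "conjugate_subgroups G (upper_group D) (upper_group D')"
      using conjugate_subgroups_trans[OF cU conjugate_subgroups_sym[OF cH conj(1)]]
        conjugate_subgroups_trans[OF cH _ conj(2)] by blast
    then show False
      using upper_group_conjugate_imp_eq[OF D D'] sw(2) by blast
  qed
  ultimately show ?L
    by (simp add: nontrivially_locally_conjugate_def)
qed

lemma diagonal_mod_pI:
  assumes H: "subgroup H G" and sub: "mat2_mod p ` H \<subseteq> split_Cartan p"
  shows "diagonal_mod_p H"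
  unfolding diagonal_mod_p_def
proof (intro conjI[OF H] allI impI)
  fix a b c d assume "red (mat22 a b c d) \<in> H"
  then have "mat2_mod p (red (mat22 a b c d)) \<in> split_Cartan p"
    using sub by blast
  then obtain w z where "mat2_mod p (red (mat22 a b c d)) = mat22 w 0 0 z"
    unfolding split_Cartan_def diag2_eq_mat22 by blast
  moreover have "mat2_mod p (red (mat22 a b c d)) = mat2_mod p (mat22 a b c d)"
    by (rule red_cong_mod_p) simp
  ultimately have "mat2_mod p (mat22 a b c d) = mat22 w 0 0 z"
    by simp
  then have "b mod P = 0" "c mod P = 0"
    by (metis mat22_nth(2,3) mat2_mod_nth)+
  then show "P dvd b \<and> P dvd c"
    by auto
qed

end

theorem proposition10:
  fixes p :: nat and H\<^sub>1 H\<^sub>2 :: "(int^2^2) set"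
  assumes "prime p" and "odd p"
    and "subgroup H\<^sub>1 (GL2 (p\<^sup>2))" and "subgroup H\<^sub>2 (GL2 (p\<^sup>2))"
    and "mat2_mod p ` H\<^sub>1 \<subseteq> split_Cartan p" and "mat2_mod p ` H\<^sub>2 \<subseteq> split_Cartan p"
  shows "nontrivially_locally_conjugate (GL2 (p\<^sup>2)) H\<^sub>1 H\<^sub>2 \<longleftrightarrow>
    (\<exists>D D'. subgroup D (GL2 (p\<^sup>2)) \<and> subgroup D' (GL2 (p\<^sup>2)) \<and>
       D \<subseteq> split_Cartan (p\<^sup>2) \<and> D' \<subseteq> split_Cartan (p\<^sup>2) \<and>
       diagonal_swaps D D' \<and> D \<noteq> D' \<and>
       (let K = generate (GL2 (p\<^sup>2)) (D \<union> {I_plus p E12});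
            K' = generate (GL2 (p\<^sup>2)) (D' \<union> {I_plus p E12})
        in conjugate_subgroups (GL2 (p\<^sup>2)) H\<^sub>1 K \<and> conjugate_subgroups (GL2 (p\<^sup>2)) H\<^sub>2 K' \<or>
           conjugate_subgroups (GL2 (p\<^sup>2)) H\<^sub>1 K' \<and> conjugate_subgroups (GL2 (p\<^sup>2)) H\<^sub>2 K))"
    (is "_ \<longleftrightarrow> ?R")
proof -
  interpret odd_prime p
    by unfold_locales (use assms in auto)
  let ?Q = "\<lambda>D D'. subgroup D G \<and> subgroup D' G \<and> D \<subseteq> split_Cartan (p\<^sup>2) \<and> D' \<subseteq> split_Cartan (p\<^sup>2) \<and>
      diagonal_swaps D D' \<and> D \<noteq> D'"
  have sym: "?Q D D' \<longleftrightarrow> ?Q D' D" for D D'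
    unfolding diagonal_swaps_def by blast
  have "?R \<longleftrightarrow> (\<exists>D D'. ?Q D D' \<and>
      (conjugate_subgroups G H\<^sub>1 (upper_group D) \<and> conjugate_subgroups G H\<^sub>2 (upper_group D') \<or>
       conjugate_subgroups G H\<^sub>1 (upper_group D') \<and> conjugate_subgroups G H\<^sub>2 (upper_group D)))"
    unfolding Let_def by (intro ex_cong1) (metis generate_eq_upper_group)
  also have "\<dots> \<longleftrightarrow> (\<exists>D D'. ?Q D D' \<and>
      conjugate_subgroups G H\<^sub>1 (upper_group D) \<and> conjugate_subgroups G H\<^sub>2 (upper_group D'))"
    using sym by blast
  also have "\<dots> \<longleftrightarrow> nontrivially_locally_conjugate G H\<^sub>1 H\<^sub>2"
    using nontrivially_locally_conjugate_iff[OF diagonal_mod_pI diagonal_mod_pI] assms(3-6) by simp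
  finally show ?thesis
    by blast
qed

end
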